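(* Let $u\in\mathcal{L}(\mathbb{C}^n)$ and $x\in\mathbb{C}^n$. For $m\in\mathbb{N}$ put $(\mathcal{T}_{m,x}u)(z)=m^{-1}u(x+z^m)$, where $z^m=(z_1^m,\dots,z_n^m)$. Then $\mathcal{T}_{m,x}u\to\Psi_{u,x}$ in $L^1_{loc}(\mathbb{C}^n)$ as $m\to+\infty$.
   Context: Plurisubharmonic functions are, as usual, not identically $-\infty$. $\mathcal{L}=\mathcal{L}(\mathbb{C}^n)$ is the class of plurisubharmonic functions $u$ on $\mathbb{C}^n$ with $u(z)\le C_1\log^+|z|+C_2$ for all $z$, for some constants $C_1,C_2\ge0$ depending on $u$. For $u\in\mathcal{L}$, $x\in\mathbb{C}^n$, $t\in\mathbb{R}^n$, let $g'(u,x,t)$ be the maximum of $u$ on $\{z:|z_k-x_k|=e^{t_k},\ 1\le k\le n\}$, and $\psi_{u,x}(t)=\lim_{R\to+\infty}R^{-1}g'(u,x,Rt)$ (the limit exists and is finite). The indicator of $u$ at $x$ is the function $\Psi_{u,x}\in\mathcal{L}$ given by $\Psi_{u,x}(y)=\psi_{u,x}(\log|y_1|,\dots,\log|y_n|)$ for $y_1\cdots y_n\neq0$, extended (uniquely) to a plurisubharmonic function on $\mathbb{C}^n$. *)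

theory Defs
  imports "HOL-Analysis.Analysis"
begin

definition usc :: "('a::topological_space \<Rightarrow> ereal) \<Rightarrow> bool" where
  "usc u \<longleftrightarrow> (\<forall>c. open {z. u z < c})"

text \<open>The mean \<open>(2\<pi>)\<^sup>-\<^sup>1 \<integral> f(\<theta>) d\<theta>\<close> over \<open>[0, 2\<pi>]\<close> of an extended real function, as positive part
  minus negative part (\<^const>\<open>e2ennreal\<close> truncates at 0). It is meaningful, with values in
  \<open>[-\<infinity>, \<infinity>)\<close>, whenever \<open>f\<close> is measurable and bounded above, in particular for \<open>f\<close> upper
  semicontinuous and \<open>< \<infinity>\<close>.\<close>

definition circle_mean :: "(real \<Rightarrow> ereal) \<Rightarrow> ereal" where
  "circle_mean f =
     (enn2ereal (\<integral>\<^sup>+\<theta>\<in>{0..2*pi}. e2ennreal (f \<theta>) \<partial>lborel)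
      - enn2ereal (\<integral>\<^sup>+\<theta>\<in>{0..2*pi}. e2ennreal (- f \<theta>) \<partial>lborel)) / ereal (2 * pi)"

text \<open>The sub-mean value inequality is required on all circles in all complex lines
  \<open>{a + \<zeta> b}\<close>; the radius is absorbed in \<open>b\<close>.\<close>

definition psh :: "(complex ^ 'n \<Rightarrow> ereal) \<Rightarrow> bool" where
  "psh u \<longleftrightarrow> usc u \<and> (\<forall>z. u z < \<infinity>) \<and> (\<exists>z. u z \<noteq> -\<infinity>) \<and>
     (\<forall>a b. u a \<le> circle_mean (\<lambda>\<theta>. u (a + cis \<theta> *s b)))"

definition log_class :: "(complex ^ 'n \<Rightarrow> ereal) set" where
  "log_class = {u. psh u \<and>
     (\<exists>C1\<ge>0. \<exists>C2\<ge>0. \<forall>z. u z \<le> ereal (C1 * ln (max 1 (norm z)) + C2))}"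

text \<open>The supremum below is a maximum for \<open>u\<close> upper semicontinuous, the torus being compact.\<close>

definition torus_max :: "(complex ^ 'n \<Rightarrow> ereal) \<Rightarrow> complex ^ 'n \<Rightarrow> real ^ 'n \<Rightarrow> ereal" where
  "torus_max u x t = (SUP z\<in>{z. \<forall>k. norm (z $ k - x $ k) = exp (t $ k)}. u z)"

definition local_indicator :: "(complex ^ 'n \<Rightarrow> ereal) \<Rightarrow> complex ^ 'n \<Rightarrow> real ^ 'n \<Rightarrow> ereal" where
  "local_indicator u x t = Lim at_top (\<lambda>R::real. torus_max u x (R *\<^sub>R t) / ereal R)"

definition indicator_psh :: "(complex ^ 'n \<Rightarrow> ereal) \<Rightarrow> complex ^ 'n \<Rightarrow> complex ^ 'n \<Rightarrow> ereal" where
  "indicator_psh u x = (THE F. psh F \<and>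
     (\<forall>y. (\<forall>k. y $ k \<noteq> 0) \<longrightarrow> F y = local_indicator u x (\<chi> k. ln (norm (y $ k)))))"

text \<open>Only \<open>m \<ge> 1\<close> is meaningful; sequences of these functions are indexed as \<open>T_op (Suc m)\<close>.\<close>

definition T_op :: "nat \<Rightarrow> complex ^ 'n \<Rightarrow> (complex ^ 'n \<Rightarrow> ereal) \<Rightarrow> complex ^ 'n \<Rightarrow> ereal" where
  "T_op m x u z = u (x + (\<chi> k. (z $ k) ^ m)) / ereal (real m)"

text \<open>Functions are extended real valued. Members of \<open>L1_loc\<close> are finite almost everywhere, so
  the convention for \<open>\<infinity> - \<infinity>\<close> plays no role in \<open>L1_loc_tendsto\<close>.\<close>

definition L1_loc :: "('a::euclidean_space \<Rightarrow> ereal) set" where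
  "L1_loc = {f. f \<in> borel_measurable lborel \<and>
     (\<forall>K. compact K \<longrightarrow> (\<integral>\<^sup>+z\<in>K. e2ennreal \<bar>f z\<bar> \<partial>lborel) < \<infinity>)}"

definition L1_loc_tendsto ::
    "(nat \<Rightarrow> 'a::euclidean_space \<Rightarrow> ereal) \<Rightarrow> ('a \<Rightarrow> ereal) \<Rightarrow> bool" where
  "L1_loc_tendsto f F \<longleftrightarrow> (\<forall>m. f m \<in> L1_loc) \<and> F \<in> L1_loc \<and>
     (\<forall>K. compact K \<longrightarrow>
       (\<lambda>m. \<integral>\<^sup>+z\<in>K. e2ennreal \<bar>f m z - F z\<bar> \<partial>lborel) \<longlonglongrightarrow> 0)"

end

theory Submission
  imports Defs "HOL-Complex_Analysis.Cauchy_Integral_Formula"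
begin

text \<open>Translate so that \<open>x = 0\<close>. The maximum \<open>v t\<close> of \<open>u\<close> over the torus of radii
\<open>exp (t $ k)\<close> is a convex function of \<open>t\<close> (\<open>psh_three_tori\<close>, a three circles theorem), and the growth
condition makes it Lipschitz and increasing in every variable. Hence the slopes
\<open>(v (R *\<^sub>R t) - v 0) / R\<close> increase with \<open>R\<close> to \<open>psi t\<close>, a convex increasing function. So
\<open>log_psh psi\<close>, the function equal to \<open>psi (ln_vec y)\<close> off the coordinate hyperplanes, is
plurisubharmonic by Jensen's inequality (\<open>psh_log_psh\<close>). A plurisubharmonic function is determined by its
values off the hyperplanes (\<open>psh_eq_off_axes\<close>), so this is the indicator.

Monotonicity of the slopes gives at once the upper bound
\<open>u (z^m) / m \<le> psi (ln_vec z) + v 0 / m\<close>. The difference of the two sides, called the defect, is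
therefore nonnegative and only the integral of the defect over polydiscs has to be shown to tend to 0.
The defect is small on average because \<open>u\<close>, scaled to have radius 1 at the torus of
\<open>a = z^m\<close>, attains \<open>v (m *\<^sub>R ln_vec z)\<close> on the unit torus and exceeds it by at most a
constant on a larger polydisc. The sub-mean value inequality over a polydisc about the maximum point is a
Harnack inequality (\<open>psh_polydisc_harnack\<close>): it bounds the average of
\<open>v (m *\<^sub>R ln_vec z) - u (a \<xi>)\<close> over \<open>\<xi>\<close> in the unit polydisc by a constant independent of
\<open>m\<close> and \<open>z\<close>. After division by \<open>m\<close> this vanishes, up to the difference between
\<open>psi\<close> and the slope of \<open>v\<close> at \<open>m\<close>.

Since \<open>z^m \<xi>\<close> is the \<open>m\<close>-th power of \<open>\<eta> z\<close>, where \<open>\<eta>\<close> is a root of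
\<open>\<xi>\<close>, this is a bound for the average of the defect over the points \<open>\<eta> z\<close>
(\<open>defect_polydisc_mean\<close>). Integrating also over \<open>z\<close>, exchanging the integrals, and using that
\<open>z \<mapsto> \<eta> z\<close> contracts volume for \<open>|\<eta>| \<le> 1\<close>, one recovers the plain integral of the
defect (\<open>defect_integral_le\<close>). The bounds converge to 0 by dominated convergence. The dominating function
is a multiple of \<open>norm (ln_vec z)\<close>, which is locally integrable, again by the Harnack inequality, now
applied to the functions \<open>ln |z_k|\<close>.\<close>

section \<open>Circle means and the sub-mean value inequality\<close>

text \<open>The truncations in \<open>circle_mean\<close> split \<open>f\<close> and \<open>M - f\<close> into positive and negative
parts. This identity, arranged so that no subtraction occurs, relates the two splittings and can be
integrated termwise.\<close>

lemma e2ennreal_real_decomp: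
  fixes f :: ereal
  assumes "f \<le> ereal M"
  shows "e2ennreal f + e2ennreal (ereal M - f) + ennreal (- M) = ennreal M + e2ennreal (- f)"
proof (cases f)
  case (real r)
  with assms have "r \<le> M" by simp
  have "ennreal r + ennreal (M - r) + ennreal (- M) = ennreal M + ennreal (- r)"
    using \<open>r \<le> M\<close>
    by (cases "0 \<le> r"; cases "0 \<le> M") (auto simp: ennreal_neg simp flip: ennreal_plus)
  then show ?thesis using real by simp
next
  case PInf
  with assms show ?thesis by simp
next
  case MInf
  then show ?thesis by (simp add: e2ennreal_neg)
qed

text \<open>Inequalities for the mean of a function bounded by \<open>M\<close> become upper bounds for the integral of the
nonnegative function \<open>M - f\<close>, for which Tonelli's theorem and monotone convergence hold without
integrability conditions.\<close>

lemma le_circle_mean_iff: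
  fixes f :: "real \<Rightarrow> ereal"
  assumes [measurable]: "f \<in> borel_measurable borel" and M: "\<And>\<theta>. \<theta> \<in> {0..2*pi} \<Longrightarrow> f \<theta> \<le> ereal M"
    and c: "c \<le> ereal M"
  shows "c \<le> circle_mean f \<longleftrightarrow>
    (\<integral>\<^sup>+\<theta>\<in>{0..2*pi}. e2ennreal (ereal M - f \<theta>) \<partial>lborel) \<le> ennreal (2*pi) * e2ennreal (ereal M - c)"
proof -
  define P where "P = (\<integral>\<^sup>+\<theta>\<in>{0..2*pi}. e2ennreal (f \<theta>) \<partial>lborel)"
  define N where "N = (\<integral>\<^sup>+\<theta>\<in>{0..2*pi}. e2ennreal (- f \<theta>) \<partial>lborel)"
  define G where "G = (\<integral>\<^sup>+\<theta>\<in>{0..2*pi}. e2ennreal (ereal M - f \<theta>) \<partial>lborel)"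
  have I: "(\<integral>\<^sup>+\<theta>\<in>{0..2*pi}. ennreal a \<partial>lborel) = ennreal (2*pi*a)" for a
    by (cases "a \<ge> 0") (auto simp: nn_integral_cmult_indicator ennreal_mult[symmetric] mult.commute
        ennreal_neg mult_nonneg_nonpos)
  have "P + G + ennreal (2*pi*(-M)) = (\<integral>\<^sup>+\<theta>\<in>{0..2*pi}. (e2ennreal (f \<theta>) + e2ennreal (ereal M - f \<theta>) + ennreal (- M)) \<partial>lborel)"
    unfolding P_def G_def I[symmetric]
    by (simp add: nn_integral_add[symmetric] distrib_right)
  also have "\<dots> = (\<integral>\<^sup>+\<theta>\<in>{0..2*pi}. (ennreal M + e2ennreal (- f \<theta>)) \<partial>lborel)"
    by (intro nn_integral_cong) (auto simp: indicator_def e2ennreal_real_decomp[OF M])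
  also have "\<dots> = ennreal (2*pi*M) + N"
    unfolding N_def I[symmetric] by (simp add: nn_integral_add[symmetric] distrib_right)
  finally have eq: "P + G + ennreal (2*pi*(-M)) = ennreal (2*pi*M) + N" .
  have "P \<le> (\<integral>\<^sup>+\<theta>\<in>{0..2*pi}. ennreal M \<partial>lborel)"
    unfolding P_def using M
    by (intro nn_integral_mono) (auto simp: indicator_def simp flip: e2ennreal_ereal intro!: e2ennreal_mono)
  then have Pfin: "P \<noteq> top" unfolding I by (auto simp: top_unique)
  have cm: "circle_mean f = (enn2ereal P - enn2ereal N) / ereal (2*pi)"
    by (simp add: circle_mean_def P_def N_def)
  obtain p where p: "P = ennreal p" "p \<ge> 0" using Pfin by (cases P) auto
  have "c \<le> circle_mean f \<longleftrightarrow> G \<le> ennreal (2*pi) * e2ennreal (ereal M - c)"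
  proof (cases N)
    case top
    have "G = top" using eq top p by (cases G) (auto simp flip: ennreal_plus simp: add_top)
    show ?thesis
    proof (cases c)
      case (real r) then show ?thesis unfolding cm using \<open>G = top\<close> top p by (simp add: ennreal_mult[symmetric] ennreal_mult_eq_top_iff top_unique)
    next
      case PInf then show ?thesis using c by simp
    next
      case MInf then show ?thesis using \<open>G = top\<close> by (simp add: ennreal_mult_top)
    qed
  next
    case (real n)
    have "ennreal (2*pi*M) + N \<noteq> top" using real by simp
    then have "G \<noteq> top" unfolding eq[symmetric] by auto
    then obtain g where g: "G = ennreal g" "g \<ge> 0" by (cases G) auto
    have gg: "p - n = 2*pi*M - g"
    proof (cases "M \<ge> 0")
      case True
      then have "ennreal (p + g) = ennreal (2*pi*M + n)" "2*pi*M \<ge> 0"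
        using eq p g real by (simp_all add: ennreal_neg)
      then show ?thesis using p g real by (subst (asm) ennreal_inj) auto
    next
      case False
      then have "2*pi*M \<le> 0" by (simp add: mult_nonneg_nonpos)
      then have "ennreal (p + g + 2*pi*(-M)) = ennreal n"
        using eq p g real ennreal_plus[of "p + g" "2*pi*(-M)"] by (simp add: ennreal_neg)
      moreover have "0 \<le> p + g + 2*pi*(-M)" using \<open>2*pi*M \<le> 0\<close> p g by linarith
      ultimately have "p + g + 2*pi*(-M) = n" using real by (subst (asm) ennreal_inj) auto
      then show ?thesis by linarith
    qed
    have cm': "circle_mean f = ereal ((2*pi*M - g)/(2*pi))"
      unfolding cm p real using p real by (simp add: gg)
    show ?thesis
    proof (cases c)
      case r: (real r)
      then have "r \<le> M" using c by simp
      then show ?thesis unfolding cm' r g using g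
        by (simp add: ennreal_mult[symmetric] ennreal_le_iff field_simps)
    next
      case PInf then show ?thesis using c by simp
    next
      case MInf then show ?thesis by (simp add: ennreal_mult_top)
    qed
  qed
  then show ?thesis by (simp add: G_def)
qed

lemma usc_borel_measurable:
  assumes "usc u" shows "u \<in> borel_measurable borel"
  using assms unfolding usc_def
  by (intro borel_measurableI_less) auto

lemma circle_mean_mono:
  assumes "\<And>\<theta>. \<theta> \<in> {0..2*pi} \<Longrightarrow> f \<theta> \<le> g \<theta>"
  shows "circle_mean f \<le> circle_mean g"
  unfolding circle_mean_def using assms
  by (intro ereal_divide_right_mono ereal_minus_mono nn_integral_mono less_eq_ennreal.rep_eq[THEN iffD1])
     (auto simp: indicator_def intro!: e2ennreal_mono)

lemma circle_mean_real:
  fixes g :: "real \<Rightarrow> real"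
  assumes g: "continuous_on {0..2*pi} g"
  shows "circle_mean (\<lambda>\<theta>. ereal (g \<theta>)) = ereal (integral {0..2*pi} g / (2*pi))"
proof -
  define P where "P = (\<integral>\<^sup>+\<theta>\<in>{0..2*pi}. e2ennreal (ereal (g \<theta>)) \<partial>lborel)"
  define N where "N = (\<integral>\<^sup>+\<theta>\<in>{0..2*pi}. e2ennreal (- ereal (g \<theta>)) \<partial>lborel)"
  define h where "h = (\<lambda>\<theta>. indicator {0..2*pi} \<theta> *\<^sub>R g \<theta>)"
  have si: "set_integrable lborel {0..2*pi} g"
    by (rule borel_integrable_atLeastAtMost'[OF g])
  then have int: "integrable lborel h" unfolding h_def set_integrable_def .
  have "integral\<^sup>L lborel h = integral {0..2*pi} g"
    using set_borel_integral_eq_integral(2)[OF si] by (simp add: h_def set_lebesgue_integral_def)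
  moreover have "integral\<^sup>L lborel h = enn2real (\<integral>\<^sup>+ x. ennreal (h x) \<partial>lborel) - enn2real (\<integral>\<^sup>+ x. ennreal (- h x) \<partial>lborel)"
    by (rule real_lebesgue_integral_def[OF int])
  moreover have "(\<integral>\<^sup>+ x. ennreal (h x) \<partial>lborel) = (\<integral>\<^sup>+\<theta>\<in>{0..2*pi}. e2ennreal (ereal (g \<theta>)) \<partial>lborel)"
    by (intro nn_integral_cong) (auto simp: h_def indicator_def)
  moreover have "(\<integral>\<^sup>+ x. ennreal (- h x) \<partial>lborel) = (\<integral>\<^sup>+\<theta>\<in>{0..2*pi}. e2ennreal (- ereal (g \<theta>)) \<partial>lborel)"
    by (intro nn_integral_cong) (auto simp: h_def indicator_def)
  moreover have "(\<integral>\<^sup>+ x. ennreal (h x) \<partial>lborel) < \<infinity>" "(\<integral>\<^sup>+ x. ennreal (- h x) \<partial>lborel) < \<infinity>"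
    using int unfolding real_integrable_def by (auto simp: less_top)
  ultimately have "enn2real P - enn2real N = integral {0..2*pi} g" "P < \<infinity>" "N < \<infinity>"
    unfolding P_def N_def by simp_all
  then have "enn2ereal P - enn2ereal N = ereal (integral {0..2*pi} g)"
    by (cases P; cases N) auto
  then show ?thesis unfolding circle_mean_def P_def N_def by simp
qed

lemma continuous_on_circle_vec:
  "continuous_on S (\<lambda>\<theta>. a + cis \<theta> *s (b :: complex^'n))"
  unfolding vector_scalar_mult_def by (intro continuous_intros)

lemma circle_vec_measurable [measurable]:
  "(\<lambda>\<theta>. a + cis \<theta> *s (b :: complex^'n)) \<in> borel_measurable borel"
  by (intro borel_measurable_continuous_onI continuous_on_circle_vec)

lemma psh_measurable: "psh u \<Longrightarrow> u \<in> borel_measurable borel"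
  by (simp add: psh_def usc_borel_measurable)

lemma psh_le_circle:
  assumes u: "psh u" and le: "\<And>\<theta>. u (a + cis \<theta> *s b) \<le> c"
  shows "u a \<le> c"
proof -
  have *: "u a \<le> ereal r" if "c \<le> ereal r" for r
  proof -
    have "u a \<le> circle_mean (\<lambda>\<theta>. u (a + cis \<theta> *s b))" using u by (simp add: psh_def)
    also have "\<dots> \<le> circle_mean (\<lambda>\<theta>. ereal r)"
      by (intro circle_mean_mono) (use le that order_trans in blast)
    also have "\<dots> = ereal r" by (subst circle_mean_real) auto
    finally show ?thesis .
  qed
  show ?thesis
  proof (cases c)
    case MInf
    then show ?thesis using * by (simp add: ereal_bot)
  qed (use * in auto)
qed

lemma psh_circle_nn_integral:
  assumes u: "psh u" and le: "\<And>\<theta>. u (a + cis \<theta> *s b) \<le> ereal M"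
  shows "(\<integral>\<^sup>+\<theta>\<in>{0..2*pi}. e2ennreal (ereal M - u (a + cis \<theta> *s b)) \<partial>lborel)
           \<le> ennreal (2*pi) * e2ennreal (ereal M - u a)"
proof -
  have [measurable]: "u \<in> borel_measurable borel" using psh_measurable[OF u] .
  show ?thesis
    by (subst le_circle_mean_iff[symmetric]) (use u le psh_le_circle[OF u le] in \<open>auto simp: psh_def\<close>)
qed

text \<open>Mean value property of the harmonic function \<open>Re (Ln (1 + w \<zeta>))\<close>, read off from Cauchy's
integral formula on the unit circle.\<close>

lemma has_integral_ln_cmod_circle:
  assumes "cmod w < 1"
  shows "((\<lambda>\<theta>. ln (cmod (1 + w * cis \<theta>))) has_integral 0) {0..2*pi}"
proof -
  have re: "Re (1 + w * \<zeta>) > 0" if "cmod \<zeta> \<le> 1" for \<zeta>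
  proof -
    have "cmod (w * \<zeta>) < 1" using assms that
      by (metis (no_types, lifting) mult_left_le_one_le norm_ge_zero norm_mult mult.commute order.strict_trans1)
    then have "- Re (w*\<zeta>) < 1" using abs_Re_le_cmod[of "w*\<zeta>"] by linarith
    then show ?thesis by simp
  qed
  have nn: "1 + w * \<zeta> \<notin> \<real>\<^sub>\<le>\<^sub>0" if "cmod \<zeta> \<le> 1" for \<zeta>
    using re[OF that] by (auto simp: complex_nonpos_Reals_iff)
  have "((\<lambda>u. Ln (1 + w*u)/(u-0)) has_contour_integral (2 * of_real pi * \<i> * Ln (1 + w*0))) (circlepath 0 1)"
    by (rule Cauchy_integral_circlepath)
      (auto intro!: continuous_intros holomorphic_intros simp: nn)
  then have "((\<lambda>t. Ln (1 + w * cis t) / cis t * \<i> * cis t) has_integral 0) {0..2*pi}"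
    unfolding circlepath_def by (subst (asm) has_contour_integral_part_circlepath_iff) (auto simp: )
  then have "((\<lambda>t. \<i> * Ln (1 + w * cis t)) has_integral 0) {0..2*pi}"
    by (simp add: mult.commute)
  then have "((\<lambda>t. Im (\<i> * Ln (1 + w * cis t))) has_integral Im 0) {0..2*pi}"
    by (rule has_integral_Im)
  moreover have "Im (\<i> * Ln (1 + w * cis t)) = ln (cmod (1 + w * cis t))" for t
  proof -
    have "1 + w * cis t \<noteq> 0"
      using re[of "cis t"] by (metis zero_complex.sel(1) less_irrefl norm_cis order_refl)
    then show ?thesis by simp
  qed
  ultimately show ?thesis by simp
qed

lemma ln_cmod_approx:
  assumes "cmod w \<le> 1/2"
  shows "\<bar>ln (cmod (1 + w)) - Re w\<bar> \<le> 2 * (cmod w)\<^sup>2"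
proof -
  have "1 + w \<noteq> 0"
    using assms by (auto simp: add_eq_0_iff)
  have "norm (Ln (1 + w) - w) \<le> (norm w)^2 / (1 - norm w)"
    using assms by (intro Ln_approx_linear) auto
  also have "\<dots> \<le> (norm w)^2 / (1/2)"
    using assms by (intro divide_left_mono) auto
  finally have "norm (Ln (1 + w) - w) \<le> 2 * (norm w)\<^sup>2" by simp
  moreover have "\<bar>Re (Ln (1 + w) - w)\<bar> \<le> norm (Ln (1 + w) - w)" by (rule abs_Re_le_cmod)
  ultimately show ?thesis using \<open>1 + w \<noteq> 0\<close> by simp
qed

section \<open>Plurisubharmonic functions of logarithms of moduli\<close>

text \<open>If the average were outside of \<open>E\<close>, a hyperplane would separate it strictly from \<open>E\<close>, hence
from all values of \<open>\<gamma>\<close>, and integrating the corresponding linear inequality contradicts the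
separation.\<close>

lemma circle_average_mem_closed_convex:
  fixes \<gamma> :: "real \<Rightarrow> 'a::euclidean_space"
  assumes \<gamma>: "continuous_on {0..2*pi} \<gamma>" "\<And>\<theta>. \<theta> \<in> {0..2*pi} \<Longrightarrow> \<gamma> \<theta> \<in> E"
    and E: "closed E" "convex E"
  shows "(1 / (2*pi)) *\<^sub>R integral {0..2*pi} \<gamma> \<in> E"
proof (rule ccontr)
  assume "\<not> ?thesis"
  from separating_hyperplane_closed_point[OF E(2,1) this]
  obtain v b where v: "v \<bullet> ((1 / (2*pi)) *\<^sub>R integral {0..2*pi} \<gamma>) < b" "\<And>x. x \<in> E \<Longrightarrow> v \<bullet> x > b" by blast
  have int: "\<gamma> integrable_on {0..2*pi}" using \<gamma>(1) by (rule integrable_continuous_real)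
  then have "((\<lambda>\<theta>. v \<bullet> \<gamma> \<theta>) has_integral v \<bullet> integral {0..2*pi} \<gamma>) {0..2*pi}"
    using has_integral_linear[OF integrable_integral[OF int] bounded_linear_inner_right[of v]] by (simp add: o_def)
  moreover have "((\<lambda>\<theta>. b) has_integral (2*pi) * b) {0..2*pi}"
    using has_integral_const_real[of b 0 "2*pi"] by simp
  ultimately have "(2*pi) * b \<le> v \<bullet> integral {0..2*pi} \<gamma>"
    by (elim has_integral_le[rotated]) (use v(2) \<gamma>(2) in \<open>auto simp: less_imp_le\<close>)
  with v(1) show False by (simp add: field_simps)
qed

lemma convex_on_UNIV_continuous:
  fixes \<psi> :: "'a::euclidean_space \<Rightarrow> real"
  assumes "convex_on UNIV \<psi>" shows "continuous_on S \<psi>"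
  using convex_on_continuous[OF open_UNIV assms] continuous_on_subset by blast

text \<open>Jensen's inequality in several variables: the average of points of the epigraph lies in the epigraph,
which is closed and convex.\<close>

lemma jensen_circle:
  fixes \<psi> :: "'a::euclidean_space \<Rightarrow> real"
  assumes c: "convex_on UNIV \<psi>" and t: "continuous_on {0..2*pi} t"
  shows "\<psi> ((1 / (2*pi)) *\<^sub>R integral {0..2*pi} t) \<le> integral {0..2*pi} (\<lambda>\<theta>. \<psi> (t \<theta>)) / (2*pi)"
proof -
  define E where "E = epigraph UNIV \<psi>"
  define \<gamma> where "\<gamma> = (\<lambda>\<theta>. (t \<theta>, \<psi> (t \<theta>)))"
  have cont: "continuous_on UNIV \<psi>" using convex_on_UNIV_continuous[OF c] .
  have "convex E" unfolding E_def using c by (rule convex_epigraphI) 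
  moreover have "closed E"
    unfolding E_def epigraph_def
    by (simp, intro closed_Collect_le continuous_intros continuous_on_compose2[OF cont]) auto
  moreover have c\<gamma>: "continuous_on {0..2*pi} \<gamma>" unfolding \<gamma>_def
    by (intro continuous_intros t continuous_on_compose2[OF cont]) auto
  ultimately have "(1 / (2*pi)) *\<^sub>R integral {0..2*pi} \<gamma> \<in> E"
    by (intro circle_average_mem_closed_convex) (auto simp: \<gamma>_def E_def epigraph_def)
  moreover have "fst (integral {0..2*pi} \<gamma>) = integral {0..2*pi} t"
    using integral_linear[OF integrable_continuous_real[OF c\<gamma>] bounded_linear_fst] by (simp add: o_def \<gamma>_def)
  moreover have "snd (integral {0..2*pi} \<gamma>) = integral {0..2*pi} (\<lambda>\<theta>. \<psi> (t \<theta>))"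
    using integral_linear[OF integrable_continuous_real[OF c\<gamma>] bounded_linear_snd] by (simp add: o_def \<gamma>_def)
  ultimately show ?thesis by (simp add: E_def epigraph_def)
qed

lemma ln_max_le:
  fixes x y \<delta> e :: real
  assumes "x \<le> y + e" "0 \<le> e" "0 < \<delta>"
  shows "ln (max x \<delta>) \<le> ln (max y \<delta>) + e / \<delta>"
proof -
  have "e * \<delta> \<le> e * max y \<delta>" using assms by (intro mult_left_mono) auto
  then have "e \<le> max y \<delta> * (e / \<delta>)" using assms by (simp add: field_simps)
  moreover have "max x \<delta> \<le> max y \<delta> + e" using assms by auto
  ultimately have "max x \<delta> \<le> max y \<delta> * (1 + e / \<delta>)" by (simp add: distrib_left)
  moreover have "0 < 1 + e / \<delta>" using assms by (simp add: add_pos_nonneg)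
  ultimately have "ln (max x \<delta>) \<le> ln (max y \<delta>) + ln (1 + e / \<delta>)"
    using assms by (subst ln_mult_pos[symmetric]) (auto simp: ln_le_cancel_iff)
  also have "ln (1 + e / \<delta>) \<le> e / \<delta>" using assms by (intro ln_add_one_self_le_self) auto
  finally show ?thesis by simp
qed

lemma continuous_on_ln_max_norm:
  assumes "continuous_on S f" "0 < \<delta>"
  shows "continuous_on S (\<lambda>x. ln (max (norm (f x)) (\<delta>::real)))"
  using assms by (intro continuous_intros) (auto simp: max_def)

text \<open>For \<open>|b| < |a|\<close> the function \<open>ln |a + b \<zeta>|\<close> is harmonic on the closed unit disc, and the
truncation from below only increases the integral.\<close>

lemma ln_max_circle_dominant:
  fixes a b :: complex
  assumes "cmod b < cmod a" "0 < \<delta>"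
  shows "2*pi * ln (cmod a) \<le> integral {0..2*pi} (\<lambda>\<theta>. ln (max (cmod (a + b * cis \<theta>)) \<delta>))"
proof -
  have a: "a \<noteq> 0" using assms by auto
  have "((\<lambda>\<theta>. ln (cmod a) + ln (cmod (1 + (b/a) * cis \<theta>))) has_integral (2*pi * ln (cmod a) + 0)) {0..2*pi}"
    using has_integral_const_real[of "ln (cmod a)" 0 "2*pi"] assms
    by (intro has_integral_add has_integral_ln_cmod_circle) (use a in \<open>auto simp: norm_divide divide_less_eq\<close>)
  moreover have "((\<lambda>\<theta>. ln (max (cmod (a + b * cis \<theta>)) \<delta>)) has_integral
     integral {0..2*pi} (\<lambda>\<theta>. ln (max (cmod (a + b * cis \<theta>)) \<delta>))) {0..2*pi}"
    by (intro integrable_integral integrable_continuous_real continuous_on_ln_max_norm continuous_intros assms)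
  ultimately have "2*pi * ln (cmod a) + 0 \<le> integral {0..2*pi} (\<lambda>\<theta>. ln (max (cmod (a + b * cis \<theta>)) \<delta>))"
  proof (rule has_integral_le)
    fix \<theta> :: real
    have "a + b * cis \<theta> = a * (1 + (b/a) * cis \<theta>)" using a by (simp add: field_simps)
    then have *: "cmod (a + b * cis \<theta>) = cmod a * cmod (1 + (b/a) * cis \<theta>)" by (metis norm_mult)
    have "cmod (b * cis \<theta>) < cmod a" using assms by (simp add: norm_mult)
    then have "a + b * cis \<theta> \<noteq> 0" by (metis add_eq_0_iff norm_minus_cancel order_less_irrefl)
    then have pos: "0 < cmod (1 + (b/a) * cis \<theta>)" using * by auto
    have "ln (cmod a) + ln (cmod (1 + (b/a) * cis \<theta>)) = ln (cmod (a + b * cis \<theta>))"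
      unfolding * using pos a by (subst ln_mult_pos) auto
    also have "\<dots> \<le> ln (max (cmod (a + b * cis \<theta>)) \<delta>)"
      using \<open>a + b * cis \<theta> \<noteq> 0\<close> by (subst ln_le_cancel_iff) (auto simp: less_max_iff_disj)
    finally show "ln (cmod a) + ln (cmod (1 + (b/a) * cis \<theta>)) \<le> ln (max (cmod (a + b * cis \<theta>)) \<delta>)" .
  qed
  then show ?thesis by simp
qed

text \<open>Sub-mean value inequality for the truncated logarithm, which is continuous and therefore free of
integrability questions. On the unit circle \<open>|a + b \<zeta>| = |cnj b + cnj a \<zeta>|\<close>, so the case
\<open>|a| < |b|\<close> reduces to the dominant one. The case \<open>|a| = |b|\<close> is a limit of dominant ones.\<close>

lemma ln_max_circle:
  fixes a b :: complex
  assumes \<delta>: "0 < \<delta>"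
  shows "2*pi * ln (max (cmod a) \<delta>) \<le> integral {0..2*pi} (\<lambda>\<theta>. ln (max (cmod (a + b * cis \<theta>)) \<delta>))"
proof -
  have int: "((\<lambda>\<theta>. ln (max (cmod (a + b * cis \<theta>)) \<delta>)) has_integral
     integral {0..2*pi} (\<lambda>\<theta>. ln (max (cmod (a + b * cis \<theta>)) \<delta>))) {0..2*pi}" for a b
    by (intro integrable_integral integrable_continuous_real continuous_on_ln_max_norm continuous_intros assms)
  consider "cmod a \<le> \<delta>" | "\<delta> < cmod a" "cmod b < cmod a" | "\<delta> < cmod a" "cmod a < cmod b" | "\<delta> < cmod a" "cmod a = cmod b"
    by linarith
  then show ?thesis
  proof cases
    case 1
    have "((\<lambda>\<theta>. ln \<delta>) has_integral (2*pi) * ln \<delta>) {0..2*pi}"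
      using has_integral_const_real[of "ln \<delta>" 0 "2*pi"] by simp
    then have "(2*pi) * ln \<delta> \<le> integral {0..2*pi} (\<lambda>\<theta>. ln (max (cmod (a + b * cis \<theta>)) \<delta>))"
      by (rule has_integral_le[OF _ int]) (use \<delta> in \<open>subst ln_le_cancel_iff, auto\<close>)
    then show ?thesis using 1 by (simp add: max_absorb2)
  next
    case 2
    then show ?thesis using ln_max_circle_dominant[of b a \<delta>] \<delta> by (simp add: max_def)
  next
    case 3
    have "cmod (a + b * cis \<theta>) = cmod (cnj b + cnj a * cis \<theta>)" for \<theta>
    proof -
      have "cnj b + cnj a * cis \<theta> = cis \<theta> * cnj (a + b * cis \<theta>)"
        by (simp add: cis_cnj algebra_simps cis_mult)
      then show ?thesis by (metis complex_mod_cnj mult_1 norm_cis norm_mult)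
    qed
    then have "2*pi * ln (cmod b) \<le> integral {0..2*pi} (\<lambda>\<theta>. ln (max (cmod (a + b * cis \<theta>)) \<delta>))"
      using ln_max_circle_dominant[of "cnj a" "cnj b" \<delta>] 3 \<delta> by simp
    moreover have "ln (cmod a) \<le> ln (cmod b)" using 3 \<delta> by (subst ln_le_cancel_iff) auto
    then have "2*pi * ln (cmod a) \<le> 2*pi * ln (cmod b)" by (intro mult_left_mono) auto
    ultimately have "2*pi * ln (cmod a) \<le> integral {0..2*pi} (\<lambda>\<theta>. ln (max (cmod (a + b * cis \<theta>)) \<delta>))"
      by linarith
    then show ?thesis using 3 by (simp add: max_absorb1)
  next
    case 4
    let ?I = "\<lambda>a. integral {0..2*pi} (\<lambda>\<theta>. ln (max (cmod (a + b * cis \<theta>)) \<delta>))"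
    have *: "2*pi * ln (cmod a) \<le> ?I a + 2*pi * (cmod a * e / \<delta>)" if e: "e > 0" for e
    proof -
      define a' where "a' = (1 + of_real e) * a"
      have "cmod (of_real (1 + e)) = 1 + e" using e by (subst norm_of_real) auto
      then have na': "cmod a' = (1 + e) * cmod a" unfolding a'_def by (simp add: norm_mult)
      have "cmod a > 0" using 4 \<delta> by linarith
      then have "cmod a < cmod a'" using na' e by simp
      then have "2*pi * ln (cmod a') \<le> ?I a'" using 4 \<delta> by (intro ln_max_circle_dominant) auto
      moreover have "ln (cmod a) \<le> ln (cmod a')"
        using \<open>cmod a < cmod a'\<close> \<open>cmod a > 0\<close> by (subst ln_le_cancel_iff) auto
      then have "2*pi*ln (cmod a) \<le> 2*pi* ln (cmod a')" by simp
      moreover have "?I a' \<le> ?I a + 2*pi*(cmod a * e / \<delta>)"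
      proof (rule has_integral_le[OF int])
        show "((\<lambda>\<theta>. ln (max (cmod (a + b * cis \<theta>)) \<delta>) + cmod a * e / \<delta>) has_integral ?I a + 2*pi*(cmod a * e / \<delta>)) {0..2*pi}"
          using has_integral_const_real[of "cmod a * e / \<delta>" 0 "2*pi"] by (intro has_integral_add int) auto
        fix \<theta>
        have eq: "a' + b * cis \<theta> = (a + b * cis \<theta>) + of_real e * a" unfolding a'_def by (simp add: algebra_simps)
        have "cmod (a' + b * cis \<theta>) \<le> cmod (a + b * cis \<theta>) + cmod a * e"
          unfolding eq using norm_triangle_ineq[of "a + b * cis \<theta>" "of_real e * a"] e by (simp add: norm_mult mult.commute)
        then show "ln (max (cmod (a' + b * cis \<theta>)) \<delta>) \<le> ln (max (cmod (a + b * cis \<theta>)) \<delta>) + cmod a * e / \<delta>"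
          by (rule ln_max_le) (use e \<delta> in auto)
      qed
      ultimately show ?thesis by linarith
    qed
    have "2*pi * ln (cmod a) \<le> ?I a"
    proof (rule field_le_epsilon)
      fix e' :: real assume "e' > 0"
      have "cmod a > 0" using 4 \<delta> by linarith
      then have "2*pi*cmod a > 0" by simp
      moreover have "2*pi * (cmod a * (e' * \<delta> / (2*pi*cmod a)) / \<delta>) = e'"
        using \<open>cmod a > 0\<close> \<delta> by simp
      moreover have "e' * \<delta> / (2*pi*cmod a) > 0" using \<open>cmod a > 0\<close> \<delta> \<open>e' > 0\<close> by simp
      ultimately show "2*pi * ln (cmod a) \<le> ?I a + e'"
        using *[of "e' * \<delta> / (2*pi*cmod a)"] by linarith
    qed
    then show ?thesis using 4 by (simp add: max_def)
  qed
qed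

text \<open>Replacing small moduli by \<open>\<delta>\<close> makes the logarithm continuous on the whole space.\<close>

definition ln_max :: "real \<Rightarrow> complex^'n \<Rightarrow> real^'n" where
  "ln_max \<delta> y = (\<chi> k. ln (max (norm (y $ k)) \<delta>))"

definition ln_vec :: "complex^'n \<Rightarrow> real^'n" where
  "ln_vec y = (\<chi> k. ln (norm (y $ k)))"

text \<open>The infimum of the truncated functions decreases to the value of \<open>\<psi> (ln_vec y)\<close> where that is
meaningful, and defines the upper semicontinuous extension on the coordinate hyperplanes.\<close>

definition log_psh :: "(real^'n \<Rightarrow> real) \<Rightarrow> complex^'n \<Rightarrow> ereal" where
  "log_psh \<psi> y = (INF n::nat. ereal (\<psi> (ln_max (inverse (Suc n)) y)))"

lemma continuous_on_ln_max:
  assumes "0 < \<delta>" "continuous_on S f"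
  shows "continuous_on S (\<lambda>y. ln_max \<delta> (f y))"
  unfolding ln_max_def by (intro continuous_intros continuous_on_ln_max_norm assms)

lemma ln_max_mono: "0 < \<delta> \<Longrightarrow> \<delta> \<le> \<delta>' \<Longrightarrow> ln_max \<delta> y $ k \<le> ln_max \<delta>' y $ k"
  unfolding ln_max_def by (auto simp: ln_le_cancel_iff)

text \<open>The average of \<open>ln_max \<delta>\<close> over a circle dominates its value at the centre in each coordinate,
so monotonicity of \<open>\<psi>\<close> and Jensen's inequality combine.\<close>

lemma ln_max_submean:
  assumes c: "convex_on UNIV \<psi>" and m: "\<And>s t. (\<And>k. s $ k \<le> t $ k) \<Longrightarrow> \<psi> s \<le> \<psi> t" and \<delta>: "0 < \<delta>"
  shows "\<psi> (ln_max \<delta> a) \<le> integral {0..2*pi} (\<lambda>\<theta>. \<psi> (ln_max \<delta> (a + cis \<theta> *s b))) / (2*pi)"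
proof -
  let ?t = "\<lambda>\<theta>. ln_max \<delta> (a + cis \<theta> *s b)"
  have ct: "continuous_on {0..2*pi} ?t"
    by (intro continuous_on_ln_max \<delta> continuous_on_circle_vec)
  have "\<psi> (ln_max \<delta> a) \<le> \<psi> ((1 / (2*pi)) *\<^sub>R integral {0..2*pi} ?t)"
  proof (rule m)
    fix k
    have "integral {0..2*pi} ?t $ k = integral {0..2*pi} (\<lambda>\<theta>. ?t \<theta> $ k)"
      by (intro integral_component_eq_cart[symmetric] integrable_continuous_real ct)
    also have "\<dots> = integral {0..2*pi} (\<lambda>\<theta>. ln (max (cmod (a $ k + b $ k * cis \<theta>)) \<delta>))"
      by (simp add: ln_max_def mult.commute)
    finally have *: "integral {0..2*pi} ?t $ k = integral {0..2*pi} (\<lambda>\<theta>. ln (max (cmod (a $ k + b $ k * cis \<theta>)) \<delta>))" .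
    show "ln_max \<delta> a $ k \<le> ((1 / (2*pi)) *\<^sub>R integral {0..2*pi} ?t) $ k"
      using ln_max_circle[OF \<delta>, of "a $ k" "b $ k"] unfolding vector_scaleR_component *
      by (simp add: ln_max_def field_simps)
  qed
  also have "\<dots> \<le> integral {0..2*pi} (\<lambda>\<theta>. \<psi> (?t \<theta>)) / (2*pi)"
    by (rule jensen_circle[OF c ct])
  finally show ?thesis .
qed

lemma log_psh_le:
  assumes m: "\<And>s t. (\<And>k. s $ k \<le> t $ k) \<Longrightarrow> \<psi> s \<le> \<psi> t" 
    and "\<And>k. norm (y $ k) \<le> r $ k" "\<And>k. 1 \<le> r $ k"
  shows "ereal (\<psi> (ln_max (inverse (Suc n)) y)) \<le> ereal (\<psi> (\<chi> k. ln (r $ k)))"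
proof -
  have "inverse (real (Suc n)) \<le> 1" by (intro inverse_le_1_iff[THEN iffD2]) auto
  then have "max (norm (y $ k)) (inverse (real (Suc n))) \<le> r $ k" for k
    using assms(2,3)[of k] by linarith
  moreover have "0 < max (norm (y $ k)) (inverse (real (Suc n)))" for k
    by (simp add: less_max_iff_disj)
  ultimately have "ln (max (norm (y $ k)) (inverse (real (Suc n)))) \<le> ln (r $ k)" for k
    by (simp add: ln_mono)
  then show ?thesis
    unfolding ln_max_def by (intro ereal_less_eq(3)[THEN iffD2] m) simp
qed

lemma log_psh_eq:
  assumes m: "\<And>s t. (\<And>k. s $ k \<le> t $ k) \<Longrightarrow> \<psi> s \<le> \<psi> t" and y: "\<And>k. y $ k \<noteq> 0"
  shows "log_psh \<psi> y = ereal (\<psi> (ln_vec y))"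
proof (rule antisym)
  have "\<exists>n. \<forall>k. inverse (real (Suc n)) \<le> norm (y $ k)"
  proof -
    define d where "d = Min (range (\<lambda>k. norm (y $ k)))"
    have "d > 0" unfolding d_def using y by (subst Min_gr_iff) auto
    moreover have "d \<le> norm (y $ k)" for k unfolding d_def by (intro Min_le) auto
    ultimately show ?thesis using reals_Archimedean[of d] by (meson less_imp_le order_trans)
  qed
  then obtain n where n: "\<And>k. inverse (real (Suc n)) \<le> norm (y $ k)" by auto
  then have "ln_max (inverse (real (Suc n))) y = ln_vec y"
    unfolding ln_max_def ln_vec_def by (simp only: max_absorb1)
  then show "log_psh \<psi> y \<le> ereal (\<psi> (ln_vec y))"
    unfolding log_psh_def by (intro INF_lower2[of n]) auto
  show "ereal (\<psi> (ln_vec y)) \<le> log_psh \<psi> y"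
    unfolding log_psh_def
    by (intro INF_greatest ereal_less_eq(3)[THEN iffD2] m)
      (use y in \<open>simp add: ln_max_def ln_vec_def ln_mono\<close>)
qed

text \<open>The truncated functions are continuous and have the sub-mean value property. Both upper semicontinuity and
the sub-mean value inequality survive the decreasing limit, the latter by monotone convergence.\<close>

lemma psh_log_psh:
  assumes c: "convex_on UNIV \<psi>" and m: "\<And>s t. (\<And>k. s $ k \<le> t $ k) \<Longrightarrow> \<psi> s \<le> \<psi> t"
  shows "psh (log_psh \<psi>)"
  unfolding psh_def
proof (intro conjI allI)
  let ?f = "\<lambda>n y. ereal (\<psi> (ln_max (inverse (real (Suc n))) y))"
  have cont: "continuous_on S (\<lambda>x. ?f n (g x))" if "continuous_on S g" for n S and g :: "'b::topological_space \<Rightarrow> complex^'a"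
    by (intro continuous_on_ereal continuous_on_compose2[OF convex_on_UNIV_continuous[OF c, of UNIV]] continuous_on_ln_max that) auto
  have u: "usc (log_psh \<psi>)"
    unfolding usc_def
  proof
    fix c
    have "{z. log_psh \<psi> z < c} = (\<Union>n. {z. ?f n z < c})"
      unfolding log_psh_def by (auto simp: INF_less_iff)
    moreover have "open {z. ?f n z < c}" for n
      by (intro open_Collect_less cont continuous_intros)
    ultimately show "open {z. log_psh \<psi> z < c}" by auto
  qed
  then show "usc (log_psh \<psi>)" .
  show "log_psh \<psi> z < \<infinity>" for z
    unfolding log_psh_def by (rule le_less_trans[OF INF_lower[of 0]]) auto
  have "log_psh \<psi> (\<chi> k. 1) \<noteq> -\<infinity>"
    by (subst log_psh_eq[OF m]) auto
  then show "\<exists>z. log_psh \<psi> z \<noteq> - \<infinity>" by blast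
  fix a b :: "complex^'a"
  let ?c = "\<lambda>\<theta>. a + cis \<theta> *s b"
  define r :: "real^'a" where "r = (\<chi> k. 1 + norm (a $ k) + norm (b $ k))"
  define M where "M = \<psi> (\<chi> k. ln (r $ k))"
  have M: "?f n (?c \<theta>) \<le> ereal M" for n \<theta>
    unfolding M_def
  proof (rule log_psh_le[OF m])
    fix k
    show "norm ((a + cis \<theta> *s b) $ k) \<le> r $ k"
      using norm_triangle_ineq[of "a $ k" "cis \<theta> * b $ k"] by (simp add: r_def norm_mult)
  qed (auto simp: r_def)
  have Ma: "?f n a \<le> ereal M" for n
    unfolding M_def by (rule log_psh_le[OF m]) (auto simp: r_def)
  have lim: "(\<lambda>n. ?f n y) \<longlonglongrightarrow> log_psh \<psi> y" for y
    unfolding log_psh_def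
    by (intro LIMSEQ_INF decseq_SucI ereal_less_eq(3)[THEN iffD2] m ln_max_mono) (auto simp: le_imp_inverse_le)
  have FM: "log_psh \<psi> (?c \<theta>) \<le> ereal M" for \<theta>
  proof -
    have "log_psh \<psi> (?c \<theta>) \<le> ?f 0 (?c \<theta>)" unfolding log_psh_def by (rule INF_lower) simp
    also have "\<dots> \<le> ereal M" by (rule M)
    finally show ?thesis .
  qed
  have FMa: "log_psh \<psi> a \<le> ereal M"
  proof -
    have "log_psh \<psi> a \<le> ?f 0 a" unfolding log_psh_def by (rule INF_lower) simp
    also have "\<dots> \<le> ereal M" by (rule Ma)
    finally show ?thesis .
  qed
  have mf [measurable]: "(\<lambda>\<theta>. ?f n (?c \<theta>)) \<in> borel_measurable borel" for n
    by (intro borel_measurable_continuous_onI cont continuous_on_circle_vec)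
  have mF [measurable]: "(\<lambda>\<theta>. log_psh \<psi> (?c \<theta>)) \<in> borel_measurable borel"
    by (rule measurable_compose[OF circle_vec_measurable usc_borel_measurable[OF u]])
  have bd: "(\<integral>\<^sup>+\<theta>\<in>{0..2*pi}. e2ennreal (ereal M - ?f n (?c \<theta>)) \<partial>lborel) \<le> ennreal (2*pi) * e2ennreal (ereal M - log_psh \<psi> a)" for n
  proof -
    have "?f n a \<le> circle_mean (\<lambda>\<theta>. ?f n (?c \<theta>))"
      by (subst circle_mean_real)
        (auto intro!: ln_max_submean c m continuous_on_compose2[OF convex_on_UNIV_continuous[OF c, of UNIV]]
          continuous_on_ln_max continuous_on_circle_vec)
    then have "(\<integral>\<^sup>+\<theta>\<in>{0..2*pi}. e2ennreal (ereal M - ?f n (?c \<theta>)) \<partial>lborel) \<le> ennreal (2*pi) * e2ennreal (ereal M - ?f n a)"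
      by (subst (asm) le_circle_mean_iff[OF mf M Ma])
    also have "\<dots> \<le> ennreal (2*pi) * e2ennreal (ereal M - log_psh \<psi> a)"
      by (intro mult_left_mono e2ennreal_mono ereal_minus_mono) (auto simp: log_psh_def intro: INF_lower)
    finally show ?thesis .
  qed
  have "(\<lambda>n. \<integral>\<^sup>+\<theta>\<in>{0..2*pi}. e2ennreal (ereal M - ?f n (?c \<theta>)) \<partial>lborel) \<longlonglongrightarrow>
     (\<integral>\<^sup>+\<theta>\<in>{0..2*pi}. e2ennreal (ereal M - log_psh \<psi> (?c \<theta>)) \<partial>lborel)"
  proof (rule nn_integral_LIMSEQ)
    show "incseq (\<lambda>n \<theta>. e2ennreal (ereal M - ?f n (?c \<theta>)) * indicator {0..2*pi} \<theta>)"
      by (intro incseq_SucI le_funI mult_right_mono e2ennreal_mono ereal_minus_mono order_refl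
            ereal_less_eq(3)[THEN iffD2] m ln_max_mono) (auto simp: le_imp_inverse_le)
    fix \<theta>
    have "(\<lambda>n. e2ennreal (ereal M - ?f n (?c \<theta>))) \<longlonglongrightarrow> e2ennreal (ereal M - log_psh \<psi> (?c \<theta>))"
      by (intro tendsto_e2ennrealI tendsto_diff_ereal_general tendsto_const lim) auto
    then show "(\<lambda>n. e2ennreal (ereal M - ?f n (?c \<theta>)) * indicator {0..2*pi} \<theta>) \<longlonglongrightarrow> e2ennreal (ereal M - log_psh \<psi> (?c \<theta>)) * indicator {0..2*pi} \<theta>"
      by (auto simp: indicator_def)
  qed measurable
  then have "(\<integral>\<^sup>+\<theta>\<in>{0..2*pi}. e2ennreal (ereal M - log_psh \<psi> (?c \<theta>)) \<partial>lborel) \<le> ennreal (2*pi) * e2ennreal (ereal M - log_psh \<psi> a)"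
    by (rule LIMSEQ_le_const2) (use bd in blast)
  then show "log_psh \<psi> a \<le> circle_mean (\<lambda>\<theta>. log_psh \<psi> (?c \<theta>))"
    by (subst le_circle_mean_iff[OF mF FM FMa])
qed

text \<open>A coordinate of a point of the circle vanishes only if the radius equals the modulus of the corresponding
coordinate of the centre. Choosing the radius smaller than all nonzero moduli avoids this on the whole circle.\<close>

lemma small_circle_off_axes:
  fixes a :: "complex^'n"
  assumes "e > 0"
  obtains \<epsilon> where "0 < \<epsilon>" "\<epsilon> \<le> e" "\<And>\<theta> k. (a + cis \<theta> *s (\<chi> k. of_real \<epsilon>)) $ k \<noteq> 0"
    "\<And>\<theta>. dist (a + cis \<theta> *s (\<chi> k. of_real \<epsilon>)) a < e"
    "\<And>\<theta> k. norm ((a + cis \<theta> *s (\<chi> k. of_real \<epsilon>)) $ k) \<le> norm (a $ k) + \<epsilon>"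
proof -
  define d where "d = Min ((\<lambda>k. if a $ k = 0 then 1 else norm (a $ k)) ` UNIV)"
  have d: "d > 0" unfolding d_def by (subst Min_gr_iff) auto
  have dle: "d \<le> norm (a $ k)" if "a $ k \<noteq> 0" for k
    unfolding d_def using that by (intro Min_le) (auto simp: image_iff intro!: exI[of _ k])
  define N where "N = 2 * (1 + real CARD('n))"
  have N: "N \<ge> 1" "real CARD('n) < N" unfolding N_def by simp_all
  define \<epsilon> where "\<epsilon> = min (d / 2) (e / N)"
  have \<epsilon>: "\<epsilon> > 0" "\<epsilon> < d" using d assms N unfolding \<epsilon>_def by simp_all
  have "\<epsilon> \<le> e / N" by (simp add: \<epsilon>_def)
  then have e1: "\<epsilon> * N \<le> e" using N by (simp add: pos_le_divide_eq)
  have "\<epsilon> * 1 \<le> \<epsilon> * N" using \<epsilon> N by (intro mult_left_mono) auto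
  then have "\<epsilon> \<le> e" using e1 by linarith
  show ?thesis
  proof (rule that)
    show "0 < \<epsilon>" "\<epsilon> \<le> e" by fact+
    fix \<theta>
    show "(a + cis \<theta> *s (\<chi> k. of_real \<epsilon>)) $ k \<noteq> 0" for k
    proof
      assume "(a + cis \<theta> *s (\<chi> k. of_real \<epsilon>)) $ k = 0"
      then have "a $ k = - (cis \<theta> * of_real \<epsilon>)" by (simp add: add_eq_0_iff2)
      then have "norm (a $ k) = \<epsilon>" using \<epsilon> by (simp add: norm_mult)
      then show False using \<epsilon> dle[of k] by auto
    qed
    have "norm (cis \<theta> *s (\<chi> k::'n. complex_of_real \<epsilon>)) \<le> (\<Sum>k\<in>UNIV. norm ((cis \<theta> *s (\<chi> k::'n. complex_of_real \<epsilon>)) $ k))"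
      unfolding norm_vec_def by (rule L2_set_le_sum) auto
    also have "\<dots> = real CARD('n) * \<epsilon>" using \<epsilon> by (simp add: norm_mult)
    also have "\<dots> < N * \<epsilon>" using \<epsilon> N by (intro mult_strict_right_mono) auto
    finally show "dist (a + cis \<theta> *s (\<chi> k. of_real \<epsilon>)) a < e" using e1 by (simp add: dist_norm mult.commute)
    show "norm ((a + cis \<theta> *s (\<chi> k. of_real \<epsilon>)) $ k) \<le> norm (a $ k) + \<epsilon>" for k
      using norm_triangle_ineq[of "a $ k" "cis \<theta> * of_real \<epsilon>"] \<epsilon> by (simp add: norm_mult)
  qed
qed

text \<open>Values on the coordinate hyperplanes are controlled by values off them: by upper semicontinuity \<open>G\<close>
is almost at most \<open>G a\<close> on small circles about \<open>a\<close> which avoid the hyperplanes, and there the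
sub-mean value inequality for \<open>F\<close> applies.\<close>

lemma psh_le_off_axes:
  assumes F: "psh F" and G: "usc G" and le: "\<And>y. (\<forall>k. y $ k \<noteq> 0) \<Longrightarrow> F y \<le> G y"
  shows "F a \<le> G a"
proof (rule dense_ge)
  fix c assume "G a < c"
  then have "a \<in> {z. G z < c}" "open {z. G z < c}" using G by (auto simp: usc_def)
  then obtain e where e: "e > 0" "\<And>z. dist z a < e \<Longrightarrow> G z < c"
    unfolding open_dist by blast
  from small_circle_off_axes[OF e(1), of a] obtain \<epsilon>
    where \<epsilon>: "\<And>\<theta> k. (a + cis \<theta> *s (\<chi> k. of_real \<epsilon>)) $ k \<noteq> 0" "\<And>\<theta>. dist (a + cis \<theta> *s (\<chi> k. of_real \<epsilon>)) a < e"
    by metis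
  show "F a \<le> c"
  proof (rule psh_le_circle[OF F])
    fix \<theta>
    let ?y = "a + cis \<theta> *s (\<chi> k. of_real \<epsilon>)"
    have "F ?y \<le> G ?y" using le \<epsilon>(1) by blast
    also have "\<dots> < c" by (rule e(2)[OF \<epsilon>(2)])
    finally show "F ?y \<le> c" by simp
  qed
qed

lemma psh_eq_off_axes:
  assumes "psh F" "psh G" "\<And>y. (\<forall>k. y $ k \<noteq> 0) \<Longrightarrow> F y = G y"
  shows "F = G"
  using psh_le_off_axes[of F G] psh_le_off_axes[of G F] assms
  by (intro ext antisym) (auto simp: psh_def)

section \<open>Maxima over tori are logarithmically convex\<close>

lemma norm_cart_le_sum: "norm (z :: 'a::real_normed_vector ^ 'n) \<le> (\<Sum>k\<in>UNIV. norm (z $ k))"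
  unfolding norm_vec_def by (rule L2_set_le_sum) auto

definition torus :: "real^'n \<Rightarrow> (complex^'n) set" where
  "torus t = {z. \<forall>k. norm (z $ k) = exp (t $ k)}"

lemma mem_torus_ln_vec: "(\<And>k. z $ k \<noteq> 0) \<Longrightarrow> z \<in> torus (ln_vec z)"
  by (simp add: torus_def ln_vec_def)

lemma ln_vec_torus: "z \<in> torus t \<Longrightarrow> ln_vec z = t"
  by (simp add: torus_def ln_vec_def vec_eq_iff)

lemma compact_torus: "compact (torus t :: (complex^'n) set)"
proof -
  have "norm z \<le> (\<Sum>k\<in>UNIV. exp (t $ k))" if "z \<in> torus t" for z :: "complex^'n"
    using norm_cart_le_sum[of z] that by (simp add: torus_def)
  then have "bounded (torus t :: (complex^'n) set)" by (auto simp: bounded_iff)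
  moreover have "torus t = (\<Inter>k. {z :: complex^'n. norm (z $ k) = exp (t $ k)})" by (auto simp: torus_def)
  moreover have "closed {z :: complex^'n. norm (z $ k) = exp (t $ k)}" for k
    by (intro closed_Collect_eq continuous_intros)
  ultimately show ?thesis by (auto simp: compact_eq_bounded_closed intro!: closed_INT)
qed

text \<open>A compact torus inside an open set has a uniform neighbourhood inside it, and nearby tori are close to the
given one by radial projection.\<close>

lemma usc_torus_nearby:
  fixes u :: "complex^'n \<Rightarrow> ereal"
  assumes u: "usc u" and less: "\<And>z. z \<in> torus t \<Longrightarrow> u z < c"
  obtains \<rho> where "\<rho> > 0" "\<And>t' z. norm (t' - t) \<le> \<rho> \<Longrightarrow> z \<in> torus t' \<Longrightarrow> u z < c"
proof -
  have "open {z. u z < c}" using u by (simp add: usc_def)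
  moreover have "torus t \<subseteq> {z. u z < c}" using less by auto
  ultimately obtain e where e: "e > 0" "(\<Union>x\<in>torus t. ball x e) \<subseteq> {z. u z < c}"
    using compact_subset_open_imp_ball_epsilon_subset[OF compact_torus] by metis
  let ?f = "\<lambda>t' :: real^'n. \<Sum>k\<in>UNIV. \<bar>exp (t' $ k) - exp (t $ k)\<bar>"
  have "open {t'. ?f t' < e}" by (intro open_Collect_less continuous_intros)
  moreover have "t \<in> {t'. ?f t' < e}" using e(1) by simp
  ultimately obtain \<rho> where \<rho>: "\<rho> > 0" "cball t \<rho> \<subseteq> {t'. ?f t' < e}"
    unfolding open_contains_cball by blast
  show ?thesis
  proof (rule that[OF \<rho>(1)])
    fix t' z assume t': "norm (t' - t) \<le> \<rho>" and z: "z \<in> torus t'"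
    have "?f t' < e" using t' \<rho>(2) by (auto simp: dist_norm norm_minus_commute)
    define y :: "complex^'n" where "y = (\<chi> k. of_real (exp (t $ k - t' $ k)) * z $ k)"
    have zk: "norm (z $ k) = exp (t' $ k)" for k using z by (simp add: torus_def)
    have "y \<in> torus t" by (simp add: torus_def y_def norm_mult zk flip: exp_add)
    have "norm (z $ k - y $ k) = \<bar>exp (t' $ k) - exp (t $ k)\<bar>" for k
    proof -
      have "z $ k - y $ k = of_real (1 - exp (t $ k - t' $ k)) * z $ k" by (simp add: y_def algebra_simps)
      then have "norm (z $ k - y $ k) = \<bar>1 - exp (t $ k - t' $ k)\<bar> * \<bar>exp (t' $ k)\<bar>"
        by (simp only: norm_mult zk norm_of_real) simp
      also have "\<dots> = \<bar>exp (t' $ k) - exp (t $ k)\<bar>"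
        unfolding abs_mult[symmetric] by (simp add: left_diff_distrib flip: exp_add)
      finally show ?thesis .
    qed
    then have "norm (z - y) < e"
      using norm_cart_le_sum[of "z - y"] \<open>?f t' < e\<close> by simp
    then have "z \<in> ball y e" by (simp add: dist_norm norm_minus_commute)
    then show "u z < c" using e(2) \<open>y \<in> torus t\<close> by blast
  qed
qed

lemma usc_add_continuous:
  fixes u :: "'a::topological_space \<Rightarrow> ereal"
  assumes u: "usc u" and f: "continuous_on UNIV f"
  shows "usc (\<lambda>z. u z + ereal (f z))"
  unfolding usc_def
proof
  fix c :: ereal
  show "open {z. u z + ereal (f z) < c}"
  proof (cases c)
    case (real r)
    have eq: "{z. u z + ereal (f z) < c} = (\<Union>q. {z. u z < ereal q} \<inter> {z. f z < r - q})"
    proof safe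
      fix z assume "u z + ereal (f z) < c"
      then have "u z < ereal (r - f z)" using real by (cases "u z") auto
      then obtain q where "u z < ereal q" "ereal q < ereal (r - f z)" using ereal_dense2 by blast
      then show "z \<in> (\<Union>q. {z. u z < ereal q} \<inter> {z. f z < r - q})" by auto
    next
      fix z q assume "u z < ereal q" "f z < r - q"
      then show "u z + ereal (f z) < c" using real by (cases "u z") auto
    qed
    have "open ({z. u z < ereal q} \<inter> {z. f z < r - q})" for q
    proof (rule open_Int)
      show "open {z. u z < ereal q}" using u by (simp add: usc_def)
      show "open {z. f z < r - q}" by (intro open_Collect_less continuous_intros f)
    qed
    then show ?thesis unfolding eq by (intro open_UN) blast
  next
    case PInf
    then have "{z. u z + ereal (f z) < c} = {z. u z < \<infinity>}" by auto
    moreover have "open {z. u z < \<infinity>}" using u unfolding usc_def by blast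
    ultimately show ?thesis by (simp only:)
  next
    case MInf
    then show ?thesis by simp
  qed
qed

lemma usc_attains_max:
  assumes u: "usc u" and Q: "compact Q" "Q \<noteq> {}"
  obtains z where "z \<in> Q" "\<And>y. y \<in> Q \<Longrightarrow> u y \<le> u z"
proof (rule ccontr)
  note key = that
  assume "\<not> thesis"
  then have *: "\<exists>y\<in>Q. u z < u y" if z: "z \<in> Q" for z using key[OF z] by (meson not_le)
  have "Q \<subseteq> (\<Union>y\<in>Q. {z. u z < u y})" using * by auto
  moreover have "open {z. u z < u y}" for y using u by (simp add: usc_def)
  ultimately obtain D where D: "D \<subseteq> Q" "finite D" "Q \<subseteq> (\<Union>y\<in>D. {z. u z < u y})"
    using compactE_image[OF Q(1), of Q "\<lambda>y. {z. u z < u y}"] by metis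
  with Q have "D \<noteq> {}" by auto
  then have "Max (u ` D) \<in> u ` D" using D by (intro Max_in) auto
  then obtain y where y: "y \<in> D" "u y = Max (u ` D)" by auto
  with D obtain y' where "y' \<in> D" "u y < u y'" by blast
  then have "u y' \<le> Max (u ` D)" using D by (intro Max_ge) auto
  with \<open>u y < u y'\<close> y show False by simp
qed

lemma has_integral_cos_square: "((\<lambda>\<theta>. (cos \<theta>)\<^sup>2) has_integral pi) {0..2*pi}"
proof -
  have "((\<lambda>\<theta>. (cos \<theta>)\<^sup>2) has_integral ((\<lambda>\<theta>. \<theta>/2 + sin \<theta> * cos \<theta> / 2) (2*pi) - (\<lambda>\<theta>. \<theta>/2 + sin \<theta> * cos \<theta> / 2) 0)) {0..2*pi}"
  proof (rule fundamental_theorem_of_calculus)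
    fix x :: real
    have "1/2 + (cos x * cos x - sin x * sin x) / 2 = (cos x)\<^sup>2"
      using sin_cos_squared_add[of x] by (simp add: power2_eq_square field_simps)
    then have "((\<lambda>\<theta>. \<theta>/2 + sin \<theta> * cos \<theta> / 2) has_real_derivative (cos x)\<^sup>2) (at x)"
      by (auto intro!: derivative_eq_intros simp: field_simps)
    then show "((\<lambda>\<theta>. \<theta>/2 + sin \<theta> * cos \<theta> / 2) has_vector_derivative (cos x)\<^sup>2) (at x within {0..2*pi})"
      by (simp add: has_real_derivative_iff_has_vector_derivative has_vector_derivative_at_within)
  qed simp
  then show ?thesis by simp
qed

text \<open>Along the disc \<open>z_k (1 + r p_k \<zeta>)\<close> the logarithms of the moduli move by \<open>h\<close>. This is a
motion in the direction \<open>p\<close> up to an error quadratic in \<open>r\<close>, and every linear functional of it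
has mean 0 on the circle.\<close>

lemma disc_ln_expansion:
  fixes p :: "real^'n" and r :: real
  assumes r: "0 \<le> r" "r * norm p \<le> 1/2"
  defines "h \<equiv> \<lambda>\<theta>. (\<chi> k. ln (cmod (1 + of_real (r * p $ k) * cis \<theta>))) :: real^'n"
  shows "norm (h \<theta> - (r * cos \<theta>) *\<^sub>R p) \<le> 2 * r\<^sup>2 * (norm p)\<^sup>2"
    and "((\<lambda>\<theta>. h \<theta> \<bullet> w) has_integral 0) {0..2*pi}"
    and "continuous_on UNIV h"
    and "1 / 2 \<le> cmod (1 + of_real (r * p $ k) * cis \<theta>)"
proof -
  have rp: "cmod (of_real (r * p $ k) * cis \<theta>) \<le> 1/2" for k \<theta>
  proof -
    have "\<bar>r * p $ k\<bar> \<le> r * norm p"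
      using component_le_norm_cart[of p k] r by (simp add: abs_mult mult_left_mono)
    then show ?thesis using r by (simp add: norm_mult)
  qed
  show half: "1 / 2 \<le> cmod (1 + of_real (r * p $ k) * cis \<theta>)" for k \<theta>
    using norm_triangle_ineq2[of 1 "- (of_real (r * p $ k) * cis \<theta>)"] rp[of k \<theta>] by simp
  have "norm (h \<theta> - (r * cos \<theta>) *\<^sub>R p) \<le> (\<Sum>k\<in>UNIV. norm ((h \<theta> - (r * cos \<theta>) *\<^sub>R p) $ k))"
    by (rule norm_cart_le_sum)
  also have "\<dots> \<le> (\<Sum>k\<in>UNIV. 2 * r\<^sup>2 * (p $ k)\<^sup>2)"
  proof (rule sum_mono)
    fix k
    have "\<bar>ln (cmod (1 + of_real (r * p $ k) * cis \<theta>)) - Re (of_real (r * p $ k) * cis \<theta>)\<bar>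
       \<le> 2 * (cmod (of_real (r * p $ k) * cis \<theta>))\<^sup>2"
      by (rule ln_cmod_approx[OF rp])
    then show "norm ((h \<theta> - (r * cos \<theta>) *\<^sub>R p) $ k) \<le> 2 * r\<^sup>2 * (p $ k)\<^sup>2"
      by (simp add: h_def norm_mult power_mult_distrib algebra_simps)
  qed
  also have "\<dots> = 2 * r\<^sup>2 * (norm p)\<^sup>2"
    by (simp add: sum_distrib_left[symmetric] norm_vec_def L2_set_def sum_nonneg)
  finally show "norm (h \<theta> - (r * cos \<theta>) *\<^sub>R p) \<le> 2 * r\<^sup>2 * (norm p)\<^sup>2" .
  have "((\<lambda>\<theta>. \<Sum>k\<in>UNIV. h \<theta> $ k * w $ k) has_integral (\<Sum>k\<in>(UNIV::'n set). 0 * w $ k)) {0..2*pi}"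
    unfolding h_def vec_lambda_beta
  proof (intro has_integral_sum has_integral_mult_left has_integral_ln_cmod_circle)
    fix k :: 'n
    show "cmod (of_real (r * p $ k)) < 1" using rp[of k 0] by simp
  qed simp
  then show "((\<lambda>\<theta>. h \<theta> \<bullet> w) has_integral 0) {0..2*pi}" by (simp add: inner_vec_def)
  have "1 + of_real (r * p $ k) * cis \<theta> \<noteq> 0" for k \<theta> using half[of k \<theta>] by auto
  then show "continuous_on UNIV h" unfolding h_def
    by (intro continuous_intros) auto
qed

text \<open>Three circles theorem for tori, by a maximum principle. Let \<open>s\<close> be the coordinate along the segment
from \<open>t1\<close> to \<open>t2\<close> and \<open>d\<close> the component transversal to it. If the claim failed, \<open>u\<close>
minus the function \<open>\<phi> = A + (B - A) s + \<eta> s (1 - s) + K |d|^2\<close> of \<open>(ln |z_k|)\<close> would have a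
positive interior maximum \<open>z0\<close> in the tube \<open>0 \<le> s \<le> 1\<close>, \<open>|d| \<le> \<rho>\<close>: near the two end tori
this is excluded by the bounds \<open>A\<close>, \<open>B\<close> and semicontinuity, on the lateral side by a large
\<open>K\<close>. On the disc \<open>z0_k (1 + r p_k \<zeta>)\<close> the concave term lowers the mean of \<open>\<phi>\<close> by about
\<open>\<eta> r^2 / 2\<close>. The disc leaves the line in direction \<open>p\<close> only to second order, so the transversal
penalty contributes merely \<open>O(r^4)\<close>. This contradicts the sub-mean value inequality at \<open>z0\<close>.\<close>

lemma psh_three_tori:
  fixes u :: "complex^'n \<Rightarrow> ereal" and t1 t2 :: "real^'n"
  assumes u: "psh u"
    and A: "\<And>z. z \<in> torus t1 \<Longrightarrow> u z \<le> ereal A" and B: "\<And>z. z \<in> torus t2 \<Longrightarrow> u z \<le> ereal B"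
    and l: "0 < l" "l < 1" and zs: "zs \<in> torus ((1 - l) *\<^sub>R t1 + l *\<^sub>R t2)"
  shows "u zs \<le> ereal ((1 - l) * A + l * B)"
proof (cases "t1 = t2")
  case True
  then have "zs \<in> torus t1" "zs \<in> torus t2" using zs by (simp_all flip: scaleR_add_left)
  then have "u zs \<le> ereal (min A B)" using A B by (simp add: min_def)
  moreover have "(1 - l) * min A B + l * min A B \<le> (1 - l) * A + l * B"
    using l by (intro add_mono mult_left_mono) auto
  then have "min A B \<le> (1 - l) * A + l * B" by (simp add: algebra_simps)
  ultimately show ?thesis by (meson ereal_less_eq(3) order_trans)
next
  case False
  have uu: "usc u" "\<And>z. u z < \<infinity>" using u by (auto simp: psh_def)
  show ?thesis
  proof (rule ccontr)
    assume "\<not> ?thesis"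
    then have gt: "ereal ((1 - l) * A + l * B) < u zs" by simp
    define p where "p = t2 - t1"
    define P where "P = norm p"
    have P: "P > 0" using False by (simp add: P_def p_def)
    have PP: "p \<bullet> p = P\<^sup>2" by (simp add: P_def power2_norm_eq_inner)
    obtain \<eta> where \<eta>: "\<eta> > 0" "ereal ((1 - l) * A + l * B + 2 * \<eta>) \<le> u zs"
    proof -
      obtain r where "ereal ((1 - l) * A + l * B) < ereal r" "ereal r < u zs" using ereal_dense2[OF gt] by blast
      moreover have "(1 - l) * A + l * B + 2 * ((r - ((1 - l) * A + l * B)) / 2) = r" by argo
      ultimately show ?thesis by (intro that[of "(r - ((1 - l) * A + l * B)) / 2"]) auto
    qed
    obtain \<rho>1 where \<rho>1: "\<rho>1 > 0" "\<And>t z. norm (t - t1) \<le> \<rho>1 \<Longrightarrow> z \<in> torus t \<Longrightarrow> u z < ereal (A + \<eta>)"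
      by (rule usc_torus_nearby[OF uu(1), of t1 "ereal (A + \<eta>)"]) (use A \<eta>(1) in \<open>force intro: le_less_trans\<close>)+
    obtain \<rho>2 where \<rho>2: "\<rho>2 > 0" "\<And>t z. norm (t - t2) \<le> \<rho>2 \<Longrightarrow> z \<in> torus t \<Longrightarrow> u z < ereal (B + \<eta>)"
      by (rule usc_torus_nearby[OF uu(1), of t2 "ereal (B + \<eta>)"]) (use B \<eta>(1) in \<open>force intro: le_less_trans\<close>)+
    define \<rho> where "\<rho> = min \<rho>1 \<rho>2"
    have \<rho>: "\<rho> > 0" "\<rho> \<le> \<rho>1" "\<rho> \<le> \<rho>2" using \<rho>1 \<rho>2 by (auto simp: \<rho>_def)
    define s where "s = (\<lambda>t. ((t - t1) \<bullet> p) / P\<^sup>2)"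
    define d where "d = (\<lambda>t. t - t1 - s t *\<^sub>R p)"
    have t_eq: "t = t1 + s t *\<^sub>R p + d t" for t by (simp add: d_def)
    \<comment> \<open>On the tube the logarithms of the moduli are at most \<open>R\<close> in absolute value, and a disc about such a point at most halves the moduli, so the truncation at \<open>\<delta>\<close> is never active there. It only makes the test function continuous everywhere.\<close>
    define R where "R = norm t1 + P + \<rho>"
    define \<delta> where "\<delta> = exp (- R) / 4"
    have \<delta>: "\<delta> > 0" by (simp add: \<delta>_def)
    let ?L = "ln_max \<delta>"
    define Q where "Q = {z. 0 \<le> s (?L z) \<and> s (?L z) \<le> 1 \<and> norm (d (?L z)) \<le> \<rho>}"
    have cL: "continuous_on UNIV ?L" using continuous_on_ln_max[OF \<delta>, of UNIV "\<lambda>y. y"] by simp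
    have cs: "continuous_on UNIV s" unfolding s_def using P by (intro continuous_intros) auto
    have cd: "continuous_on UNIV d" unfolding d_def by (intro continuous_intros cs)
    have csL: "continuous_on UNIV (\<lambda>z. s (?L z))" "continuous_on UNIV (\<lambda>z. d (?L z))"
      by (auto intro: continuous_on_compose2[OF cs cL] continuous_on_compose2[OF cd cL])
    have QR: "norm (?L z) \<le> R" if "z \<in> Q" for z
    proof -
      have "norm (?L z) \<le> norm t1 + norm (s (?L z) *\<^sub>R p) + norm (d (?L z))"
        by (subst t_eq) (metis add_right_mono norm_triangle_le norm_triangle_ineq order_refl)
      moreover have "norm (s (?L z) *\<^sub>R p) \<le> 1 * P"
        using that unfolding norm_scaleR P_def Q_def by (intro mult_right_mono) auto
      ultimately show ?thesis using that by (simp add: R_def Q_def)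
    qed
    have QRk: "exp (- R) \<le> norm (z $ k)" "norm (z $ k) \<le> exp R" if "z \<in> Q" for z k
    proof -
      have "\<bar>?L z $ k\<bar> \<le> R" using component_le_norm_cart[of "?L z" k] QR[OF that] by linarith
      then have 1: "- R \<le> ln (max (norm (z $ k)) \<delta>)" "ln (max (norm (z $ k)) \<delta>) \<le> R" by (auto simp: ln_max_def)
      have pos: "max (norm (z $ k)) \<delta> > 0" using \<delta> by auto
      have "exp (- R) \<le> max (norm (z $ k)) \<delta>" "max (norm (z $ k)) \<delta> \<le> exp R"
        using 1 pos by (auto simp: ln_ge_iff) (metis exp_le_cancel_iff exp_ln max.bounded_iff pos)+
      moreover have "\<delta> < exp (- R)" by (simp add: \<delta>_def)
      ultimately show "exp (- R) \<le> norm (z $ k)" "norm (z $ k) \<le> exp R" by auto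
    qed
    have Lln: "?L z = ln_vec z" if "\<And>k. \<delta> \<le> norm (z $ k)" for z
      using that unfolding ln_max_def ln_vec_def by (simp only: max_absorb1)
    have dR: "\<delta> < exp (- R) / 2" by (simp add: \<delta>_def)
    have Qtorus: "z \<in> torus (?L z)" if "z \<in> Q" for z
    proof -
      have "\<delta> \<le> norm (z $ k)" for k using QRk(1)[OF that, of k] by (rule order_trans[rotated]) (simp add: \<delta>_def)
      moreover have "z $ k \<noteq> 0" for k using \<open>\<And>k. \<delta> \<le> norm (z $ k)\<close>[of k] \<delta> by auto
      ultimately show ?thesis using mem_torus_ln_vec[of z] Lln[of z] by simp
    qed
    have "bounded Q"
    proof (rule boundedI)
      fix z assume "z \<in> Q"
      have "norm z \<le> (\<Sum>k\<in>UNIV. norm (z $ k))" by (rule norm_cart_le_sum)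
      also have "\<dots> \<le> (\<Sum>k\<in>(UNIV::'n set). exp R)" by (intro sum_mono QRk \<open>z \<in> Q\<close>)
      finally show "norm z \<le> (\<Sum>k\<in>(UNIV::'n set). exp R)" .
    qed
    moreover have "closed Q" unfolding Q_def
      by (intro closed_Collect_conj closed_Collect_le continuous_intros csL)
    ultimately have "compact Q" by (simp add: compact_eq_bounded_closed)
    have zsL: "?L zs = (1 - l) *\<^sub>R t1 + l *\<^sub>R t2"
    proof -
      let ?t = "(1 - l) *\<^sub>R t1 + l *\<^sub>R t2"
      have "?t = t1 + l *\<^sub>R p" by (simp add: p_def algebra_simps)
      then have "norm ?t \<le> norm t1 + norm (l *\<^sub>R p)" by (metis norm_triangle_ineq)
      also have "norm (l *\<^sub>R p) \<le> P" unfolding norm_scaleR P_def using l by (intro mult_left_le_one_le) auto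
      then have "norm t1 + norm (l *\<^sub>R p) \<le> R" using \<rho> by (simp add: R_def)
      finally have nt: "norm ?t \<le> R" .
      have t_ge: "- R \<le> ?t $ k" for k using component_le_norm_cart[of ?t k] nt by linarith
      have "\<delta> \<le> norm (zs $ k)" for k
      proof -
        have "norm (zs $ k) = exp (?t $ k)" using zs unfolding torus_def by blast
        moreover have "exp (- R) \<le> exp (?t $ k)" using t_ge[of k] by simp
        moreover have "\<delta> \<le> exp (- R)" by (simp add: \<delta>_def)
        ultimately show ?thesis by linarith
      qed
      then show ?thesis by (rule trans[OF Lln ln_vec_torus[OF zs]])
    qed
    have szs: "s (?L zs) = l" "d (?L zs) = 0"
    proof -
      have e: "?L zs - t1 = l *\<^sub>R p" unfolding zsL by (simp add: p_def algebra_simps)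
      show "s (?L zs) = l" unfolding s_def e using P by (simp add: PP)
      then show "d (?L zs) = 0" unfolding d_def e by simp
    qed
    then have zsQ: "zs \<in> Q" using l \<rho> by (simp add: Q_def)
    obtain zM where zM: "zM \<in> Q" "\<And>y. y \<in> Q \<Longrightarrow> u y \<le> u zM"
      using usc_attains_max[OF uu(1) \<open>compact Q\<close>] zsQ by blast
    obtain M where M: "\<And>y. y \<in> Q \<Longrightarrow> u y \<le> ereal M"
    proof (cases "u zM")
      case (real M)
      then show ?thesis using zM(2) that[of M] by simp
    next
      case PInf then show ?thesis using uu(2)[of zM] by simp
    next
      case MInf then show ?thesis using zM(2) that[of 0] by force
    qed
    define K where "K = max 0 ((M - min A B) / \<rho>\<^sup>2)"
    have K: "K \<ge> 0" "K * \<rho>\<^sup>2 \<ge> M - min A B"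
      using \<rho> by (auto simp: K_def max_def divide_less_0_iff field_simps not_le)
    define \<phi> where "\<phi> = (\<lambda>t. A + (B - A) * s t + \<eta> * (s t * (1 - s t)) + K * (d t \<bullet> d t))"
    have c\<phi>: "continuous_on UNIV (\<lambda>z. - \<phi> (?L z))" unfolding \<phi>_def by (intro continuous_intros csL)
    obtain z0 where z0: "z0 \<in> Q" "\<And>y. y \<in> Q \<Longrightarrow> u y + ereal (- \<phi> (?L y)) \<le> u z0 + ereal (- \<phi> (?L z0))"
      using usc_attains_max[OF usc_add_continuous[OF uu(1) c\<phi>] \<open>compact Q\<close>] zsQ by blast
    have "ereal \<eta> \<le> u zs + ereal (- \<phi> (?L zs))"
    proof -
      have "l * (1 - l) \<le> 1 * 1" using l by (intro mult_mono) auto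
      then have "\<eta> * (l * (1 - l)) \<le> \<eta>" using \<eta>(1) by (simp add: mult_left_le)
      then have "\<eta> \<le> ((1 - l) * A + l * B + 2 * \<eta>) - \<phi> (?L zs)" by (simp add: \<phi>_def szs algebra_simps)
      then have "ereal \<eta> \<le> ereal ((1 - l) * A + l * B + 2 * \<eta>) + ereal (- \<phi> (?L zs))" by simp
      also have "\<dots> \<le> u zs + ereal (- \<phi> (?L zs))" by (rule add_right_mono[OF \<eta>(2)])
      finally show ?thesis .
    qed
    then have g0: "ereal \<eta> \<le> u z0 + ereal (- \<phi> (?L z0))" using z0(2)[OF zsQ] by (rule order_trans)
    then obtain U where U: "u z0 = ereal U" using uu(2)[of z0] by (cases "u z0") auto
    with g0 have UU: "\<eta> \<le> U - \<phi> (?L z0)" by simp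
    define t0 where "t0 = ?L z0"
    have s0: "0 \<le> s t0" "s t0 \<le> 1" "norm (d t0) \<le> \<rho>" using z0(1) by (auto simp: Q_def t0_def)
    have t0: "z0 \<in> torus t0" unfolding t0_def by (rule Qtorus[OF z0(1)])
    have ss: "0 \<le> \<eta> * (s t0 * (1 - s t0))" using s0 \<eta> by simp
    have s0n: "s t0 \<noteq> 0"
    proof
      assume 0: "s t0 = 0"
      then have "norm (t0 - t1) \<le> \<rho>1" using s0 \<rho> t_eq[of t0] by (metis add_diff_cancel_left' add.right_neutral order_trans scaleR_zero_left)
      from \<rho>1(2)[OF this t0] have "U < A + \<eta>" by (simp add: U)
      moreover have "\<phi> t0 \<ge> A" using 0 K by (simp add: \<phi>_def)
      ultimately show False using UU by (simp add: t0_def)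
    qed
    have s1n: "s t0 \<noteq> 1"
    proof
      assume 1: "s t0 = 1"
      then have "t0 - t2 = d t0" using t_eq[of t0] by (simp add: p_def algebra_simps)
      then have "norm (t0 - t2) \<le> \<rho>2" using s0 \<rho> by simp
      from \<rho>2(2)[OF this t0] have "U < B + \<eta>" by (simp add: U)
      moreover have "\<phi> t0 \<ge> B" using 1 K by (simp add: \<phi>_def)
      ultimately show False using UU by (simp add: t0_def)
    qed
    have dn: "norm (d t0) \<noteq> \<rho>"
    proof
      assume "norm (d t0) = \<rho>"
      then have "d t0 \<bullet> d t0 = \<rho>\<^sup>2" by (simp add: dot_square_norm)
      moreover have "(1 - s t0) * min A B + s t0 * min A B \<le> (1 - s t0) * A + s t0 * B"
        using s0 by (intro add_mono mult_left_mono) auto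
      then have "min A B \<le> A + (B - A) * s t0" by (simp add: algebra_simps)
      ultimately have "\<phi> t0 \<ge> M" using K ss by (simp add: \<phi>_def)
      moreover have "U \<le> M" using M[OF z0(1)] U by simp
      ultimately show False using UU \<eta> by (simp add: t0_def)
    qed
    have s0': "0 < s t0" "s t0 < 1" "norm (d t0) < \<rho>" using s0 s0n s1n dn by linarith+
    \<comment> \<open>The radius is small enough for the disc to stay inside the tube and for the concave term to beat both error terms.\<close>
    obtain r where r: "r > 0" "r * P \<le> 1/2" "r + 2 * r\<^sup>2 * P < min (s t0) (1 - s t0)"
      "4 * r\<^sup>2 * P\<^sup>2 < \<rho> - norm (d t0)" "8 * \<eta> * r * P + 32 * K * r\<^sup>2 * P^4 < \<eta>"
    proof -
      have "eventually (\<lambda>r. r > 0) (at_right (0::real))" by (rule eventually_at_right_less)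
      moreover have "((\<lambda>r. r * P) \<longlongrightarrow> 0) (at_right 0)" by (auto intro!: tendsto_eq_intros)
      then have "eventually (\<lambda>r. r * P < 1/2) (at_right 0)" by (rule order_tendstoD) simp
      moreover have "((\<lambda>r. r + 2 * r\<^sup>2 * P) \<longlongrightarrow> 0) (at_right 0)" by (auto intro!: tendsto_eq_intros)
      then have "eventually (\<lambda>r. r + 2 * r\<^sup>2 * P < min (s t0) (1 - s t0)) (at_right 0)" by (rule order_tendstoD) (use s0' in simp)
      moreover have "((\<lambda>r. 4 * r\<^sup>2 * P\<^sup>2) \<longlongrightarrow> 0) (at_right 0)" by (auto intro!: tendsto_eq_intros)
      then have "eventually (\<lambda>r. 4 * r\<^sup>2 * P\<^sup>2 < \<rho> - norm (d t0)) (at_right 0)" by (rule order_tendstoD) (use s0' in simp)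
      moreover have "((\<lambda>r. 8 * \<eta> * r * P + 32 * K * r\<^sup>2 * P^4) \<longlongrightarrow> 0) (at_right 0)" by (auto intro!: tendsto_eq_intros)
      then have "eventually (\<lambda>r. 8 * \<eta> * r * P + 32 * K * r\<^sup>2 * P^4 < \<eta>) (at_right 0)" by (rule order_tendstoD) (use \<eta> in simp)
      ultimately have "eventually (\<lambda>r. r > 0 \<and> r * P < 1/2 \<and> r + 2 * r\<^sup>2 * P < min (s t0) (1 - s t0) \<and>
         4 * r\<^sup>2 * P\<^sup>2 < \<rho> - norm (d t0) \<and> 8 * \<eta> * r * P + 32 * K * r\<^sup>2 * P^4 < \<eta>) (at_right 0)"
        by eventually_elim auto
      then have "\<exists>r. r > 0 \<and> r * P < 1/2 \<and> r + 2 * r\<^sup>2 * P < min (s t0) (1 - s t0) \<and>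
         4 * r\<^sup>2 * P\<^sup>2 < \<rho> - norm (d t0) \<and> 8 * \<eta> * r * P + 32 * K * r\<^sup>2 * P^4 < \<eta>"
        by (rule eventually_happens'[rotated]) simp
      then show ?thesis using that by (meson less_imp_le)
    qed
    define b :: "complex^'n" where "b = (\<chi> k. z0 $ k * of_real (r * p $ k))"
    define h where "h = (\<lambda>\<theta>. (\<chi> k. ln (cmod (1 + of_real (r * p $ k) * cis \<theta>))) :: real^'n)"
    have rP: "0 \<le> r" "r * norm p \<le> 1/2" using r by (auto simp: P_def)
    have ex1: "norm (h \<theta> - (r * cos \<theta>) *\<^sub>R p) \<le> 2 * r\<^sup>2 * P\<^sup>2" for \<theta>
      unfolding h_def P_def by (rule disc_ln_expansion(1)[OF rP])
    have ex2: "((\<lambda>\<theta>. h \<theta> \<bullet> w) has_integral 0) {0..2*pi}" for w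
      unfolding h_def by (rule disc_ln_expansion(2)[OF rP])
    have ex3: "continuous_on UNIV h"
      unfolding h_def by (rule disc_ln_expansion(3)[OF rP])
    have ex4: "1 / 2 \<le> cmod (1 + of_real (r * p $ k) * cis \<theta>)" for k \<theta>
      by (rule disc_ln_expansion(4)[OF rP])
    have zk: "(z0 + cis \<theta> *s b) $ k = z0 $ k * (1 + of_real (r * p $ k) * cis \<theta>)" for \<theta> k
      by (simp add: b_def algebra_simps)
    have Lth: "?L (z0 + cis \<theta> *s b) = t0 + h \<theta>" for \<theta>
    proof -
      have 1: "exp (-R) / 2 \<le> norm ((z0 + cis \<theta> *s b) $ k)" for k
      proof -
        have "exp (-R) * (1/2) \<le> norm (z0 $ k) * cmod (1 + of_real (r * p $ k) * cis \<theta>)"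
          by (intro mult_mono QRk(1)[OF z0(1)] ex4) auto
        then show ?thesis unfolding zk norm_mult by simp
      qed
      have "\<delta> \<le> norm ((z0 + cis \<theta> *s b) $ k)" for k using 1[of k] dR by linarith
      then have "?L (z0 + cis \<theta> *s b) = ln_vec (z0 + cis \<theta> *s b)" by (rule Lln)
      also have "\<dots> $ k = (t0 + h \<theta>) $ k" for k
      proof -
        have "norm (z0 $ k) = exp (t0 $ k)" using t0 by (simp add: torus_def)
        moreover have "cmod (1 + of_real (r * p $ k) * cis \<theta>) > 0" using ex4[of k \<theta>] by linarith
        ultimately show ?thesis unfolding ln_vec_def vec_lambda_beta zk norm_mult
          by (simp add: h_def ln_mult_pos)
      qed
      then have "ln_vec (z0 + cis \<theta> *s b) = t0 + h \<theta>" by (simp add: vec_eq_iff)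
      finally show ?thesis .
    qed
    define \<sigma> where "\<sigma> = (\<lambda>\<theta>. (h \<theta> \<bullet> p) / P\<^sup>2)"
    define e where "e = (\<lambda>\<theta>. h \<theta> - \<sigma> \<theta> *\<^sub>R p)"
    have s\<sigma>: "s (t0 + h \<theta>) = s t0 + \<sigma> \<theta>" for \<theta>
      by (simp add: s_def \<sigma>_def inner_add_left inner_diff_left add_divide_distrib diff_divide_distrib)
    have de: "d (t0 + h \<theta>) = d t0 + e \<theta>" for \<theta>
      unfolding d_def s\<sigma> e_def by (simp add: algebra_simps)
    define E where "E = (\<lambda>\<theta>. h \<theta> - (r * cos \<theta>) *\<^sub>R p)"
    have E: "norm (E \<theta>) \<le> 2 * r\<^sup>2 * P\<^sup>2" for \<theta> using ex1 by (simp add: E_def)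
    define \<tau> where "\<tau> = (\<lambda>\<theta>. (E \<theta> \<bullet> p) / P\<^sup>2)"
    have \<sigma>\<tau>: "\<sigma> \<theta> = r * cos \<theta> + \<tau> \<theta>" for \<theta>
      using P by (simp add: \<sigma>_def \<tau>_def E_def inner_diff_left PP diff_divide_distrib)
    have \<tau>: "\<bar>\<tau> \<theta>\<bar> \<le> 2 * r\<^sup>2 * P" for \<theta>
    proof -
      have "\<bar>E \<theta> \<bullet> p\<bar> \<le> norm (E \<theta>) * P" unfolding P_def by (rule Cauchy_Schwarz_ineq2)
      also have "\<dots> \<le> (2 * r\<^sup>2 * P\<^sup>2) * P" using E[of \<theta>] P by (intro mult_right_mono) auto
      finally have "\<bar>E \<theta> \<bullet> p\<bar> \<le> (2 * r\<^sup>2 * P) * P\<^sup>2" by (simp add: mult_ac)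
      then show ?thesis using P by (simp add: \<tau>_def pos_divide_le_eq)
    qed
    have e_le: "norm (e \<theta>) \<le> 4 * r\<^sup>2 * P\<^sup>2" for \<theta>
    proof -
      have "e \<theta> = E \<theta> - \<tau> \<theta> *\<^sub>R p" by (simp add: e_def E_def \<sigma>\<tau> algebra_simps)
      then have "norm (e \<theta>) \<le> norm (E \<theta>) + \<bar>\<tau> \<theta>\<bar> * P" by (simp add: P_def) (metis norm_scaleR norm_triangle_ineq4)
      also have "\<dots> \<le> 2 * r\<^sup>2 * P\<^sup>2 + (2 * r\<^sup>2 * P) * P" using P by (intro add_mono E mult_right_mono \<tau>) auto
      finally show ?thesis by (simp add: power2_eq_square mult_ac)
    qed
    have \<sigma>_le: "\<bar>\<sigma> \<theta>\<bar> \<le> r + 2 * r\<^sup>2 * P" for \<theta>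
    proof -
      have "\<bar>r * cos \<theta>\<bar> \<le> r" using r by (simp add: abs_mult)
      then show ?thesis using \<tau>[of \<theta>] unfolding \<sigma>\<tau> by linarith
    qed
    have inQ: "z0 + cis \<theta> *s b \<in> Q" for \<theta>
    proof -
      have "norm (d t0 + e \<theta>) \<le> \<rho>" using norm_triangle_ineq[of "d t0" "e \<theta>"] e_le[of \<theta>] r by linarith
      then show ?thesis unfolding Q_def Lth s\<sigma> de mem_Collect_eq using \<sigma>_le[of \<theta>] r(3) by auto
    qed
    define c where "c = (B - A) + \<eta> * (1 - 2 * s t0)"
    \<comment> \<open>The linear part of \<open>\<phi> (t0 + h) - \<phi> t0\<close> as an inner product, so that its circle mean vanishes.\<close>
    define w where "w = (c / P\<^sup>2) *\<^sub>R p + (2 * K) *\<^sub>R (d t0 - ((d t0 \<bullet> p) / P\<^sup>2) *\<^sub>R p)"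
    have hw: "h \<theta> \<bullet> w = c * \<sigma> \<theta> + 2 * K * (d t0 \<bullet> e \<theta>)" for \<theta>
      by (simp add: w_def \<sigma>_def e_def inner_add_right inner_diff_right inner_commute algebra_simps)
    define G where "G = (\<lambda>\<theta>. U + 4 * \<eta> * r^3 * P + 16 * K * r^4 * P^4 + h \<theta> \<bullet> w - \<eta> * r\<^sup>2 * (cos \<theta>)\<^sup>2)"
    have uG: "u (z0 + cis \<theta> *s b) \<le> ereal (G \<theta>)" for \<theta>
    proof -
      have "u (z0 + cis \<theta> *s b) + ereal (- \<phi> (t0 + h \<theta>)) \<le> ereal (U - \<phi> t0)"
        using z0(2)[OF inQ[of \<theta>]] unfolding Lth U by (simp add: t0_def)
      then have 1: "u (z0 + cis \<theta> *s b) \<le> ereal (U + \<phi> (t0 + h \<theta>) - \<phi> t0)"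
        by (cases "u (z0 + cis \<theta> *s b)") auto
      have 2: "\<phi> (t0 + h \<theta>) - \<phi> t0 = h \<theta> \<bullet> w - \<eta> * (\<sigma> \<theta>)\<^sup>2 + K * (e \<theta> \<bullet> e \<theta>)"
        unfolding hw \<phi>_def s\<sigma> de c_def
        by (simp add: algebra_simps power2_eq_square inner_add_left inner_add_right inner_commute)
      have "e \<theta> \<bullet> e \<theta> \<le> (4 * r\<^sup>2 * P\<^sup>2)\<^sup>2"
        unfolding dot_square_norm using e_le[of \<theta>] by (intro power_mono) auto
      also have "(4 * r\<^sup>2 * P\<^sup>2)\<^sup>2 = 16 * r^4 * P^4" by (simp add: power_mult_distrib flip: power_mult)
      finally have "K * (e \<theta> \<bullet> e \<theta>) \<le> K * (16 * r^4 * P^4)" using K by (intro mult_left_mono)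
      then have 3: "K * (e \<theta> \<bullet> e \<theta>) \<le> 16 * K * r^4 * P^4" by (simp add: mult_ac)
      have "\<bar>2 * (r * cos \<theta>) * \<tau> \<theta>\<bar> \<le> (2 * r) * (2 * r\<^sup>2 * P)"
        unfolding abs_mult using r \<tau>[of \<theta>] by (intro mult_mono) (auto simp: mult_left_le)
      moreover have "(2 * r) * (2 * r\<^sup>2 * P) = 4 * r^3 * P" by (simp add: power3_eq_cube power2_eq_square)
      ultimately have "2 * (r * cos \<theta>) * \<tau> \<theta> \<ge> - (4 * r^3 * P)" by linarith
      moreover have "(\<sigma> \<theta>)\<^sup>2 = r\<^sup>2 * (cos \<theta>)\<^sup>2 + 2 * (r * cos \<theta>) * \<tau> \<theta> + (\<tau> \<theta>)\<^sup>2"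
        unfolding \<sigma>\<tau> by (simp add: power2_eq_square algebra_simps)
      ultimately have "r\<^sup>2 * (cos \<theta>)\<^sup>2 - 4 * r^3 * P \<le> (\<sigma> \<theta>)\<^sup>2" using zero_le_power2[of "\<tau> \<theta>"] by linarith
      then have "\<eta> * (r\<^sup>2 * (cos \<theta>)\<^sup>2 - 4 * r^3 * P) \<le> \<eta> * (\<sigma> \<theta>)\<^sup>2" using \<eta> by (intro mult_left_mono) auto
      then have "\<eta> * r\<^sup>2 * (cos \<theta>)\<^sup>2 - 4 * \<eta> * r^3 * P \<le> \<eta> * (\<sigma> \<theta>)\<^sup>2" by (simp add: algebra_simps)
      then have "U + \<phi> (t0 + h \<theta>) - \<phi> t0 \<le> G \<theta>" using 2 3 unfolding G_def by linarith
      then show ?thesis using 1 by (meson ereal_less_eq(3) order_trans)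
    qed
    have cG: "continuous_on {0..2*pi} G" unfolding G_def
      by (intro continuous_intros continuous_on_subset[OF ex3]) auto
    have "(G has_integral (2*pi) * (U + 4 * \<eta> * r^3 * P + 16 * K * r^4 * P^4) + 0 - \<eta> * r\<^sup>2 * pi) {0..2*pi}"
      unfolding G_def
      using has_integral_const_real[of "U + 4 * \<eta> * r^3 * P + 16 * K * r^4 * P^4" 0 "2*pi"]
      by (intro has_integral_diff has_integral_add ex2 has_integral_mult_right has_integral_cos_square) simp
    then have iG: "integral {0..2*pi} G / (2*pi) = U + 4 * \<eta> * r^3 * P + 16 * K * r^4 * P^4 - \<eta> * r\<^sup>2 / 2"
      by (simp add: integral_unique field_simps)
    have "u z0 \<le> circle_mean (\<lambda>\<theta>. u (z0 + cis \<theta> *s b))" using u by (simp add: psh_def)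
    also have "\<dots> \<le> circle_mean (\<lambda>\<theta>. ereal (G \<theta>))" by (intro circle_mean_mono uG)
    also have "\<dots> = ereal (U + 4 * \<eta> * r^3 * P + 16 * K * r^4 * P^4 - \<eta> * r\<^sup>2 / 2)"
      by (subst circle_mean_real[OF cG]) (simp add: iG)
    finally have "\<eta> * r\<^sup>2 / 2 \<le> 4 * \<eta> * r^3 * P + 16 * K * r^4 * P^4" by (simp add: U)
    moreover have "(r\<^sup>2 / 2) * (8 * \<eta> * r * P + 32 * K * r\<^sup>2 * P^4) < (r\<^sup>2 / 2) * \<eta>"
      using r by (intro mult_strict_left_mono) auto
    ultimately show False by (simp add: algebra_simps power2_eq_square power3_eq_cube power4_eq_xxxx)
  qed
qed

section \<open>The indicator as a recession function\<close>

lemma convex_on_ray_slope: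
  fixes f :: "'a::real_vector \<Rightarrow> real"
  assumes f: "convex_on UNIV f" and R: "0 < r" "r \<le> R"
  shows "(f (t + r *\<^sub>R e) - f t) / r \<le> (f (t + R *\<^sub>R e) - f t) / R"
proof -
  define l where "l = r / R"
  have l: "0 \<le> l" "l \<le> 1" "l * R = r" using R by (auto simp: l_def)
  have "f ((1 - l) *\<^sub>R t + l *\<^sub>R (t + R *\<^sub>R e)) \<le> (1 - l) * f t + l * f (t + R *\<^sub>R e)"
    using l by (intro convex_onD[OF f]) auto
  moreover have "(1 - l) *\<^sub>R t + l *\<^sub>R (t + R *\<^sub>R e) = t + (l * R) *\<^sub>R e"
    by (simp add: algebra_simps)
  ultimately have "f (t + r *\<^sub>R e) \<le> (1 - l) * f t + l * f (t + R *\<^sub>R e)" by (simp only: l(3))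
  then have "f (t + r *\<^sub>R e) - f t \<le> l * (f (t + R *\<^sub>R e) - f t)" by (simp add: algebra_simps)
  then show ?thesis using R by (simp add: l_def field_simps)
qed

text \<open>A convex function which grows along a ray at most with slope \<open>c\<close> has all its increments bounded by
that slope, since difference quotients increase.\<close>

lemma convex_on_increment_le:
  fixes f :: "'a::real_vector \<Rightarrow> real"
  assumes f: "convex_on UNIV f" and le: "\<And>R. R \<ge> 1 \<Longrightarrow> f (t + R *\<^sub>R e) \<le> c * R + b"
  shows "f (t + e) \<le> f t + c"
proof -
  have "f (t + e) - f t \<le> c + (b - f t) * inverse R" if "R \<ge> 1" for R
  proof -
    have "f (t + e) - f t \<le> (f (t + R *\<^sub>R e) - f t) / R"
      using convex_on_ray_slope[OF f, of 1 R t e] that by simp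
    also have "\<dots> \<le> (c * R + b - f t) / R" using le[OF that] that by (intro divide_right_mono) auto
    also have "\<dots> = c + (b - f t) * inverse R" using that by (simp add: field_simps)
    finally show ?thesis .
  qed
  then have "eventually (\<lambda>R. f (t + e) - f t \<le> c + (b - f t) * inverse R) at_top"
    by (rule eventually_mono[OF eventually_ge_at_top[of 1]])
  moreover have "((\<lambda>R. c + (b - f t) * inverse R) \<longlongrightarrow> c + (b - f t) * 0) at_top"
    by (intro tendsto_intros tendsto_inverse_0_at_top filterlim_ident)
  ultimately have "f (t + e) - f t \<le> c + (b - f t) * 0"
    by (intro tendsto_lowerbound[of _ _ at_top]) auto
  then show ?thesis by simp
qed

text \<open>The growth condition with its constants; the point \<open>x\<close> of the statement is translated to 0.\<close>

locale log_growth =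
  fixes u :: "complex^'n \<Rightarrow> ereal" and C1 C2 :: real
  assumes psh: "psh u" and C1: "C1 \<ge> 0"
    and growth: "u z \<le> ereal (C1 * ln (max 1 (norm z)) + C2)"
begin

definition v :: "real^'n \<Rightarrow> real" where
  "v t = real_of_ereal (torus_max u 0 t)"

lemma torus_max_eq: "torus_max u 0 t = (SUP z\<in>torus t. u z)"
  by (simp add: torus_max_def torus_def)

lemma torus_max_le:
  assumes "\<And>k. t $ k \<le> T" "T \<ge> 0"
  shows "torus_max u 0 t \<le> ereal (C1 * (ln (real CARD('n)) + T) + C2)"
  unfolding torus_max_eq
proof (rule SUP_least)
  fix z assume z: "z \<in> torus t"
  have "norm z \<le> (\<Sum>k\<in>UNIV. norm (z $ k))" by (rule norm_cart_le_sum)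
  also have "\<dots> \<le> (\<Sum>k\<in>(UNIV::'n set). exp T)" using z assms(1) by (intro sum_mono) (auto simp: torus_def)
  also have "\<dots> = real CARD('n) * exp T" by simp
  finally have "max 1 (norm z) \<le> real CARD('n) * exp T"
    using mult_mono[of 1 "real CARD('n)" 1 "exp T"] assms(2) by simp
  then have "ln (max 1 (norm z)) \<le> ln (real CARD('n) * exp T)" by (intro ln_mono) auto
  also have "\<dots> = ln (real CARD('n)) + T" by (simp add: ln_mult_pos)
  finally have "C1 * ln (max 1 (norm z)) + C2 \<le> C1 * (ln (real CARD('n)) + T) + C2"
    using C1 by (simp add: mult_left_mono)
  then show "u z \<le> ereal (C1 * (ln (real CARD('n)) + T) + C2)"
    using growth[of z] by (meson ereal_less_eq(3) order_trans)
qed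

text \<open>If \<open>u\<close> were \<open>-\<infinity>\<close> on one torus, convexity between that torus and one reflected in an arbitrary
third torus would make \<open>u\<close> equal to \<open>-\<infinity>\<close> on the third.\<close>

lemma torus_max_not_MInf: "torus_max u 0 t \<noteq> -\<infinity>"
proof
  assume "torus_max u 0 t = -\<infinity>"
  then have MInf: "u z = -\<infinity>" if "z \<in> torus t" for z
    using that SUP_upper[of z "torus t" u] unfolding torus_max_eq by simp
  have "u y = -\<infinity>" if y: "\<forall>k. y $ k \<noteq> 0" for y
  proof (rule ereal_bot)
    fix a :: real
    define t' where "t' = ln_vec y"
    define t2 where "t2 = t' + (t' - t)"
    define B where "B = C1 * (ln (real CARD('n)) + norm t2) + C2"
    have "t2 $ k \<le> norm t2" for k using component_le_norm_cart[of t2 k] by linarith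
    then have "torus_max u 0 t2 \<le> ereal B" unfolding B_def by (rule torus_max_le) simp
    then have B: "u z \<le> ereal B" if "z \<in> torus t2" for z
      using that SUP_upper2[of z "torus t2"] unfolding torus_max_eq by (auto simp: SUP_le_iff)
    have "t' = (1 - 1/2) *\<^sub>R t + (1/2) *\<^sub>R t2" by (simp add: t2_def scaleR_add_right scaleR_diff_right flip: scaleR_add_left)
    then have "y \<in> torus ((1 - 1/2) *\<^sub>R t + (1/2) *\<^sub>R t2)"
      using mem_torus_ln_vec[of y] y by (simp add: t'_def)
    from psh_three_tori[OF psh _ B _ _ this, of "2 * a - B"] 
    show "u y \<le> ereal a" using MInf by (simp add: field_simps)
  qed
  then have off: "u y \<le> -\<infinity>" if "\<forall>k. y $ k \<noteq> 0" for y using that by simp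
  have "usc (\<lambda>_ :: complex^'n. -\<infinity>)" unfolding usc_def by (auto intro: open_UNIV)
  from psh_le_off_axes[OF psh this off] have "u a = -\<infinity>" for a by simp
  moreover obtain a where "u a \<noteq> -\<infinity>" using psh unfolding psh_def by blast
  ultimately show False by blast
qed

lemma torus_max_v: "torus_max u 0 t = ereal (v t)"
proof -
  have "t $ k \<le> norm t" for k using component_le_norm_cart[of t k] by linarith
  from torus_max_le[of t, OF this] have "torus_max u 0 t \<noteq> \<infinity>" by auto
  with torus_max_not_MInf[of t] show ?thesis unfolding v_def by (cases "torus_max u 0 t") auto
qed

lemma u_le_v: "z \<in> torus t \<Longrightarrow> u z \<le> ereal (v t)"
  using SUP_upper[of z "torus t" u] unfolding torus_max_eq[symmetric] torus_max_v .

lemma v_least: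
  assumes "\<And>z. z \<in> torus t \<Longrightarrow> u z \<le> ereal c" shows "v t \<le> c"
proof -
  have "torus_max u 0 t \<le> ereal c" unfolding torus_max_eq using assms by (rule SUP_least)
  then show ?thesis by (simp add: torus_max_v)
qed

lemma v_growth: "(\<And>k. t $ k \<le> T) \<Longrightarrow> T \<ge> 0 \<Longrightarrow> v t \<le> C1 * (ln (real CARD('n)) + T) + C2"
  using torus_max_le[of t T] torus_max_v[of t] by simp

lemma convex_v: "convex_on UNIV v"
proof (rule convex_onI)
  fix l :: real and s t :: "real^'n"
  assume "0 < l" "l < 1"
  then show "v ((1 - l) *\<^sub>R s + l *\<^sub>R t) \<le> (1 - l) * v s + l * v t"
    by (intro v_least psh_three_tori[OF psh u_le_v u_le_v])
qed simp

text \<open>A convex function of at most linear growth is Lipschitz with the growth rate as constant.\<close>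

lemma v_Lipschitz: "v (t + e) \<le> v t + C1 * norm e"
proof (rule convex_on_increment_le[OF convex_v])
  fix R :: real assume R: "R \<ge> 1"
  have "(t + R *\<^sub>R e) $ k \<le> norm t + R * norm e" for k
    using component_le_norm_cart[of "t + R *\<^sub>R e" k] norm_triangle_ineq[of t "R *\<^sub>R e"] R by simp
  then have "v (t + R *\<^sub>R e) \<le> C1 * (ln (real CARD('n)) + (norm t + R * norm e)) + C2"
    by (rule v_growth) (use R in simp)
  then show "v (t + R *\<^sub>R e) \<le> C1 * norm e * R + (C1 * (ln (real CARD('n)) + norm t) + C2)"
    by (simp add: algebra_simps)
qed

text \<open>Decreasing coordinates moves along a ray on which the growth condition bounds \<open>v\<close>, and a convex function
bounded above on a ray does not increase along it.\<close>

lemma v_mono: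
  assumes "\<And>k. s $ k \<le> t $ k" shows "v s \<le> v t"
proof -
  have "v (t + (s - t)) \<le> v t + 0"
  proof (rule convex_on_increment_le[OF convex_v])
    fix R :: real assume R: "R \<ge> 1"
    have "(t + R *\<^sub>R (s - t)) $ k \<le> norm t" for k
      using component_le_norm_cart[of t k] R assms[of k] mult_nonneg_nonpos[of R "s $ k - t $ k"] by simp
    then have "v (t + R *\<^sub>R (s - t)) \<le> C1 * (ln (real CARD('n)) + norm t) + C2"
      by (rule v_growth) simp
    then show "v (t + R *\<^sub>R (s - t)) \<le> 0 * R + (C1 * (ln (real CARD('n)) + norm t) + C2)" by simp
  qed
  then show ?thesis by simp
qed

text \<open>The bound by the maximum over the distinguished boundary, also on the coordinate hyperplanes, where it comes
from circles avoiding them.\<close>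

lemma u_le_v_polydisc:
  assumes y: "\<And>k. norm (y $ k) < exp (t $ k)"
  shows "u y \<le> ereal (v t)"
proof -
  define e where "e = Min (range (\<lambda>k. exp (t $ k) - norm (y $ k)))"
  have "e > 0" unfolding e_def using y by (subst Min_gr_iff) auto
  have e: "e \<le> exp (t $ k) - norm (y $ k)" for k unfolding e_def by (intro Min_le) auto
  from small_circle_off_axes[OF \<open>e > 0\<close>, of y] obtain \<epsilon> where \<epsilon>: "\<epsilon> \<le> e"
    "\<And>\<theta> k. (y + cis \<theta> *s (\<chi> k. of_real \<epsilon>)) $ k \<noteq> 0"
    "\<And>\<theta> k. norm ((y + cis \<theta> *s (\<chi> k. of_real \<epsilon>)) $ k) \<le> norm (y $ k) + \<epsilon>" by metis
  show ?thesis
  proof (rule psh_le_circle[OF psh])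
    fix \<theta>
    let ?z = "y + cis \<theta> *s (\<chi> k. of_real \<epsilon>)"
    have "u ?z \<le> ereal (v (ln_vec ?z))" by (intro u_le_v mem_torus_ln_vec \<epsilon>(2))
    also have "v (ln_vec ?z) \<le> v t"
    proof (rule v_mono)
      fix k
      have "norm (?z $ k) \<le> exp (t $ k)" using \<epsilon>(1) \<epsilon>(3)[of \<theta> k] e[of k] by linarith
      moreover have "0 < norm (?z $ k)" using \<epsilon>(2)[of \<theta> k] by simp
      ultimately have "ln (norm (?z $ k)) \<le> t $ k" by (metis exp_le_cancel_iff exp_ln)
      then show "ln_vec ?z $ k \<le> t $ k" by (simp add: ln_vec_def)
    qed
    finally show "u ?z \<le> ereal (v t)" by simp
  qed
qed

definition psi :: "real^'n \<Rightarrow> real" where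
  "psi t = (SUP R\<in>{0<..}. (v (R *\<^sub>R t) - v 0) / R)"

text \<open>Convexity on rays from the origin, the source of all estimates which compare \<open>v\<close> and \<open>psi\<close>.\<close>

lemma slope_mono: "0 < r \<Longrightarrow> r \<le> R \<Longrightarrow> (v (r *\<^sub>R t) - v 0) / r \<le> (v (R *\<^sub>R t) - v 0) / R"
  using convex_on_ray_slope[OF convex_v, of r R 0 t] by simp

lemma slope_bound: "0 < R \<Longrightarrow> (v (R *\<^sub>R t) - v 0) / R \<le> C1 * norm t"
  using v_Lipschitz[of 0 "R *\<^sub>R t"] by (simp add: pos_divide_le_eq algebra_simps)

lemma slope_le_psi: "0 < R \<Longrightarrow> (v (R *\<^sub>R t) - v 0) / R \<le> psi t"
  unfolding psi_def by (rule cSUP_upper) (auto intro!: bdd_aboveI2 slope_bound)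

lemma slope_tendsto_psi: "((\<lambda>R. (v (R *\<^sub>R t) - v 0) / R) \<longlongrightarrow> psi t) at_top"
proof (rule increasing_tendsto)
  show "eventually (\<lambda>R. (v (R *\<^sub>R t) - v 0) / R \<le> psi t) at_top"
    using eventually_gt_at_top[of 0] by eventually_elim (rule slope_le_psi)
  fix x assume "x < psi t"
  then obtain r where r: "0 < r" "x < (v (r *\<^sub>R t) - v 0) / r"
    unfolding psi_def by (subst (asm) less_cSUP_iff) (auto intro!: bdd_aboveI2 slope_bound)
  show "eventually (\<lambda>R. x < (v (R *\<^sub>R t) - v 0) / R) at_top"
    using eventually_ge_at_top[of r]
    by eventually_elim (use r slope_mono[of r] in \<open>auto intro: less_le_trans\<close>)
qed

lemma v_tendsto_psi: "((\<lambda>R. v (R *\<^sub>R t) / R) \<longlongrightarrow> psi t) at_top"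
proof -
  have "((\<lambda>R. (v (R *\<^sub>R t) - v 0) / R + v 0 * inverse R) \<longlongrightarrow> psi t + v 0 * 0) at_top"
    by (intro tendsto_intros slope_tendsto_psi tendsto_inverse_0_at_top filterlim_ident)
  then show ?thesis by (simp add: divide_inverse left_diff_distrib)
qed

lemma local_indicator_psi: "local_indicator u 0 t = ereal (psi t)"
  unfolding local_indicator_def
proof (rule tendsto_Lim)
  have "((\<lambda>R. ereal (v (R *\<^sub>R t) / R)) \<longlongrightarrow> ereal (psi t)) at_top"
    by (intro tendsto_ereal v_tendsto_psi)
  then show "((\<lambda>R. torus_max u 0 (R *\<^sub>R t) / ereal R) \<longlongrightarrow> ereal (psi t)) at_top"
    by (rule Lim_transform_eventually)
      (rule eventually_mono[OF eventually_gt_at_top[of 0]], simp add: torus_max_v)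
qed simp

lemma convex_psi: "convex_on UNIV psi"
proof (rule convex_onI)
  fix l :: real and s t :: "real^'n"
  assume l: "0 < l" "l < 1"
  have "((\<lambda>R. (1 - l) * (v (R *\<^sub>R s) / R) + l * (v (R *\<^sub>R t) / R)) \<longlongrightarrow> (1 - l) * psi s + l * psi t) at_top"
    by (intro tendsto_intros v_tendsto_psi)
  moreover have "eventually (\<lambda>R. v (R *\<^sub>R ((1 - l) *\<^sub>R s + l *\<^sub>R t)) / R \<le> (1 - l) * (v (R *\<^sub>R s) / R) + l * (v (R *\<^sub>R t) / R)) at_top"
    using eventually_gt_at_top[of 0]
  proof eventually_elim
    case (elim R)
    have "v ((1 - l) *\<^sub>R (R *\<^sub>R s) + l *\<^sub>R (R *\<^sub>R t)) \<le> (1 - l) * v (R *\<^sub>R s) + l * v (R *\<^sub>R t)"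
      using l by (intro convex_onD[OF convex_v]) auto
    then have "v (R *\<^sub>R ((1 - l) *\<^sub>R s + l *\<^sub>R t)) \<le> (1 - l) * v (R *\<^sub>R s) + l * v (R *\<^sub>R t)"
      by (simp add: scaleR_add_right mult.commute)
    then show ?case using elim by (simp add: field_simps)
  qed
  ultimately show "psi ((1 - l) *\<^sub>R s + l *\<^sub>R t) \<le> (1 - l) * psi s + l * psi t"
    by (rule tendsto_le[OF trivial_limit_at_top_linorder _ v_tendsto_psi])
qed simp

lemma psi_mono:
  assumes "\<And>k. s $ k \<le> t $ k" shows "psi s \<le> psi t"
proof (rule tendsto_le[OF trivial_limit_at_top_linorder v_tendsto_psi v_tendsto_psi])
  show "eventually (\<lambda>R. v (R *\<^sub>R s) / R \<le> v (R *\<^sub>R t) / R) at_top"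
    using eventually_gt_at_top[of 0]
    by eventually_elim (auto intro!: divide_right_mono v_mono mult_left_mono assms)
qed

lemma psi_0: "psi 0 = 0"
  by (simp add: psi_def)

lemma psi_bound: "\<bar>psi t\<bar> \<le> C1 * norm t"
proof -
  have *: "psi t \<le> C1 * norm t" for t
    unfolding psi_def by (rule cSUP_least) (auto intro: slope_bound)
  have "psi ((1 - 1/2) *\<^sub>R t + (1/2) *\<^sub>R (-t)) \<le> (1 - 1/2) * psi t + (1/2) * psi (-t)"
    by (intro convex_onD[OF convex_psi]) auto
  then have "0 \<le> psi t + psi (-t)" by (simp add: psi_0)
  then show ?thesis using *[of t] *[of "-t"] by simp
qed

lemma indicator_psh_eq: "indicator_psh u 0 = log_psh psi"
  unfolding indicator_psh_def
proof (rule the_equality)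
  have lp: "log_psh psi y = ereal (psi (ln_vec y))" if "\<forall>k. y $ k \<noteq> 0" for y
    using that by (intro log_psh_eq psi_mono) auto
  show "psh (log_psh psi) \<and> (\<forall>y. (\<forall>k. y $ k \<noteq> 0) \<longrightarrow> log_psh psi y = local_indicator u 0 (\<chi> k. ln (cmod (y $ k))))"
    using psh_log_psh[OF convex_psi psi_mono] lp by (auto simp: local_indicator_psi ln_vec_def)
  fix F assume F: "psh F \<and> (\<forall>y. (\<forall>k. y $ k \<noteq> 0) \<longrightarrow> F y = local_indicator u 0 (\<chi> k. ln (cmod (y $ k))))"
  show "F = log_psh psi"
    by (rule psh_eq_off_axes) (use F psh_log_psh[OF convex_psi psi_mono] lp in \<open>auto simp: local_indicator_psi ln_vec_def\<close>)
qed

end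

section \<open>Integration over complex space\<close>

lemma nn_integral_lborel_shift:
  fixes f :: "'a::euclidean_space \<Rightarrow> ennreal"
  assumes [measurable]: "f \<in> borel_measurable borel"
  shows "(\<integral>\<^sup>+y. f (c + y) \<partial>lborel) = (\<integral>\<^sup>+y. f y \<partial>lborel)"
proof -
  have "(\<integral>\<^sup>+y. f y \<partial>distr lborel borel ((+) c)) = (\<integral>\<^sup>+y. f (c + y) \<partial>lborel)"
    by (subst nn_integral_distr) auto
  then show ?thesis by (simp add: lborel_distr_plus)
qed

text \<open>Uniqueness of translation invariant measures, specialised to the image of Lebesgue measure under \<open>L\<close>.
The scaling factor appears as a quotient of volumes of any test set \<open>B\<close> instead of a determinant.
The proof computes the integral of \<open>f (L z) * indicator B (y - L z)\<close> in both orders.\<close>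

lemma nn_integral_lborel_linear_bij:
  fixes L L' :: "'a::euclidean_space \<Rightarrow> 'a" and f :: "'a \<Rightarrow> ennreal"
  assumes L: "linear L" "linear L'" and inv: "\<And>y. L (L' y) = y"
    and f [measurable]: "f \<in> borel_measurable borel" and B [measurable]: "B \<in> sets borel"
  shows "(\<integral>\<^sup>+z. f (L z) \<partial>lborel) * emeasure lborel B = (\<integral>\<^sup>+y. f y \<partial>lborel) * emeasure lborel {z. - L z \<in> B}"
proof -
  have Lm [measurable]: "L \<in> borel_measurable borel" and L'm [measurable]: "L' \<in> borel_measurable borel"
    using L by (auto intro!: borel_measurable_continuous_onI linear_continuous_on simp: linear_conv_bounded_linear)
  have "(\<integral>\<^sup>+z. f (L z) \<partial>lborel) * emeasure lborel B = (\<integral>\<^sup>+z. f (L z) * emeasure lborel B \<partial>lborel)"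
    by (rule nn_integral_multc[symmetric]) measurable
  also have "\<dots> = (\<integral>\<^sup>+z. \<integral>\<^sup>+y. f (L z) * indicator B (y - L z) \<partial>lborel \<partial>lborel)"
  proof (rule nn_integral_cong)
    fix z
    have "(\<integral>\<^sup>+y. f (L z) * indicator B (y - L z) \<partial>lborel) = f (L z) * (\<integral>\<^sup>+y. indicator B (- L z + y) \<partial>lborel)"
      by (subst nn_integral_cmult[symmetric]) (auto simp: algebra_simps)
    also have "(\<integral>\<^sup>+y. indicator B (- L z + y) \<partial>lborel) = emeasure lborel B"
      by (subst nn_integral_lborel_shift) auto
    finally show "f (L z) * emeasure lborel B = (\<integral>\<^sup>+y. f (L z) * indicator B (y - L z) \<partial>lborel)" by simp
  qed
  also have "\<dots> = (\<integral>\<^sup>+y. \<integral>\<^sup>+z. f (L z) * indicator B (y - L z) \<partial>lborel \<partial>lborel)"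
    by (rule lborel_pair.Fubini'[symmetric]) measurable
  also have "\<dots> = (\<integral>\<^sup>+y. \<integral>\<^sup>+z. f (y + L z) * indicator B (- L z) \<partial>lborel \<partial>lborel)"
  proof (rule nn_integral_cong)
    fix y
    have "(\<integral>\<^sup>+z. f (L z) * indicator B (y - L z) \<partial>lborel)
        = (\<integral>\<^sup>+z. f (L (L' y + z)) * indicator B (y - L (L' y + z)) \<partial>lborel)"
      by (rule nn_integral_lborel_shift[symmetric]) measurable
    then show "(\<integral>\<^sup>+z. f (L z) * indicator B (y - L z) \<partial>lborel) = (\<integral>\<^sup>+z. f (y + L z) * indicator B (- L z) \<partial>lborel)"
      by (simp add: linear_add[OF L(1)] inv)
  qed
  also have "\<dots> = (\<integral>\<^sup>+z. \<integral>\<^sup>+y. f (y + L z) * indicator B (- L z) \<partial>lborel \<partial>lborel)"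
    by (rule lborel_pair.Fubini') measurable
  also have "\<dots> = (\<integral>\<^sup>+z. (\<integral>\<^sup>+y. f y \<partial>lborel) * indicator {z. - L z \<in> B} z \<partial>lborel)"
  proof (rule nn_integral_cong)
    fix z
    have "(\<integral>\<^sup>+y. f (y + L z) * indicator B (- L z) \<partial>lborel) = (\<integral>\<^sup>+y. f (L z + y) \<partial>lborel) * indicator B (- L z)"
      by (subst nn_integral_multc[symmetric]) (auto simp: add.commute)
    then show "(\<integral>\<^sup>+y. f (y + L z) * indicator B (- L z) \<partial>lborel) = (\<integral>\<^sup>+y. f y \<partial>lborel) * indicator {z. - L z \<in> B} z"
      by (simp add: nn_integral_lborel_shift indicator_def)
  qed
  also have "\<dots> = (\<integral>\<^sup>+y. f y \<partial>lborel) * emeasure lborel {z. - L z \<in> B}"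
    by (rule nn_integral_cmult_indicator) measurable
  finally show ?thesis .
qed

definition polydisc :: "real \<Rightarrow> (complex^'n) set" where
  "polydisc r = {z. \<forall>k. norm (z $ k) \<le> r}"

lemma compact_polydisc: "compact (polydisc r :: (complex^'n) set)"
proof -
  have "norm z \<le> (\<Sum>k\<in>(UNIV::'n set). r)" if "z \<in> polydisc r" for z :: "complex^'n"
    using that by (intro order_trans[OF norm_cart_le_sum] sum_mono) (auto simp: polydisc_def)
  then have "bounded (polydisc r :: (complex^'n) set)" by (rule boundedI)
  moreover have "polydisc r = (\<Inter>k. {z :: complex^'n. norm (z $ k) \<le> r})" by (auto simp: polydisc_def)
  moreover have "closed {z :: complex^'n. norm (z $ k) \<le> r}" for k
    by (intro closed_Collect_le continuous_intros)
  ultimately show ?thesis by (auto simp: compact_eq_bounded_closed intro!: closed_INT)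
qed

lemma polydisc_borel [measurable]: "polydisc r \<in> sets borel"
  by (intro borel_closed compact_imp_closed compact_polydisc)

lemma emeasure_polydisc_finite: "emeasure lborel (polydisc r :: (complex^'n) set) < \<infinity>"
  by (intro emeasure_bounded_finite compact_imp_bounded compact_polydisc)

lemma emeasure_lborel_open_pos:
  fixes U :: "'a::euclidean_space set"
  assumes "open U" "U \<noteq> {}" "U \<subseteq> S" "S \<in> sets borel"
  shows "emeasure lborel S > 0"
proof -
  have "\<not> negligible U" using assms open_not_negligible by blast
  then have "emeasure lborel U \<noteq> 0" using assms
    by (auto simp: negligible_iff_null_sets null_sets_def)
  then show ?thesis using emeasure_mono[of U S lborel] assms by (simp add: zero_less_iff_neq_zero) (metis le_zero_eq)
qed

lemma emeasure_polydisc_pos: "r > 0 \<Longrightarrow> emeasure lborel (polydisc r :: (complex^'n) set) > 0"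
proof (rule emeasure_lborel_open_pos)
  assume "r > 0"
  show "ball 0 r \<subseteq> (polydisc r :: (complex^'n) set)"
    using Finite_Cartesian_Product.norm_nth_le order_trans less_imp_le by (fastforce simp: polydisc_def)
qed auto

definition cart_mult :: "complex^'n \<Rightarrow> complex^'n \<Rightarrow> complex^'n" where
  "cart_mult a z = (\<chi> k. a $ k * z $ k)"

lemma linear_cart_mult: "linear (cart_mult a)"
  by (rule linearI) (simp_all add: cart_mult_def vec_eq_iff algebra_simps)

lemma borel_measurable_vec_lambda [measurable (raw)]:
  fixes f :: "'n::finite \<Rightarrow> 'c \<Rightarrow> 'b::euclidean_space"
  assumes [measurable]: "\<And>k. f k \<in> borel_measurable M"
  shows "(\<lambda>x. (\<chi> k. f k x)) \<in> borel_measurable M"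
proof -
  have ax: "(\<lambda>c. axis k c :: 'b^'n) \<in> borel_measurable borel" for k
  proof (intro borel_measurable_continuous_onI linear_continuous_on)
    show "bounded_linear (\<lambda>c. axis k c :: 'b^'n)"
      by (auto intro!: linearI simp: axis_def vec_eq_iff simp flip: linear_conv_bounded_linear)
  qed
  have "(\<lambda>x. (\<chi> k. f k x)) = (\<lambda>x. \<Sum>k\<in>UNIV. axis k (f k x))"
    by (simp add: fun_eq_iff vec_eq_iff axis_def if_distrib[of "\<lambda>f. f _"] cong: if_cong)
  moreover have "(\<lambda>x. \<Sum>k\<in>UNIV. axis k (f k x) :: 'b^'n) \<in> borel_measurable M"
    by (intro borel_measurable_sum measurable_compose[OF _ ax] assms)
  ultimately show ?thesis by simp
qed

lemma vec_nth_measurable [measurable]: "(\<lambda>z::complex^'n. z $ k) \<in> borel_measurable borel"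
  by (intro borel_measurable_continuous_onI continuous_intros)

lemma cart_mult_measurable [measurable (raw)]:
  assumes [measurable]: "f \<in> borel_measurable M" "g \<in> borel_measurable M"
  shows "(\<lambda>x. cart_mult (f x) (g x) :: complex^'n) \<in> borel_measurable M"
  unfolding cart_mult_def
  by (intro borel_measurable_vec_lambda borel_measurable_times measurable_compose[OF _ vec_nth_measurable] assms)

text \<open>With the unit polydisc as test set: multiplication by coefficients of modulus at most 1 maps it into itself,
so its preimage has at least its volume.\<close>

lemma nn_integral_cart_mult_ge:
  fixes f :: "complex^'n \<Rightarrow> ennreal"
  assumes f: "f \<in> borel_measurable borel" and a: "\<And>k. a $ k \<noteq> 0" "\<And>k. norm (a $ k) \<le> 1"
  shows "(\<integral>\<^sup>+z. f z \<partial>lborel) \<le> (\<integral>\<^sup>+z. f (cart_mult a z) \<partial>lborel)"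
proof -
  let ?P = "polydisc 1 :: (complex^'n) set"
  let ?c = "emeasure lborel ?P"
  have "?c > 0" by (rule emeasure_polydisc_pos) simp
  moreover have "?c < \<infinity>" by (rule emeasure_polydisc_finite)
  ultimately have c: "?c \<noteq> 0" "?c \<noteq> top" by auto
  have inv: "cart_mult a (cart_mult (\<chi> k. inverse (a $ k)) y) = y" for y
    using a(1) by (simp add: cart_mult_def vec_eq_iff)
  have sub: "?P \<subseteq> {z. - cart_mult a z \<in> ?P}"
    using a(2) by (auto simp: polydisc_def cart_mult_def norm_mult intro!: mult_le_one)
  have [measurable]: "cart_mult a \<in> borel_measurable borel" by (rule cart_mult_measurable) auto
  have "{z. - cart_mult a z \<in> ?P} \<in> sets borel" by measurable
  then have "(\<integral>\<^sup>+z. f z \<partial>lborel) * ?c \<le> (\<integral>\<^sup>+z. f z \<partial>lborel) * emeasure lborel {z. - cart_mult a z \<in> ?P}"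
    using sub by (intro mult_left_mono emeasure_mono) auto
  also have "\<dots> = (\<integral>\<^sup>+z. f (cart_mult a z) \<partial>lborel) * ?c"
    by (rule nn_integral_lborel_linear_bij[OF linear_cart_mult linear_cart_mult inv f, symmetric]) measurable
  finally have le: "(\<integral>\<^sup>+z. f z \<partial>lborel) * ?c \<le> (\<integral>\<^sup>+z. f (cart_mult a z) \<partial>lborel) * ?c" .
  have "(\<integral>\<^sup>+z. f z \<partial>lborel) = (\<integral>\<^sup>+z. f z \<partial>lborel) * ?c / ?c"
    using c by (simp add: ennreal_mult_divide_eq)
  also have "\<dots> \<le> (\<integral>\<^sup>+z. f (cart_mult a z) \<partial>lborel) * ?c / ?c" by (intro divide_right_mono_ennreal le)
  also have "\<dots> = (\<integral>\<^sup>+z. f (cart_mult a z) \<partial>lborel)" using c by (simp add: ennreal_mult_divide_eq)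
  finally show ?thesis .
qed

lemma nn_integral_rotate:
  fixes f :: "complex^'n \<Rightarrow> ennreal"
  assumes f [measurable]: "f \<in> borel_measurable borel"
  shows "(\<integral>\<^sup>+z. f (cis \<theta> *s z) \<partial>lborel) = (\<integral>\<^sup>+z. f z \<partial>lborel)"
proof -
  have *: "cis \<theta> *s z = cart_mult (\<chi> k. cis \<theta>) z" for z :: "complex^'n" and \<theta>
    by (simp add: cart_mult_def vec_eq_iff)
  have ge: "(\<integral>\<^sup>+z. g z \<partial>lborel) \<le> (\<integral>\<^sup>+z. g (cis \<theta> *s z) \<partial>lborel)"
    if "g \<in> borel_measurable borel" for g :: "complex^'n \<Rightarrow> ennreal" and \<theta>
    unfolding * by (rule nn_integral_cart_mult_ge[OF that]) auto
  have [measurable]: "(\<lambda>z::complex^'n. cis \<theta> *s z) \<in> borel_measurable borel"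
    unfolding * by measurable
  have "(\<integral>\<^sup>+z. f (cis \<theta> *s z) \<partial>lborel) \<le> (\<integral>\<^sup>+z. f (cis \<theta> *s (cis (-\<theta>) *s z)) \<partial>lborel)"
    by (rule ge) measurable
  also have "\<dots> = (\<integral>\<^sup>+z. f z \<partial>lborel)" by (simp add: vector_smult_assoc cis_mult)
  finally show ?thesis using ge[OF f] by (intro antisym) auto
qed

text \<open>Averaging over the rotations of a circled set turns the inequality on circles into one for volume integrals.\<close>

lemma nn_integral_circled_mean:
  fixes f :: "complex^'n \<Rightarrow> ennreal"
  assumes f [measurable]: "f \<in> borel_measurable borel" and S [measurable]: "S \<in> sets borel"
    and circ: "\<And>b \<theta>. cis \<theta> *s b \<in> S \<longleftrightarrow> b \<in> S"
    and le: "\<And>b. b \<in> S \<Longrightarrow> (\<integral>\<^sup>+\<theta>\<in>{0..2*pi}. f (z0 + cis \<theta> *s b) \<partial>lborel) \<le> ennreal (2*pi) * C"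
  shows "(\<integral>\<^sup>+b\<in>S. f (z0 + b) \<partial>lborel) \<le> C * emeasure lborel S"
proof -
  let ?I = "\<integral>\<^sup>+b\<in>S. f (z0 + b) \<partial>lborel"
  have mm: "(\<lambda>(\<theta>, b). cis \<theta> *s b :: complex^'n) \<in> borel_measurable (lborel \<Otimes>\<^sub>M lborel)"
  proof -
    have "(\<lambda>(\<theta>, b). cis \<theta> *s b :: complex^'n) = (\<lambda>p. cart_mult (\<chi> k. cis (fst p)) (snd p))"
      by (simp add: fun_eq_iff cart_mult_def vec_eq_iff)
    moreover have "(\<lambda>p. cart_mult (\<chi> k. cis (fst p)) (snd p) :: complex^'n) \<in> borel_measurable (lborel \<Otimes>\<^sub>M lborel)"
    proof -
      have [measurable]: "cis \<in> borel_measurable borel"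
        by (intro borel_measurable_continuous_onI continuous_intros)
      show ?thesis by measurable
    qed
    ultimately show ?thesis by simp
  qed
  have m2: "(\<lambda>(\<theta>, b). f (z0 + cis \<theta> *s b) * indicator S b * indicator {0..2*pi} \<theta>) \<in> borel_measurable (lborel \<Otimes>\<^sub>M lborel)"
  proof -
    have [measurable]: "(\<lambda>p. cis (fst p) *s (snd p :: complex^'n)) \<in> borel_measurable (lborel \<Otimes>\<^sub>M lborel)"
      using mm by (simp add: case_prod_beta')
    show ?thesis unfolding case_prod_beta' by measurable
  qed
  have "ennreal (2*pi) * ?I = (\<integral>\<^sup>+\<theta>. ?I * indicator {0..2*pi} \<theta> \<partial>(lborel :: real measure))"
    by (subst nn_integral_cmult_indicator) (auto simp: mult.commute)
  also have "\<dots> = (\<integral>\<^sup>+\<theta>. \<integral>\<^sup>+b. f (z0 + cis \<theta> *s b) * indicator S b * indicator {0..2*pi} \<theta> \<partial>lborel \<partial>lborel)"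
  proof (rule nn_integral_cong)
    fix \<theta> :: real
    have "?I = (\<integral>\<^sup>+b. f (z0 + cis \<theta> *s b) * indicator S (cis \<theta> *s b) \<partial>lborel)"
      by (rule nn_integral_rotate[symmetric]) measurable
    also have "\<dots> = (\<integral>\<^sup>+b. f (z0 + cis \<theta> *s b) * indicator S b \<partial>lborel)" by (simp add: indicator_def circ)
    finally show "?I * indicator {0..2*pi} \<theta> = (\<integral>\<^sup>+b. f (z0 + cis \<theta> *s b) * indicator S b * indicator {0..2*pi} \<theta> \<partial>lborel)"
      by (auto simp: indicator_def)
  qed
  also have "\<dots> = (\<integral>\<^sup>+b. \<integral>\<^sup>+\<theta>. f (z0 + cis \<theta> *s b) * indicator S b * indicator {0..2*pi} \<theta> \<partial>lborel \<partial>lborel)"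
    by (rule lborel_pair.Fubini'[OF m2, symmetric])
  also have "\<dots> \<le> (\<integral>\<^sup>+b. (ennreal (2*pi) * C) * indicator S b \<partial>lborel)"
    using le by (intro nn_integral_mono) (auto simp: indicator_def)
  also have "\<dots> = ennreal (2*pi) * (C * emeasure lborel S)"
    by (subst nn_integral_cmult_indicator) (auto simp: mult.assoc)
  finally have le: "ennreal (2*pi) * ?I \<le> ennreal (2*pi) * (C * emeasure lborel S)" .
  have pp: "x = ennreal (2*pi) * x / ennreal (2*pi)" for x
    using ennreal_mult_divide_eq[of "ennreal (2*pi)" x] by (simp add: mult.commute)
  show ?thesis
    by (subst pp, subst (2) pp) (intro divide_right_mono_ennreal le)
qed

lemma psh_polydisc_mean:
  fixes u :: "complex^'n \<Rightarrow> ereal"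
  assumes u: "psh u" and le: "\<And>b. b \<in> polydisc r \<Longrightarrow> u (cart_mult a (z0 + b)) \<le> ereal M"
  shows "(\<integral>\<^sup>+b\<in>polydisc r. e2ennreal (ereal M - u (cart_mult a (z0 + b))) \<partial>lborel)
     \<le> e2ennreal (ereal M - u (cart_mult a z0)) * emeasure lborel (polydisc r :: (complex^'n) set)"
proof (rule nn_integral_circled_mean[of "\<lambda>y. e2ennreal (ereal M - u (cart_mult a y))"])
  have [measurable]: "u \<in> borel_measurable borel" by (rule psh_measurable[OF u])
  have [measurable]: "cart_mult a \<in> borel_measurable borel" by (rule cart_mult_measurable) auto
  show "(\<lambda>y. e2ennreal (ereal M - u (cart_mult a y))) \<in> borel_measurable borel" by measurable
  show "polydisc r \<in> sets borel" by measurable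
  show *: "cis \<theta> *s b \<in> polydisc r \<longleftrightarrow> b \<in> polydisc r" for b :: "complex^'n" and \<theta>
    by (simp add: polydisc_def norm_mult)
  fix b :: "complex^'n" assume b: "b \<in> polydisc r"
  have eq: "cart_mult a (z0 + cis \<theta> *s b) = cart_mult a z0 + cis \<theta> *s cart_mult a b" for \<theta>
    by (simp add: cart_mult_def vec_eq_iff algebra_simps)
  show "(\<integral>\<^sup>+\<theta>\<in>{0..2*pi}. e2ennreal (ereal M - u (cart_mult a (z0 + cis \<theta> *s b))) \<partial>lborel)
    \<le> ennreal (2*pi) * e2ennreal (ereal M - u (cart_mult a z0))"
    unfolding eq by (rule psh_circle_nn_integral[OF u]) (use le[of "cis _ *s b"] * b eq in auto)
qed

text \<open>Harnack inequality. The polydisc of radius \<open>r\<close> about 0 lies in the polydisc of radius \<open>r + 1\<close> about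
\<open>z0\<close>, and \<open>M - u\<close> is nonnegative there, so its integral over the smaller set is bounded by the mean
value inequality at \<open>z0\<close>. The factor \<open>a\<close> places the inequality at an arbitrary scale without a change of
variables.\<close>

lemma psh_polydisc_harnack:
  fixes u :: "complex^'n \<Rightarrow> ereal"
  assumes u: "psh u" and le: "\<And>y. y \<in> polydisc (r + 2) \<Longrightarrow> u (cart_mult a y) \<le> ereal M"
    and z0: "z0 \<in> polydisc 1" and "r \<ge> 0"
  shows "(\<integral>\<^sup>+y\<in>polydisc r. e2ennreal (ereal M - u (cart_mult a y)) \<partial>lborel)
     \<le> e2ennreal (ereal M - u (cart_mult a z0)) * emeasure lborel (polydisc (r + 1) :: (complex^'n) set)"
proof -
  have [measurable]: "u \<in> borel_measurable borel" by (rule psh_measurable[OF u])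
  have [measurable]: "cart_mult a \<in> borel_measurable borel" by (rule cart_mult_measurable) auto
  have "(\<integral>\<^sup>+y\<in>polydisc r. e2ennreal (ereal M - u (cart_mult a y)) \<partial>lborel)
    = (\<integral>\<^sup>+b. e2ennreal (ereal M - u (cart_mult a (z0 + b))) * indicator (polydisc r) (z0 + b) \<partial>lborel)"
    by (rule nn_integral_lborel_shift[symmetric]) measurable
  also have "\<dots> \<le> (\<integral>\<^sup>+b\<in>polydisc (r + 1). e2ennreal (ereal M - u (cart_mult a (z0 + b))) \<partial>lborel)"
  proof (intro nn_integral_mono mult_left_mono)
    fix b :: "complex^'n"
    have "b \<in> polydisc (r + 1)" if "z0 + b \<in> polydisc r"
      unfolding polydisc_def
    proof safe
      fix k
      show "norm (b $ k) \<le> r + 1"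
      proof -
        have "norm (z0 $ k) \<le> 1" "norm (z0 $ k + b $ k) \<le> r" using z0 that by (auto simp: polydisc_def)
        then show ?thesis using norm_triangle_ineq4[of "z0 $ k + b $ k" "z0 $ k"] by simp
      qed
    qed
    then show "(indicator (polydisc r) (z0 + b) :: ennreal) \<le> indicator (polydisc (r + 1)) b"
      by (auto simp: indicator_def)
  qed simp
  also have "\<dots> \<le> e2ennreal (ereal M - u (cart_mult a z0)) * emeasure lborel (polydisc (r + 1) :: (complex^'n) set)"
  proof (rule psh_polydisc_mean[OF u])
    fix b :: "complex^'n" assume b: "b \<in> polydisc (r + 1)"
    have "norm ((z0 + b) $ k) \<le> r + 2" for k
    proof -
      have "norm (z0 $ k) \<le> 1" "norm (b $ k) \<le> r + 1" using z0 b by (auto simp: polydisc_def)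
      then show ?thesis using norm_triangle_ineq[of "z0 $ k" "b $ k"] by simp
    qed
    then show "u (cart_mult a (z0 + b)) \<le> ereal M" by (intro le) (simp add: polydisc_def)
  qed
  finally show ?thesis .
qed

text \<open>Besides the coordinate hyperplanes this avoids the branch cut of the logarithm used for roots.\<close>

lemma AE_coordinates_nonreal: "AE z in lborel. \<forall>k. Im ((z :: complex^'n) $ k) \<noteq> 0"
proof -
  have "AE z in lborel. Im ((z :: complex^'n) $ k) \<noteq> 0" for k
  proof -
    let ?H = "{z :: complex^'n. axis k \<i> \<bullet> z = 0}"
    have "closed ?H" by (rule closed_hyperplane)
    have "negligible ?H" by (rule negligible_hyperplane) (simp add: axis_eq_0_iff)
    then have "?H \<in> null_sets lborel" using \<open>closed ?H\<close>
      by (subst null_sets_completion_iff[symmetric]) (auto simp: negligible_iff_null_sets)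
    then show ?thesis by (rule AE_I') (auto simp: inner_axis' inner_complex_def)
  qed
  then show ?thesis by (subst AE_all_countable) auto
qed

lemma AE_off_axes: "AE z in lborel. \<forall>k. (z :: complex^'n) $ k \<noteq> 0"
  using AE_coordinates_nonreal by eventually_elim (metis zero_complex.sel(2))

section \<open>Local integrability of logarithms, powers and roots\<close>

lemma log_psh_upper:
  assumes m: "\<And>s t. (\<And>k. s $ k \<le> t $ k) \<Longrightarrow> \<psi> s \<le> \<psi> t" and "y \<in> polydisc r" "1 \<le> r"
  shows "log_psh \<psi> y \<le> ereal (\<psi> (\<chi> k. ln r))"
proof -
  have "log_psh \<psi> y \<le> ereal (\<psi> (ln_max (inverse (Suc 0)) y))"
    unfolding log_psh_def by (rule INF_lower) simp
  also have "\<dots> \<le> ereal (\<psi> (\<chi> k. ln ((\<chi> k. r) $ k)))"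
    by (rule log_psh_le[OF m]) (use assms in \<open>auto simp: polydisc_def\<close>)
  finally show ?thesis by simp
qed

lemma cart_mult_1: "cart_mult (\<chi> k. 1) y = y"
  by (simp add: cart_mult_def vec_eq_iff)

lemma ln_vec_measurable [measurable]: "ln_vec \<in> borel_measurable borel"
  unfolding ln_vec_def by measurable

text \<open>The function \<open>ln |z_k|\<close> is plurisubharmonic and finite at \<open>(1, \<dots>, 1)\<close>, so the Harnack inequality at
that point bounds the integral of its negative part.\<close>

lemma nn_integral_ln_coordinate_finite:
  assumes "r \<ge> 0"
  shows "(\<integral>\<^sup>+z\<in>polydisc r. ennreal \<bar>ln (norm ((z :: complex^'n) $ k))\<bar> \<partial>lborel) < \<infinity>"
proof -
  define g :: "complex^'n \<Rightarrow> ereal" where "g = log_psh (\<lambda>t. t $ k)"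
  define M where "M = ln (r + 2)"
  have M: "M \<ge> 0" using assms by (simp add: M_def)
  have "convex_on UNIV (\<lambda>t :: real^'n. t $ k)" by (rule convex_onI) auto
  then have g: "psh g" unfolding g_def by (rule psh_log_psh)
  have [measurable]: "g \<in> borel_measurable borel" by (rule psh_measurable[OF g])
  have gM: "g y \<le> ereal M" if "y \<in> polydisc (r + 2)" for y
    using log_psh_upper[of "\<lambda>t. t $ k" y "r + 2"] that assms by (simp add: g_def M_def)
  have g_eq: "g z = ereal (ln (norm (z $ k)))" if "\<forall>k. z $ k \<noteq> 0" for z
    unfolding g_def by (subst log_psh_eq) (use that in \<open>auto simp: ln_vec_def\<close>)
  let ?J = "\<integral>\<^sup>+z\<in>polydisc r. e2ennreal (ereal M - g z) \<partial>lborel"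
  have "(\<integral>\<^sup>+y\<in>polydisc r. e2ennreal (ereal M - g (cart_mult (\<chi> k. 1) y)) \<partial>lborel)
     \<le> e2ennreal (ereal M - g (cart_mult (\<chi> k. 1) (\<chi> k. 1))) * emeasure lborel (polydisc (r + 1) :: (complex^'n) set)"
    by (rule psh_polydisc_harnack[OF g]) (use gM assms in \<open>auto simp: cart_mult_1 polydisc_def\<close>)
  then have "?J \<le> ennreal M * emeasure lborel (polydisc (r + 1) :: (complex^'n) set)"
    by (simp add: cart_mult_1 g_eq)
  also have "\<dots> < \<infinity>" using emeasure_polydisc_finite[of "r + 1", where 'n='n]
    by (simp add: ennreal_mult_less_top)
  finally have J: "?J < \<infinity>" .
  have "(\<integral>\<^sup>+z\<in>polydisc r. ennreal \<bar>ln (norm ((z :: complex^'n) $ k))\<bar> \<partial>lborel)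
    \<le> (\<integral>\<^sup>+z. ennreal M * indicator (polydisc r) z + e2ennreal (ereal M - g z) * indicator (polydisc r) z \<partial>lborel)"
  proof (rule nn_integral_mono_AE)
    show "AE z in lborel. ennreal \<bar>ln (norm ((z :: complex^'n) $ k))\<bar> * indicator (polydisc r) z
       \<le> ennreal M * indicator (polydisc r) z + e2ennreal (ereal M - g z) * indicator (polydisc r) z"
      using AE_off_axes
    proof eventually_elim
      case (elim z)
      show ?case
      proof (cases "z \<in> polydisc r")
        case True
        then have "g z \<le> ereal M" by (intro gM) (auto simp: polydisc_def intro: order_trans)
        then have "ln (norm (z $ k)) \<le> M" using g_eq[OF elim] by simp
        then have "\<bar>ln (norm (z $ k))\<bar> \<le> M + (M - ln (norm (z $ k)))" using M by linarith
        then have "ennreal \<bar>ln (norm (z $ k))\<bar> \<le> ennreal M + ennreal (M - ln (norm (z $ k)))"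
          using M \<open>ln (norm (z $ k)) \<le> M\<close> by (subst ennreal_plus[symmetric]) (auto intro: ennreal_leI)
        then show ?thesis using True by (simp add: g_eq[OF elim])
      qed simp
    qed
  qed
  also have "\<dots> = ennreal M * emeasure lborel (polydisc r :: (complex^'n) set) + ?J"
    by (subst nn_integral_add) (auto simp: nn_integral_cmult_indicator)
  also have "\<dots> < \<infinity>" using J emeasure_polydisc_finite[of r, where 'n='n]
    by (simp add: ennreal_mult_less_top)
  finally show ?thesis .
qed

lemma nn_integral_ln_vec_finite:
  assumes "r \<ge> 0"
  shows "(\<integral>\<^sup>+z\<in>polydisc r. ennreal (norm (ln_vec (z :: complex^'n))) \<partial>lborel) < \<infinity>"
proof -
  have "(\<integral>\<^sup>+z\<in>polydisc r. ennreal (norm (ln_vec (z :: complex^'n))) \<partial>lborel)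
     \<le> (\<integral>\<^sup>+z. (\<Sum>k\<in>UNIV. ennreal \<bar>ln (norm ((z :: complex^'n) $ k))\<bar> * indicator (polydisc r) z) \<partial>lborel)"
  proof (rule nn_integral_mono)
    fix z :: "complex^'n"
    have "norm (ln_vec z) \<le> (\<Sum>k\<in>UNIV. \<bar>ln (norm (z $ k))\<bar>)"
      using norm_cart_le_sum[of "ln_vec z"] by (simp add: ln_vec_def)
    then have "ennreal (norm (ln_vec z)) \<le> (\<Sum>k\<in>UNIV. ennreal \<bar>ln (norm (z $ k))\<bar>)"
      by (subst sum_ennreal) (auto intro: ennreal_leI)
    then show "ennreal (norm (ln_vec z)) * indicator (polydisc r) z \<le> (\<Sum>k\<in>UNIV. ennreal \<bar>ln (norm (z $ k))\<bar> * indicator (polydisc r) z)"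
      by (auto simp: indicator_def)
  qed
  also have "\<dots> = (\<Sum>k\<in>UNIV. \<integral>\<^sup>+z\<in>polydisc r. ennreal \<bar>ln (norm ((z :: complex^'n) $ k))\<bar> \<partial>lborel)"
    by (rule nn_integral_sum) measurable
  also have "\<dots> < \<infinity>"
    using nn_integral_ln_coordinate_finite[OF assms, where 'n='n] by (simp add: less_top)
  finally show ?thesis .
qed

definition cart_pow :: "nat \<Rightarrow> complex^'n \<Rightarrow> complex^'n" where
  "cart_pow m z = (\<chi> k. z $ k ^ m)"

text \<open>Some Borel choice of an \<open>m\<close>-th root in each coordinate. On the branch cut, a null set, the value 1 is
arbitrary.\<close>

definition cart_root :: "nat \<Rightarrow> complex^'n \<Rightarrow> complex^'n" where
  "cart_root m z = (\<chi> k. if z $ k \<in> \<real>\<^sub>\<le>\<^sub>0 then 1 else exp (Ln (z $ k) / of_nat m))"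

lemma cart_pow_measurable [measurable (raw)]:
  "f \<in> borel_measurable M \<Longrightarrow> (\<lambda>x. cart_pow m (f x)) \<in> borel_measurable M"
  unfolding cart_pow_def by measurable

lemma cart_root_measurable [measurable (raw)]:
  assumes [measurable]: "f \<in> borel_measurable M"
  shows "(\<lambda>x. cart_root m (f x)) \<in> borel_measurable M"
proof -
  have "continuous_on (- \<real>\<^sub>\<le>\<^sub>0) (\<lambda>c. exp (w * Ln c))" for w by (intro continuous_intros) auto
  from this[of "1 / of_nat m"] have "continuous_on (- \<real>\<^sub>\<le>\<^sub>0) (\<lambda>c. exp (Ln c / of_nat m))" by simp
  then have [measurable]: "(\<lambda>c. if c \<in> \<real>\<^sub>\<le>\<^sub>0 then 1 else exp (Ln c / of_nat m)) \<in> borel_measurable borel"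
    by (intro borel_measurable_continuous_on_if) (auto intro!: borel_closed)
  have "(\<lambda>x. if f x $ k \<in> \<real>\<^sub>\<le>\<^sub>0 then 1 else exp (Ln (f x $ k) / of_nat m)) \<in> borel_measurable M" for k
    by (rule measurable_compose[of "\<lambda>x. f x $ k" M borel "\<lambda>c. if c \<in> \<real>\<^sub>\<le>\<^sub>0 then 1 else exp (Ln c / of_nat m)"]) measurable
  then show ?thesis unfolding cart_root_def by (rule borel_measurable_vec_lambda)
qed

lemma cart_root:
  fixes \<xi> :: "complex^'n"
  assumes im: "\<forall>k. Im (\<xi> $ k) \<noteq> 0" and m: "m > 0" and \<xi>: "\<xi> \<in> polydisc 1"
  shows "cart_root m \<xi> $ k ^ m = \<xi> $ k" "cart_root m \<xi> $ k \<noteq> 0" "norm (cart_root m \<xi> $ k) \<le> 1"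
    "norm (\<xi> $ k) \<le> norm (cart_root m \<xi> $ k)"
proof -
  have "\<xi> $ k \<notin> \<real>\<^sub>\<le>\<^sub>0" "\<xi> $ k \<noteq> 0" using im[rule_format, of k] by (auto simp: complex_nonpos_Reals_iff)
  then have eq: "cart_root m \<xi> $ k = exp (Ln (\<xi> $ k) / of_nat m)" by (simp add: cart_root_def)
  show pow: "cart_root m \<xi> $ k ^ m = \<xi> $ k"
    unfolding eq exp_of_nat_mult[symmetric] using m \<open>\<xi> $ k \<noteq> 0\<close> by simp
  show "cart_root m \<xi> $ k \<noteq> 0" unfolding eq by simp
  have np: "norm (cart_root m \<xi> $ k) ^ m = norm (\<xi> $ k)" using pow by (metis norm_power)
  moreover have "norm (\<xi> $ k) \<le> 1" using \<xi> by (simp add: polydisc_def)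
  ultimately show le: "norm (cart_root m \<xi> $ k) \<le> 1" using m by (metis norm_ge_zero not_le one_less_power)
  have "norm (cart_root m \<xi> $ k) ^ m \<le> norm (cart_root m \<xi> $ k) ^ 1"
    using m le by (intro power_decreasing) auto
  then show "norm (\<xi> $ k) \<le> norm (cart_root m \<xi> $ k)" using np by simp
qed

lemma e2ennreal_split_le:
  fixes U :: ereal
  assumes "U \<le> ereal M" "V \<le> M" "m > 0"
  shows "e2ennreal (ereal p - U / ereal m) \<le> ennreal (p - V / m) + ennreal (1 / m) * e2ennreal (ereal M - U)"
proof (cases U)
  case (real x)
  have "p - x / m \<le> (p - V / m) + (1 / m) * (M - x)" using assms by (simp add: field_simps)
  then have "ennreal (p - x / m) \<le> ennreal (p - V / m) + ennreal ((1 / m) * (M - x))"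
  proof (cases "0 \<le> p - V / m")
    case True
    have "ennreal (p - x / m) \<le> ennreal ((p - V / m) + (1 / m) * (M - x))"
      using \<open>p - x / m \<le> _\<close> by (rule ennreal_leI)
    also have "\<dots> = ennreal (p - V / m) + ennreal ((1 / m) * (M - x))"
      by (rule ennreal_plus) (use True assms real in auto)
    finally show ?thesis .
  next
    case False
    then have "p - x / m \<le> (1 / m) * (M - x)" using \<open>p - x / m \<le> _\<close> by linarith
    then show ?thesis using ennreal_leI add_increasing by (metis zero_le)
  qed
  moreover have "ennreal ((1 / m) * (M - x)) = ennreal (1 / m) * ennreal (M - x)"
    using assms real by (intro ennreal_mult) auto
  ultimately show ?thesis using real assms by simp
next
  case MInf
  then show ?thesis using assms by (simp add: ennreal_mult_top)
qed (use assms in auto)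

lemma emeasure_shell_pos:
  "emeasure lborel {\<xi> \<in> polydisc 1 :: (complex^'n) set. \<forall>k. 1/2 \<le> norm (\<xi> $ k)} > 0" (is "emeasure _ ?S > 0")
proof (rule emeasure_lborel_open_pos)
  let ?U = "(\<Inter>k. {\<xi> :: complex^'n. norm (\<xi> $ k) < 1} \<inter> {\<xi>. 1/2 < norm (\<xi> $ k)})"
  show "open ?U" by (intro open_INT ballI open_Int open_Collect_less continuous_intros) auto
  have "(\<chi> k. 3/4) \<in> ?U" by simp
  then show "?U \<noteq> {}" by blast
  show "?U \<subseteq> ?S" by (auto simp: polydisc_def less_imp_le)
  show "?S \<in> sets borel" by measurable
qed

section \<open>Convergence\<close>

lemma cart_pow_torus:
  assumes "\<And>k. z $ k \<noteq> 0"
  shows "cart_pow m z \<in> torus (real m *\<^sub>R ln_vec z)"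
  using assms by (simp add: cart_pow_def torus_def ln_vec_def norm_power exp_of_nat_mult)

context log_growth
begin

lemma u_measurable [measurable]: "u \<in> borel_measurable borel"
  by (rule psh_measurable[OF psh])

lemma psi_measurable [measurable]: "psi \<in> borel_measurable borel"
  by (intro borel_measurable_continuous_onI convex_on_UNIV_continuous convex_psi)

lemma v_measurable [measurable]: "v \<in> borel_measurable borel"
  by (intro borel_measurable_continuous_onI convex_on_UNIV_continuous convex_v)

text \<open>Attaining the maximum provides the centre for the Harnack inequality.\<close>

lemma v_attained: "\<exists>y\<in>torus t. u y = ereal (v t)"
proof -
  have "(\<chi> k. of_real (exp (t $ k))) \<in> torus t" by (simp add: torus_def)
  then obtain y where y: "y \<in> torus t" "\<And>z. z \<in> torus t \<Longrightarrow> u z \<le> u y"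
    using usc_attains_max[OF _ compact_torus, of u t] psh by (auto simp: psh_def)
  have "torus_max u 0 t = u y" unfolding torus_max_eq
    by (intro antisym SUP_least SUP_upper y)
  then show ?thesis using y(1) torus_max_v by metis
qed

text \<open>The gap tends to 0 because the slopes of \<open>v\<close> tend to \<open>psi\<close>. The Lipschitz bound makes
it at most linear in \<open>t\<close>, which is used for domination.\<close>

definition gap :: "nat \<Rightarrow> real^'n \<Rightarrow> real" where
  "gap m t = psi t - (v (real m *\<^sub>R t) - v 0) / real m"

text \<open>Off the coordinate hyperplanes the truncation by \<open>e2ennreal\<close> cuts off nothing, see
\<open>u_cart_pow_le\<close>.\<close>

definition defect :: "nat \<Rightarrow> complex^'n \<Rightarrow> ennreal" where
  "defect m z = e2ennreal (ereal (psi (ln_vec z) + v 0 / real m) - u (cart_pow m z) / ereal (real m))"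

lemma gap_bound: 
  assumes "m > 0" shows "gap m t \<le> 2 * C1 * norm t"
proof -
  have "v 0 \<le> v (real m *\<^sub>R t) + C1 * (real m * norm t)"
    using v_Lipschitz[of "real m *\<^sub>R t" "- (real m *\<^sub>R t)"] by simp
  then have "- (C1 * norm t) \<le> (v (real m *\<^sub>R t) - v 0) / real m"
    using assms by (simp add: pos_le_divide_eq algebra_simps)
  then show ?thesis using psi_bound[of t] by (simp add: gap_def)
qed

lemma gap_tendsto: "(\<lambda>m. gap (Suc m) t) \<longlonglongrightarrow> 0"
proof -
  have "(\<lambda>m. psi t - (v (real (Suc m) *\<^sub>R t) - v 0) / real (Suc m)) \<longlonglongrightarrow> psi t - psi t"
    by (intro tendsto_diff tendsto_const filterlim_compose[OF slope_tendsto_psi]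
        filterlim_compose[OF filterlim_real_sequentially filterlim_Suc])
  then show ?thesis by (simp add: gap_def)
qed

lemma gap_measurable [measurable]: "gap m \<in> borel_measurable borel"
  unfolding gap_def by measurable

lemma defect_measurable [measurable]: "defect m \<in> borel_measurable borel"
  unfolding defect_def by measurable

lemma u_cart_pow_le:
  assumes "\<And>k. z $ k \<noteq> 0" "m > 0"
  shows "u (cart_pow m z) / ereal (real m) \<le> ereal (psi (ln_vec z) + v 0 / real m)"
proof -
  have "u (cart_pow m z) / ereal (real m) \<le> ereal (v (real m *\<^sub>R ln_vec z)) / ereal (real m)"
    using assms by (intro ereal_divide_right_mono u_le_v cart_pow_torus) auto
  also have "\<dots> \<le> ereal (psi (ln_vec z) + v 0 / real m)"
    using slope_le_psi[of "real m" "ln_vec z"] assms by (simp add: diff_divide_distrib)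
  finally show ?thesis .
qed

text \<open>The bound for the increase of \<open>v\<close> when all radii are multiplied by 4, uniform in the torus.\<close>

definition osc :: real where "osc = C1 * norm (\<chi> k::'n. ln (4::real))"

lemma osc_nonneg: "0 \<le> osc"
  using C1 by (simp add: osc_def)

text \<open>The points \<open>\<eta> z\<close> with \<open>\<eta>^m = \<xi>\<close> have \<open>m\<close>-th powers \<open>a \<xi>\<close> with \<open>a = z^m\<close>. The
part of the defect coming from \<open>psi\<close> does not exceed its value at \<open>z\<close>, because \<open>|\<eta>| \<le> 1\<close>. The
part coming from \<open>u\<close> is averaged over \<open>\<xi>\<close> by the Harnack inequality about a maximum point on the torus
of \<open>a\<close>.\<close>

lemma defect_polydisc_mean:
  fixes z :: "complex^'n"
  assumes z: "\<And>k. z $ k \<noteq> 0" and m: "m > 0"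
  shows "(\<integral>\<^sup>+\<xi>\<in>polydisc 1. defect m (cart_mult (cart_root m \<xi>) z) \<partial>lborel) \<le>
    ennreal (gap m (ln_vec z)) * emeasure lborel (polydisc 1 :: (complex^'n) set)
      + ennreal (osc / real m) * emeasure lborel (polydisc 2 :: (complex^'n) set)" (is "?L \<le> _")
proof -
  define a where "a = cart_pow m z"
  define t where "t = real m *\<^sub>R ln_vec z"
  define M where "M = v (t + (\<chi> k. ln 4))"
  define p where "p = psi (ln_vec z) + v 0 / real m"
  have [measurable]: "cart_mult a \<in> borel_measurable borel" by (rule cart_mult_measurable) auto
  have at: "a \<in> torus t" unfolding a_def t_def by (rule cart_pow_torus[OF z])
  have a0: "a $ k \<noteq> 0" for k using z by (simp add: a_def cart_pow_def)
  have vM: "v t \<le> M" unfolding M_def by (rule v_mono) simp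
  have Mv: "M - v t \<le> osc" using v_Lipschitz[of t "\<chi> k. ln 4"] by (simp add: M_def osc_def)
  have uM: "u (cart_mult a y) \<le> ereal M" if "y \<in> polydisc (1 + 2)" for y
    unfolding M_def
  proof (rule u_le_v_polydisc)
    fix k
    have "norm (cart_mult a y $ k) = exp (t $ k) * norm (y $ k)"
      using at by (simp add: cart_mult_def norm_mult torus_def)
    also have "\<dots> < exp (t $ k) * 4" using that by (intro mult_strict_left_mono) (auto simp: polydisc_def intro: le_less_trans[of _ 3])
    also have "\<dots> = exp ((t + (\<chi> k. ln 4)) $ k)" by (simp add: exp_add)
    finally show "norm (cart_mult a y $ k) < exp ((t + (\<chi> k. ln 4)) $ k)" .
  qed
  obtain y0 where y0: "y0 \<in> torus t" "u y0 = ereal (v t)" using v_attained by blast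
  define z0 where "z0 = cart_mult (\<chi> k. inverse (a $ k)) y0"
  have z0: "cart_mult a z0 = y0" using a0 by (simp add: z0_def cart_mult_def vec_eq_iff)
  have "z0 \<in> polydisc 1" using y0 at by (simp add: z0_def polydisc_def torus_def cart_mult_def norm_mult norm_inverse)
  from psh_polydisc_harnack[OF psh uM this, of 1]
  have X: "(\<integral>\<^sup>+y\<in>polydisc 1. e2ennreal (ereal M - u (cart_mult a y)) \<partial>lborel)
     \<le> ennreal (M - v t) * emeasure lborel (polydisc 2 :: (complex^'n) set)"
    unfolding z0 y0(2) by simp
  have "?L \<le> (\<integral>\<^sup>+\<xi>. ennreal (gap m (ln_vec z)) * indicator (polydisc 1) \<xi> +
      ennreal (1 / real m) * (e2ennreal (ereal M - u (cart_mult a \<xi>)) * indicator (polydisc 1) \<xi>) \<partial>lborel)"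
  proof (rule nn_integral_mono_AE)
    show "AE \<xi> in lborel. defect m (cart_mult (cart_root m \<xi>) z) * indicator (polydisc 1) \<xi>
      \<le> ennreal (gap m (ln_vec z)) * indicator (polydisc 1) \<xi> +
      ennreal (1 / real m) * (e2ennreal (ereal M - u (cart_mult a \<xi>)) * indicator (polydisc 1) \<xi>)"
      using AE_coordinates_nonreal
    proof eventually_elim
      case (elim \<xi>)
      show ?case
      proof (cases "\<xi> \<in> polydisc 1")
        case True
        note r = cart_root[OF elim m True]
        have eq: "cart_pow m (cart_mult (cart_root m \<xi>) z) = cart_mult a \<xi>"
          by (simp add: cart_pow_def cart_mult_def a_def vec_eq_iff power_mult_distrib r(1))
        have "psi (ln_vec (cart_mult (cart_root m \<xi>) z)) \<le> psi (ln_vec z)"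
        proof (rule psi_mono)
          fix k
          have "norm (cart_root m \<xi> $ k) * norm (z $ k) \<le> 1 * norm (z $ k)"
            by (intro mult_right_mono r(3)) auto
          then show "ln_vec (cart_mult (cart_root m \<xi>) z) $ k \<le> ln_vec z $ k"
            using r(2)[of k] z[of k] by (simp add: ln_vec_def cart_mult_def norm_mult ln_mono)
        qed
        then have "defect m (cart_mult (cart_root m \<xi>) z) \<le> e2ennreal (ereal p - u (cart_mult a \<xi>) / ereal (real m))"
          unfolding defect_def eq p_def by (intro e2ennreal_mono ereal_minus_mono) auto
        also have "\<dots> \<le> ennreal (p - v t / real m) + ennreal (1 / real m) * e2ennreal (ereal M - u (cart_mult a \<xi>))"
        proof (rule e2ennreal_split_le)
          show "u (cart_mult a \<xi>) \<le> ereal M" by (rule uM) (use True in \<open>force simp: polydisc_def intro: order_trans\<close>)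
        qed (use vM m in auto)
        also have "p - v t / real m = gap m (ln_vec z)"
          by (simp add: p_def gap_def t_def diff_divide_distrib)
        finally show ?thesis using True by simp
      qed simp
    qed
  qed
  also have "\<dots> = ennreal (gap m (ln_vec z)) * emeasure lborel (polydisc 1 :: (complex^'n) set)
     + ennreal (1 / real m) * (\<integral>\<^sup>+y\<in>polydisc 1. e2ennreal (ereal M - u (cart_mult a y)) \<partial>lborel)"
    by (subst nn_integral_add) (auto simp: nn_integral_cmult nn_integral_cmult_indicator)
  also have "ennreal (1 / real m) * (\<integral>\<^sup>+y\<in>polydisc 1. e2ennreal (ereal M - u (cart_mult a y)) \<partial>lborel)
     \<le> ennreal (1 / real m) * (ennreal osc * emeasure lborel (polydisc 2 :: (complex^'n) set))"
    by (intro mult_left_mono order_trans[OF X] mult_right_mono ennreal_leI Mv) auto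
  also have "\<dots> = ennreal (osc / real m) * emeasure lborel (polydisc 2 :: (complex^'n) set)"
    using osc_nonneg m by (simp add: ennreal_mult[symmetric] mult.assoc[symmetric])
  finally show ?thesis by simp
qed

text \<open>Only those \<open>\<xi>\<close> with all moduli at least 1/2 are kept, so that the roots \<open>\<eta>\<close> satisfy
\<open>1/2 \<le> |\<eta>| \<le> 1\<close> for every \<open>m\<close>. The polydisc of radius \<open>\<rho>\<close> then pulls back under
multiplication by \<open>\<eta>\<close> into the one of radius \<open>2 * \<rho>\<close>, and the integral over the pull-back is at least
the integral over the polydisc.\<close>

lemma defect_integral_le:
  fixes \<rho> :: real
  assumes m: "m > 0"
  shows "emeasure lborel {\<xi> \<in> polydisc 1 :: (complex^'n) set. \<forall>k. 1/2 \<le> norm (\<xi> $ k)} * (\<integral>\<^sup>+z\<in>polydisc \<rho>. defect m z \<partial>lborel)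
    \<le> (\<integral>\<^sup>+z\<in>polydisc (2*\<rho>). (ennreal (gap m (ln_vec z)) * emeasure lborel (polydisc 1 :: (complex^'n) set)
      + ennreal (osc / real m) * emeasure lborel (polydisc 2 :: (complex^'n) set)) \<partial>lborel)"
    (is "emeasure lborel ?S * ?I \<le> ?R")
proof -
  let ?D = "\<lambda>z \<xi>. defect m (cart_mult (cart_root m \<xi>) z) * indicator (polydisc 1) \<xi> * indicator (polydisc (2*\<rho>)) z"
  have S [measurable]: "?S \<in> sets borel" by measurable
  have "emeasure lborel ?S * ?I = (\<integral>\<^sup>+\<xi>. ?I * indicator ?S \<xi> \<partial>lborel)"
    by (subst nn_integral_cmult_indicator) (auto simp: mult.commute)
  also have "\<dots> \<le> (\<integral>\<^sup>+\<xi>. \<integral>\<^sup>+z. ?D z \<xi> \<partial>lborel \<partial>lborel)"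
  proof (rule nn_integral_mono_AE)
    show "AE \<xi> in lborel. ?I * indicator ?S \<xi> \<le> (\<integral>\<^sup>+z. ?D z \<xi> \<partial>lborel)"
      using AE_coordinates_nonreal
    proof eventually_elim
      case (elim \<xi>)
      show ?case
      proof (cases "\<xi> \<in> ?S")
        case True
        then have \<xi>: "\<xi> \<in> polydisc 1" "\<And>k. 1/2 \<le> norm (\<xi> $ k)" by auto
        note r = cart_root[OF elim m \<xi>(1)]
        let ?a = "cart_root m \<xi>"
        have "?I \<le> (\<integral>\<^sup>+z. defect m (cart_mult ?a z) * indicator (polydisc \<rho>) (cart_mult ?a z) \<partial>lborel)"
          by (rule nn_integral_cart_mult_ge[OF _ r(2,3)]) measurable
        also have "\<dots> \<le> (\<integral>\<^sup>+z. ?D z \<xi> \<partial>lborel)"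
        proof (rule nn_integral_mono)
          fix z :: "complex^'n"
          have "z \<in> polydisc (2*\<rho>)" if "cart_mult ?a z \<in> polydisc \<rho>"
            unfolding polydisc_def
          proof safe
            fix k
            have "1/2 * norm (z $ k) \<le> norm (?a $ k) * norm (z $ k)"
              using \<xi>(2)[of k] r(4)[of k] by (intro mult_right_mono) auto
            also have "\<dots> \<le> \<rho>" using that by (simp add: polydisc_def cart_mult_def norm_mult)
            finally show "norm (z $ k) \<le> 2*\<rho>" by simp
          qed
          then show "defect m (cart_mult ?a z) * indicator (polydisc \<rho>) (cart_mult ?a z) \<le> ?D z \<xi>"
            using \<xi>(1) by (auto simp: indicator_def)
        qed
        finally show ?thesis using True by simp
      qed simp
    qed
  qed
  also have "\<dots> = (\<integral>\<^sup>+z. \<integral>\<^sup>+\<xi>. ?D z \<xi> \<partial>lborel \<partial>lborel)"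
    by (rule lborel_pair.Fubini') measurable
  also have "\<dots> \<le> ?R"
  proof (rule nn_integral_mono_AE)
    show "AE z in lborel. (\<integral>\<^sup>+\<xi>. ?D z \<xi> \<partial>lborel) \<le> (ennreal (gap m (ln_vec z)) * emeasure lborel (polydisc 1 :: (complex^'n) set)
      + ennreal (osc / real m) * emeasure lborel (polydisc 2 :: (complex^'n) set)) * indicator (polydisc (2*\<rho>)) z"
      using AE_off_axes
    proof eventually_elim
      case (elim z)
      then show ?case using defect_polydisc_mean[of z m] m by (cases "z \<in> polydisc (2*\<rho>)") auto
    qed
  qed
  finally show ?thesis .
qed

lemma ln_vec_bound_integrable:
  assumes "\<rho> \<ge> 0" "c \<ge> 0"
  shows "(\<integral>\<^sup>+z\<in>polydisc \<rho>. ennreal (c * norm (ln_vec (z :: complex^'n))) \<partial>lborel) < \<infinity>"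
proof -
  have "(\<integral>\<^sup>+z\<in>polydisc \<rho>. ennreal (c * norm (ln_vec (z :: complex^'n))) \<partial>lborel) =
     ennreal c * (\<integral>\<^sup>+z\<in>polydisc \<rho>. ennreal (norm (ln_vec (z :: complex^'n))) \<partial>lborel)"
    using assms by (subst nn_integral_cmult[symmetric]) (auto simp: ennreal_mult mult.assoc)
  then show ?thesis using nn_integral_ln_vec_finite[OF assms(1), where 'n='n] by (simp add: ennreal_mult_less_top)
qed

lemma gap_integral_tendsto:
  assumes "\<rho> \<ge> 0"
  shows "(\<lambda>m. \<integral>\<^sup>+z\<in>polydisc \<rho>. ennreal (gap (Suc m) (ln_vec z)) \<partial>lborel) \<longlonglongrightarrow> 0"
proof -
  have "(\<lambda>m. \<integral>\<^sup>+z\<in>polydisc \<rho>. ennreal (gap (Suc m) (ln_vec z)) \<partial>lborel) \<longlonglongrightarrow>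
    (\<integral>\<^sup>+z. 0 \<partial>(lborel :: (complex^'n) measure))"
  proof (rule nn_integral_dominated_convergence[where w = "\<lambda>z. ennreal (2 * C1 * norm (ln_vec z)) * indicator (polydisc \<rho>) z"])
    show "(\<integral>\<^sup>+z\<in>polydisc \<rho>. ennreal (2 * C1 * norm (ln_vec (z :: complex^'n))) \<partial>lborel) < \<infinity>"
      using ln_vec_bound_integrable[of \<rho> "2 * C1"] assms C1 by simp
    show "AE z in lborel. ennreal (gap (Suc m) (ln_vec z)) * indicator (polydisc \<rho>) z
        \<le> ennreal (2 * C1 * norm (ln_vec z)) * indicator (polydisc \<rho>) z" for m
      by (intro AE_I2 mult_right_mono ennreal_leI gap_bound) auto
    show "AE z in lborel. (\<lambda>m. ennreal (gap (Suc m) (ln_vec z)) * indicator (polydisc \<rho>) z) \<longlonglongrightarrow> 0"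
    proof (rule AE_I2)
      fix z :: "complex^'n"
      have "(\<lambda>m. ennreal (gap (Suc m) (ln_vec z))) \<longlonglongrightarrow> ennreal 0"
        by (intro tendsto_ennrealI gap_tendsto)
      then show "(\<lambda>m. ennreal (gap (Suc m) (ln_vec z)) * indicator (polydisc \<rho>) z) \<longlonglongrightarrow> 0"
        by (auto simp: indicator_def)
    qed
  qed measurable
  then show ?thesis by simp
qed

lemma defect_bound_eq:
  "(\<integral>\<^sup>+z\<in>polydisc \<rho>. (ennreal (gap m (ln_vec z)) * c1 + c2) \<partial>lborel) =
    (\<integral>\<^sup>+z\<in>polydisc \<rho>. ennreal (gap m (ln_vec z)) \<partial>lborel) * c1 + c2 * emeasure lborel (polydisc \<rho> :: (complex^'n) set)"
proof -
  have "(\<integral>\<^sup>+z\<in>polydisc \<rho>. (ennreal (gap m (ln_vec z)) * c1 + c2) \<partial>lborel) =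
    (\<integral>\<^sup>+z. (ennreal (gap m (ln_vec z)) * indicator (polydisc \<rho>) z) * c1 + c2 * indicator (polydisc \<rho>) z \<partial>lborel)"
    by (intro nn_integral_cong) (auto simp: indicator_def)
  then show ?thesis by (simp add: nn_integral_add nn_integral_multc nn_integral_cmult_indicator)
qed

lemma
  assumes \<rho>: "\<rho> \<ge> 0"
  shows defect_integral_tendsto: "(\<lambda>m. \<integral>\<^sup>+z\<in>polydisc \<rho>. defect (Suc m) z \<partial>lborel) \<longlonglongrightarrow> 0"
    and defect_integral_finite: "(\<integral>\<^sup>+z\<in>polydisc \<rho>. defect (Suc m) z \<partial>lborel) < \<infinity>"
proof -
  let ?S = "{\<xi> \<in> polydisc 1 :: (complex^'n) set. \<forall>k. 1/2 \<le> norm (\<xi> $ k)}"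
  let ?s = "emeasure lborel ?S"
  let ?e = "\<lambda>r. emeasure lborel (polydisc r :: (complex^'n) set)"
  let ?I = "\<lambda>m. \<integral>\<^sup>+z\<in>polydisc \<rho>. defect (Suc m) z \<partial>lborel"
  let ?G = "\<lambda>m. \<integral>\<^sup>+z\<in>polydisc (2 * \<rho>). ennreal (gap (Suc m) (ln_vec (z :: complex^'n))) \<partial>lborel"
  let ?B = "\<lambda>m. ?G m * ?e 1 + ennreal (osc / real (Suc m)) * ?e 2 * ?e (2 * \<rho>)"
  have s0: "?s \<noteq> 0" using emeasure_shell_pos[where 'n='n] by simp
  have "?s \<le> ?e 1" by (intro emeasure_mono) auto
  then have s1: "?s \<noteq> top" using emeasure_polydisc_finite[of 1, where 'n='n] by (auto simp: top_unique)
  have ef: "?e r < top" for r using emeasure_polydisc_finite[of r, where 'n='n] by simp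
  have sI: "?s * ?I m \<le> ?B m" for m
    using defect_integral_le[of "Suc m" \<rho>] by (simp only: defect_bound_eq zero_less_Suc simp_thms)
  have le: "?I m \<le> ?B m / ?s" for m
  proof -
    have "?I m * ?s / ?s \<le> ?B m / ?s" using sI[of m] by (intro divide_right_mono_ennreal) (simp add: mult.commute)
    then show ?thesis using s0 s1 by (simp add: ennreal_mult_divide_eq)
  qed
  have Gfin: "?G m < top" for m
  proof -
    have "?G m \<le> (\<integral>\<^sup>+z\<in>polydisc (2*\<rho>). ennreal (2 * C1 * norm (ln_vec (z :: complex^'n))) \<partial>lborel)"
      by (intro nn_integral_mono mult_right_mono ennreal_leI gap_bound) auto
    also have "\<dots> < \<infinity>" using ln_vec_bound_integrable[of "2*\<rho>" "2 * C1"] \<rho> C1 by simp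
    finally show ?thesis by simp
  qed
  have "?B m < top" using Gfin[of m] ef by (auto simp: ennreal_mult_less_top)
  then have "?s * ?I m < top" using sI[of m] by (rule le_less_trans[rotated])
  then show "?I m < \<infinity>" using s0 by (auto simp: ennreal_mult_less_top)
  have "?B \<longlonglongrightarrow> 0 * ?e 1 + ennreal 0 * ?e 2 * ?e (2 * \<rho>)"
  proof (intro tendsto_add)
    show "(\<lambda>m. ?G m * ?e 1) \<longlonglongrightarrow> 0 * ?e 1"
      using gap_integral_tendsto[of "2 * \<rho>"] \<rho> ef[of 1] by (intro tendsto_mult_ennreal tendsto_const) auto
    have "(\<lambda>m. osc / real (Suc m)) \<longlonglongrightarrow> 0"
      using LIMSEQ_inverse_real_of_nat tendsto_mult_right_zero[of _ sequentially osc] by (simp add: divide_inverse)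
    then have "(\<lambda>m. ennreal (osc / real (Suc m))) \<longlonglongrightarrow> ennreal 0" by (rule tendsto_ennrealI)
    then have "(\<lambda>m. ennreal (osc / real (Suc m)) * ?e 2) \<longlonglongrightarrow> ennreal 0 * ?e 2"
      using ef[of 2] by (intro tendsto_mult_ennreal tendsto_const) auto
    then show "(\<lambda>m. ennreal (osc / real (Suc m)) * ?e 2 * ?e (2 * \<rho>)) \<longlonglongrightarrow> ennreal 0 * ?e 2 * ?e (2 * \<rho>)"
      by (rule tendsto_mult_ennreal[OF _ tendsto_const]) (use ef[of 2] ef[of "2*\<rho>"] in auto)
  qed
  then have "?B \<longlonglongrightarrow> 0" by simp
  then have "(\<lambda>m. ?B m * inverse ?s) \<longlonglongrightarrow> 0 * inverse ?s"
    by (rule tendsto_mult_ennreal[OF _ tendsto_const]) (use s0 in auto)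
  then have "(\<lambda>m. ?B m / ?s) \<longlonglongrightarrow> 0" by (simp add: divide_ennreal_def)
  then show "?I \<longlonglongrightarrow> 0"
    by (rule tendsto_sandwich[OF _ _ tendsto_const, rotated 2]) (use le in auto)
qed

text \<open>The defect measures the distance of \<open>u (z^m) / m\<close> from \<open>psi (ln_vec z) + v 0 / m\<close> instead of
\<open>psi (ln_vec z)\<close>. The correction \<open>|v 0| / m\<close> tends to 0 uniformly.\<close>

lemma T_op_tendsto_indicator: "L1_loc_tendsto (\<lambda>m. T_op (Suc m) 0 u) (log_psh psi)"
proof -
  let ?F = "log_psh psi"
  have F_AE: "AE z in lborel. ?F z = ereal (psi (ln_vec z))"
    using AE_off_axes by eventually_elim (intro log_psh_eq psi_mono, auto)
  have Fm [measurable]: "?F \<in> borel_measurable borel"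
    by (intro psh_measurable psh_log_psh convex_psi psi_mono)
  have T: "T_op m 0 u z = u (cart_pow m z) / ereal (real m)" for m z
    by (simp add: T_op_def cart_pow_def)
  have Tm [measurable]: "T_op m 0 u \<in> borel_measurable borel" for m
    unfolding T by measurable
  have KD: "\<exists>\<rho>\<ge>0. K \<subseteq> polydisc \<rho>" if K: "compact K" for K :: "(complex^'n) set"
  proof -
    obtain b where "\<And>x. x \<in> K \<Longrightarrow> norm x \<le> b" using compact_imp_bounded[OF K] by (auto simp: bounded_iff)
    then have "K \<subseteq> polydisc (max 0 b)"
      by (auto simp: polydisc_def intro: order_trans[OF Finite_Cartesian_Product.norm_nth_le] le_max_iff_disj[THEN iffD2])
    then show ?thesis by (intro exI[of _ "max 0 b"]) auto
  qed
  have F_int: "(\<integral>\<^sup>+z\<in>polydisc \<rho>. e2ennreal \<bar>?F z\<bar> \<partial>lborel) < \<infinity>" if "\<rho> \<ge> 0" for \<rho>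
  proof -
    have "(\<integral>\<^sup>+z\<in>polydisc \<rho>. e2ennreal \<bar>?F z\<bar> \<partial>lborel) \<le> (\<integral>\<^sup>+z\<in>polydisc \<rho>. ennreal (C1 * norm (ln_vec (z :: complex^'n))) \<partial>lborel)"
      by (rule nn_integral_mono_AE)
        (use F_AE in eventually_elim, auto intro!: mult_right_mono ennreal_leI psi_bound)
    then show ?thesis using ln_vec_bound_integrable[OF that C1] by (rule le_less_trans)
  qed
  have diff_AE: "AE z in lborel. e2ennreal \<bar>T_op (Suc m) 0 u z - ?F z\<bar> \<le> defect (Suc m) z + ennreal (\<bar>v 0\<bar> / real (Suc m))" for m
    using F_AE AE_off_axes
  proof eventually_elim
    case (elim z)
    define U where "U = u (cart_pow (Suc m) z) / ereal (real (Suc m))"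
    define c where "c = v 0 / real (Suc m)"
    have U: "U \<le> ereal (psi (ln_vec z) + c)" unfolding U_def c_def
      by (rule u_cart_pow_le) (use elim in auto)
    have ac: "\<bar>v 0\<bar> / real (Suc m) = \<bar>c\<bar>" by (simp add: c_def)
    have "e2ennreal \<bar>U - ereal (psi (ln_vec z))\<bar> \<le> e2ennreal (ereal (psi (ln_vec z) + c) - U) + ennreal \<bar>c\<bar>"
    proof (cases U)
      case (real r)
      have "\<bar>r - psi (ln_vec z)\<bar> \<le> (psi (ln_vec z) + c - r) + \<bar>c\<bar>" "0 \<le> psi (ln_vec z) + c - r" using U real by auto
      then have "ennreal \<bar>r - psi (ln_vec z)\<bar> \<le> ennreal ((psi (ln_vec z) + c - r) + \<bar>c\<bar>)"
        by (intro ennreal_leI)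
      also have "\<dots> = ennreal (psi (ln_vec z) + c - r) + ennreal \<bar>c\<bar>"
        by (rule ennreal_plus) (use \<open>0 \<le> psi (ln_vec z) + c - r\<close> in auto)
      finally show ?thesis using real by simp
    qed (use U in auto)
    then show ?case unfolding T elim(1) defect_def ac by (simp only: U_def c_def)
  qed
  have diff_int: "(\<integral>\<^sup>+z\<in>K. e2ennreal \<bar>T_op (Suc m) 0 u z - ?F z\<bar> \<partial>lborel) \<le>
     (\<integral>\<^sup>+z\<in>polydisc \<rho>. defect (Suc m) z \<partial>lborel) + ennreal (\<bar>v 0\<bar> / real (Suc m)) * emeasure lborel (polydisc \<rho> :: (complex^'n) set)"
    if K: "K \<subseteq> polydisc \<rho>" for K \<rho> m
  proof -
    have "(\<integral>\<^sup>+z\<in>K. e2ennreal \<bar>T_op (Suc m) 0 u z - ?F z\<bar> \<partial>lborel) \<le>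
      (\<integral>\<^sup>+z. defect (Suc m) z * indicator (polydisc \<rho>) z + ennreal (\<bar>v 0\<bar> / real (Suc m)) * indicator (polydisc \<rho>) z \<partial>lborel)"
      by (rule nn_integral_mono_AE) (use diff_AE[of m] in eventually_elim, use K in \<open>auto simp: indicator_def\<close>)
    also have "\<dots> = (\<integral>\<^sup>+z\<in>polydisc \<rho>. defect (Suc m) z \<partial>lborel) + ennreal (\<bar>v 0\<bar> / real (Suc m)) * emeasure lborel (polydisc \<rho> :: (complex^'n) set)"
      by (subst nn_integral_add) (auto simp: nn_integral_cmult_indicator)
    finally show ?thesis .
  qed
  have ef: "emeasure lborel (polydisc r :: (complex^'n) set) < top" for r using emeasure_polydisc_finite[of r, where 'n='n] by simp
  show ?thesis
    unfolding L1_loc_tendsto_def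
  proof (intro conjI allI impI)
    show F1: "?F \<in> L1_loc" unfolding L1_loc_def
    proof safe
      show "?F \<in> borel_measurable lborel" by simp
      fix K :: "(complex^'n) set" assume "compact K"
      then obtain \<rho> where \<rho>: "\<rho> \<ge> 0" "K \<subseteq> polydisc \<rho>" using KD by blast
      have "(\<integral>\<^sup>+z\<in>K. e2ennreal \<bar>?F z\<bar> \<partial>lborel) \<le> (\<integral>\<^sup>+z\<in>polydisc \<rho>. e2ennreal \<bar>?F z\<bar> \<partial>lborel)"
        using \<rho>(2) by (intro nn_integral_mono) (auto simp: indicator_def)
      then show "(\<integral>\<^sup>+z\<in>K. e2ennreal \<bar>?F z\<bar> \<partial>lborel) < \<infinity>" using F_int[OF \<rho>(1)] by (rule le_less_trans)
    qed
    fix m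
    show "T_op (Suc m) 0 u \<in> L1_loc" unfolding L1_loc_def
    proof safe
      show "T_op (Suc m) 0 u \<in> borel_measurable lborel" by simp
      fix K :: "(complex^'n) set" assume "compact K"
      then obtain \<rho> where \<rho>: "\<rho> \<ge> 0" "K \<subseteq> polydisc \<rho>" using KD by blast
      have "(\<integral>\<^sup>+z\<in>K. e2ennreal \<bar>T_op (Suc m) 0 u z\<bar> \<partial>lborel) \<le>
        (\<integral>\<^sup>+z. e2ennreal \<bar>T_op (Suc m) 0 u z - ?F z\<bar> * indicator (polydisc \<rho>) z + e2ennreal \<bar>?F z\<bar> * indicator (polydisc \<rho>) z \<partial>lborel)"
      proof (rule nn_integral_mono_AE)
        show "AE z in lborel. e2ennreal \<bar>T_op (Suc m) 0 u z\<bar> * indicator K z \<le>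
          e2ennreal \<bar>T_op (Suc m) 0 u z - ?F z\<bar> * indicator (polydisc \<rho>) z + e2ennreal \<bar>?F z\<bar> * indicator (polydisc \<rho>) z"
          using F_AE
        proof eventually_elim
          case (elim z)
          have "e2ennreal \<bar>T_op (Suc m) 0 u z\<bar> \<le> e2ennreal \<bar>T_op (Suc m) 0 u z - ?F z\<bar> + e2ennreal \<bar>?F z\<bar>"
          proof (cases "T_op (Suc m) 0 u z")
            case (real r)
            then show ?thesis unfolding elim real by (simp flip: ennreal_plus)
          qed (auto simp: elim)
          then show ?case using \<rho>(2) by (auto simp: indicator_def)
        qed
      qed
      also have "\<dots> = (\<integral>\<^sup>+z\<in>polydisc \<rho>. e2ennreal \<bar>T_op (Suc m) 0 u z - ?F z\<bar> \<partial>lborel) + (\<integral>\<^sup>+z\<in>polydisc \<rho>. e2ennreal \<bar>?F z\<bar> \<partial>lborel)"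
        by (rule nn_integral_add) measurable
      also have "\<dots> < \<infinity>"
        using le_less_trans[OF diff_int[OF order_refl, of m \<rho>]] defect_integral_finite[OF \<rho>(1), of m] F_int[OF \<rho>(1)] ef[of \<rho>]
        by (simp add: ennreal_mult_less_top)
      finally show "(\<integral>\<^sup>+z\<in>K. e2ennreal \<bar>T_op (Suc m) 0 u z\<bar> \<partial>lborel) < \<infinity>" .
    qed
  next
    fix K :: "(complex^'n) set" assume "compact K"
    then obtain \<rho> where \<rho>: "\<rho> \<ge> 0" "K \<subseteq> polydisc \<rho>" using KD by blast
    let ?c = "emeasure lborel (polydisc \<rho> :: (complex^'n) set)"
    have "(\<lambda>m. \<bar>v 0\<bar> / real (Suc m)) \<longlonglongrightarrow> 0"
      using LIMSEQ_inverse_real_of_nat tendsto_mult_right_zero[of _ sequentially "\<bar>v 0\<bar>"] by (simp add: divide_inverse)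
    then have "(\<lambda>m. ennreal (\<bar>v 0\<bar> / real (Suc m))) \<longlonglongrightarrow> ennreal 0" by (rule tendsto_ennrealI)
    then have "(\<lambda>m. ennreal (\<bar>v 0\<bar> / real (Suc m)) * ?c) \<longlonglongrightarrow> ennreal 0 * ?c"
      using ef[of \<rho>] by (intro tendsto_mult_ennreal tendsto_const) auto
    then have "(\<lambda>m. (\<integral>\<^sup>+z\<in>polydisc \<rho>. defect (Suc m) z \<partial>lborel) + ennreal (\<bar>v 0\<bar> / real (Suc m)) * ?c) \<longlonglongrightarrow> 0 + ennreal 0 * ?c"
      by (intro tendsto_add defect_integral_tendsto \<rho>)
    then have "(\<lambda>m. (\<integral>\<^sup>+z\<in>polydisc \<rho>. defect (Suc m) z \<partial>lborel) + ennreal (\<bar>v 0\<bar> / real (Suc m)) * ?c) \<longlonglongrightarrow> 0" by simp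
    then show "(\<lambda>m. \<integral>\<^sup>+z\<in>K. e2ennreal \<bar>T_op (Suc m) 0 u z - ?F z\<bar> \<partial>lborel) \<longlonglongrightarrow> 0"
      by (rule tendsto_sandwich[OF _ _ tendsto_const, rotated 2]) (use diff_int[OF \<rho>(2)] in auto)
  qed
qed

end

lemma psh_translate:
  assumes "psh u" shows "psh (\<lambda>z. u (x + z))"
  unfolding psh_def
proof (intro conjI allI)
  show "usc (\<lambda>z. u (x + z))"
    unfolding usc_def
  proof
    fix c
    have "open {z. u z < c}" using assms by (simp add: psh_def usc_def)
    then have "open ((+) x -` {z. u z < c})" by (rule open_vimage) (intro continuous_intros)
    then show "open {z. u (x + z) < c}" by (simp add: vimage_def)
  qed
  show "u (x + z) < \<infinity>" for z using assms by (simp add: psh_def)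
  obtain z where "u z \<noteq> -\<infinity>" using assms by (auto simp: psh_def)
  then have "u (x + (z - x)) \<noteq> -\<infinity>" by simp
  then show "\<exists>z. u (x + z) \<noteq> -\<infinity>" by blast
  show "u (x + a) \<le> circle_mean (\<lambda>\<theta>. u (x + (a + cis \<theta> *s b)))" for a b
    using assms by (simp add: psh_def add.assoc[symmetric])
qed

lemma torus_max_translate: "torus_max u x t = torus_max (\<lambda>z. u (x + z)) 0 t"
proof -
  have "{z. \<forall>k. norm (z $ k - x $ k) = exp (t $ k)} = (+) x ` {z. \<forall>k. norm (z $ k - 0 $ k) = exp (t $ k)}" (is "?A = ?B")
  proof safe
    fix z assume "\<forall>k. norm (z $ k - x $ k) = exp (t $ k)"
    then show "z \<in> ?B" by (intro image_eqI[of _ _ "z - x"]) auto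
  qed simp
  then show ?thesis unfolding torus_max_def by (simp add: image_image)
qed

theorem theorem2:
  fixes u :: "complex ^ 'n \<Rightarrow> ereal" and x :: "complex ^ 'n"
  assumes "u \<in> log_class"
  shows "L1_loc_tendsto (\<lambda>m. T_op (Suc m) x u) (indicator_psh u x)"
proof -
  define w where "w = (\<lambda>z. u (x + z))"
  from assms obtain C1 C2 where u: "psh u" and C: "C1 \<ge> 0" "\<And>z. u z \<le> ereal (C1 * ln (max 1 (norm z)) + C2)"
    by (auto simp: log_class_def)
  interpret log_growth w C1 "C1 * ln (1 + norm x) + C2"
  proof
    show "psh w" unfolding w_def by (rule psh_translate[OF u])
    show "C1 \<ge> 0" by fact
    fix z
    have "max 1 (norm (x + z)) \<le> (1 + norm x) * max 1 (norm z)"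
    proof -
      have "norm x * 1 \<le> norm x * max 1 (norm z)" by (intro mult_left_mono) auto
      moreover have "norm x \<ge> 0" by simp
      ultimately show ?thesis using norm_triangle_ineq[of x z] unfolding distrib_right by linarith
    qed
    then have "ln (max 1 (norm (x + z))) \<le> ln ((1 + norm x) * max 1 (norm z))" by (intro ln_mono) auto
    also have "\<dots> = ln (1 + norm x) + ln (max 1 (norm z))"
      by (intro ln_mult_pos) (auto simp: add_pos_nonneg)
    finally have "C1 * ln (max 1 (norm (x + z))) + C2 \<le> C1 * ln (max 1 (norm z)) + (C1 * ln (1 + norm x) + C2)"
      using mult_left_mono[OF _ C(1)] by (fastforce simp: algebra_simps)
    then show "w z \<le> ereal (C1 * ln (max 1 (norm z)) + (C1 * ln (1 + norm x) + C2))"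
      unfolding w_def using C(2)[of "x + z"] by (meson ereal_less_eq(3) order_trans)
  qed
  have "T_op m x u = T_op m 0 w" for m by (simp add: T_op_def w_def fun_eq_iff)
  moreover have "local_indicator u x = local_indicator w 0"
    unfolding local_indicator_def w_def by (simp add: fun_eq_iff flip: torus_max_translate)
  then have "indicator_psh u x = log_psh psi"
    unfolding indicator_psh_eq[symmetric] by (simp add: indicator_psh_def)
  ultimately show ?thesis using T_op_tendsto_indicator by simp
qed

end
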